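(* Let $q\in\mathbb{C}\setminus\{0\}$ be not a root of $1$. The following is a complete list of the $U_q(\mathfrak{sl}_2)$-symmetries $\pi$ on $\operatorname{Pol}(\mathbb{D})_q$; that is, each of the following sets of formulas (for all admissible values of the parameters) determines a well-defined $U_q(\mathfrak{sl}_2)$-symmetry on $\operatorname{Pol}(\mathbb{D})_q$, and every $U_q(\mathfrak{sl}_2)$-symmetry on $\operatorname{Pol}(\mathbb{D})_q$ is given by one of them. Here $\mathsf{k}(u),\mathsf{e}(u),\mathsf{f}(u)$ stand for $\pi(\mathsf{k})(u),\pi(\mathsf{e})(u),\pi(\mathsf{f})(u)$. Series $(0+)$: $\mathsf{k}(z)=z$, $\mathsf{k}(z^* )=z^*$, $\mathsf{e}(z)=\mathsf{e}(z^* )=\mathsf{f}(z)=\mathsf{f}(z^* )=0$. Series $(0-)$: $\mathsf{k}(z)=-z$, $\mathsf{k}(z^* )=-z^*$, $\mathsf{e}(z)=\mathsf{e}(z^* )=\mathsf{f}(z)=\mathsf{f}(z^* )=0$. Series $(1a)$, with parameters $b_0,b_1\in\mathbb{C}$, $b_0\ne 0$: $\mathsf{k}(z)=q^2z$, $\mathsf{k}(z^* )=q^{-2}z^*$, $\mathsf{e}(y)=q^{-1}b_0^{-1}zy$, $\mathsf{e}(z)=qb_0^{-1}z^2$, $\mathsf{e}(z^* )=-q^{-1}b_0^{-1}$, $\mathsf{f}(y)=(b_0y+b_1y^2)z^*$, $\mathsf{f}(z)=-b_0-b_1y^2$, $\mathsf{f}(z^* )=q^2b_0z^{*2}$. Series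 $(1b)$, with parameters $a_0,a_1\in\mathbb{C}$, $a_0\ne 0$: $\mathsf{k}(z)=q^2z$, $\mathsf{k}(z^* )=q^{-2}z^*$, $\mathsf{e}(y)=z(a_0y+a_1y^2)$, $\mathsf{e}(z)=q^2a_0z^2$, $\mathsf{e}(z^* )=-a_0-a_1y^2$, $\mathsf{f}(y)=q^{-1}a_0^{-1}yz^*$, $\mathsf{f}(z)=-q^{-1}a_0^{-1}$, $\mathsf{f}(z^* )=qa_0^{-1}z^{*2}$. Series $(-1a)$, with parameters $b_0,b_1\in\mathbb{C}$, $b_1\ne 0$: $\mathsf{k}(z)=q^{-2}z$, $\mathsf{k}(z^* )=q^{2}z^*$, $\mathsf{e}(y)=-qb_1^{-1}z^*$, $\mathsf{e}(z)=q^{-1}b_1^{-1}$, $\mathsf{e}(z^* )=0$, $\mathsf{f}(y)=z(b_0+b_1y)$, $\mathsf{f}(z)=-q^2b_1z^2$, $\mathsf{f}(z^* )=-q^{-2}b_0+b_1-(1+q^{-2})b_1y$. Series $(-1b)$, with parameters $a_0,a_1\in\mathbb{C}$, $a_1\ne 0$: $\mathsf{k}(z)=q^{-2}z$, $\mathsf{k}(z^* )=q^{2}z^*$, $\mathsf{e}(y)=(a_0+a_1y)z^*$, $\mathsf{e}(z)=-q^{-2}a_0+a_1-(1+q^{-2})a_1y$, $\mathsf{e}(z^* )=-q^2a_1z^{*2}$, $\mathsf{f}(y)=-qa_1^{-1}z$, $\mathsf{f}(z)=0$, $\mathsf{f}(z^* )=q^{-1}a_1^{-1}$.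
   Context: The ground field is $\mathbb{C}$. The quantum disc $\operatorname{Pol}(\mathbb{D})_q$ is the unital $\mathbb{C}$-algebra generated by $z,z^*$ subject to the single relation $zz^*=q^2z^*z+1-q^2$; it is considered as an algebra without involution, so $z^*$ is just a symbol for a second generator, and $z^{*j}=(z^* )^j$. Put $y=1-zz^*$. $U_q(\mathfrak{sl}_2)$ is the unital associative algebra generated by $\mathsf{k},\mathsf{k}^{-1},\mathsf{e},\mathsf{f}$ subject to $\mathsf{k}^{-1}\mathsf{k}=\mathsf{k}\mathsf{k}^{-1}=\mathbf{1}$, $\mathsf{ke}=q^2\mathsf{ek}$, $\mathsf{kf}=q^{-2}\mathsf{fk}$, $\mathsf{ef}-\mathsf{fe}=\frac{\mathsf{k}-\mathsf{k}^{-1}}{q-q^{-1}}$, with Hopf algebra structure $\Delta(\mathsf{k})=\mathsf{k}\otimes\mathsf{k}$, $\Delta(\mathsf{e})=\mathbf{1}\otimes\mathsf{e}+\mathsf{e}\otimes\mathsf{k}$, $\Delta(\mathsf{f})=\mathsf{f}\otimes\mathbf{1}+\mathsf{k}^{-1}\otimes\mathsf{f}$, $\mathsf{S}(\mathsf{k})=\mathsf{k}^{-1}$, $\mathsf{S}(\mathsf{e})=-\mathsf{ek}^{-1}$, $\mathsf{S}(\mathsf{f})=-\mathsf{kf}$, $\varepsilon(\mathsf{k})=1$, $\varepsilon(\mathsf{e})=\varepsilon(\mathsf{f})=0$. For a Hopf algebra $H$ and a unital algebra $A$, an $H$-symmetry on $A$ (structure of $H$-module algebra) is a homomorphism of algebras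 $\pi:H\to\operatorname{End}_{\mathbb{C}}A$ such that $\pi(h)(ab)=\sum_{(h)}\pi(h_{(1)})(a)\,\pi(h_{(2)})(b)$ and $\pi(h)(\mathbf{1})=\varepsilon(h)\mathbf{1}$ for all $h\in H$, $a,b\in A$ (Sweedler notation $\Delta(h)=\sum_{(h)}h_{(1)}\otimes h_{(2)}$). A symmetry is determined by the action of $\mathsf{k},\mathsf{e},\mathsf{f}$ on $z,z^*$; formulas on generators "determine a symmetry" if they extend (necessarily uniquely) to a symmetry. *)

theory Defs
  imports
    Complex_Main
    "HOL-Library.Poly_Mapping"
    "HOL-Library.Product_Plus"
    "HOL-Library.FuncSet"
    "HOL-Algebra.QuotRing"
    "HOL-Algebra.Module"
begin

section \<open>Free algebras and algebras given by generators and relations\<close>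

text \<open>
  The free monoid is written additively, because multiplication of type \<open>\<Rightarrow>\<^sub>0\<close> is convolution
  over an additive monoid of exponents. The free algebra is the monoid algebra of the free monoid.
\<close>

datatype 'x monomial = Mon (letters: "'x list")

instantiation monomial :: (type) monoid_add
begin

definition zero_monomial :: "'a monomial" where
  "0 = Mon []"

definition plus_monomial :: "'a monomial \<Rightarrow> 'a monomial \<Rightarrow> 'a monomial" where
  "u + v = Mon (letters u @ letters v)"

instance
  by standard (simp_all add: zero_monomial_def plus_monomial_def)

end

type_synonym 'x free_alg = "'x monomial \<Rightarrow>\<^sub>0 complex"

definition gen :: "'x \<Rightarrow> 'x free_alg" where
  "gen x = Poly_Mapping.single (Mon [x]) 1"

definition scal :: "complex \<Rightarrow> ('m::monoid_add \<Rightarrow>\<^sub>0 complex)" where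
  "scal c = Poly_Mapping.single 0 c"

definition free_algebra :: "(complex, 'x free_alg) module" where
  "free_algebra = \<lparr>carrier = UNIV, mult = (*), one = 1, zero = 0, add = (+),
     smult = (\<lambda>c p. scal c * p)\<rparr>"

text \<open>The unital homomorphism from the free algebra to \<open>'r\<close> with \<open>x \<mapsto> g x\<close>, where \<open>\<iota>\<close> embeds the
  scalars into \<open>'r\<close>.\<close>

definition free_lift :: "(complex \<Rightarrow> 'r::ring_1) \<Rightarrow> ('x \<Rightarrow> 'r) \<Rightarrow> 'x free_alg \<Rightarrow> 'r" where
  "free_lift \<iota> g p =
     (\<Sum>w\<in>Poly_Mapping.keys p. \<iota> (Poly_Mapping.lookup p w) * prod_list (map g (letters w)))"

text \<open>\<^const>\<open>genideal\<close> is the generated two-sided ideal, and elements of the presented algebra are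
  cosets in the free algebra.\<close>

definition rel_ideal :: "'x free_alg set \<Rightarrow> 'x free_alg set" where
  "rel_ideal R = genideal free_algebra R"

definition pclass :: "'x free_alg set \<Rightarrow> 'x free_alg \<Rightarrow> 'x free_alg set" where
  "pclass R p = rel_ideal R +>\<^bsub>free_algebra\<^esub> p"

definition presented_algebra :: "'x free_alg set \<Rightarrow> (complex, 'x free_alg set) module" where
  "presented_algebra R =
    (let Q = free_algebra Quot (rel_ideal R)
     in \<lparr>carrier = carrier Q, mult = mult Q, one = one Q, zero = zero Q, add = add Q,
         smult = (\<lambda>c X. pclass R (scal c) \<otimes>\<^bsub>Q\<^esub> X)\<rparr>)"


section \<open>Algebra homomorphisms and linear endomorphisms\<close>

text \<open>Maps are extensional, i.e. \<^const>\<open>undefined\<close> outside their domain, so that HOL equality is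
  equality of maps on the carriers.\<close>

definition alg_hom :: "(complex, 'a) module \<Rightarrow> (complex, 'b) module \<Rightarrow> ('a \<Rightarrow> 'b) set" where
  "alg_hom A B =
     {\<phi> \<in> ring_hom A B \<inter> extensional (carrier A).
        \<forall>c. \<forall>x\<in>carrier A. \<phi> (c \<odot>\<^bsub>A\<^esub> x) = c \<odot>\<^bsub>B\<^esub> \<phi> x}"

definition linear_endos :: "(complex, 'a) module \<Rightarrow> ('a \<Rightarrow> 'a) set" where
  "linear_endos A =
     {f \<in> carrier A \<rightarrow>\<^sub>E carrier A.
        (\<forall>x\<in>carrier A. \<forall>y\<in>carrier A. f (x \<oplus>\<^bsub>A\<^esub> y) = f x \<oplus>\<^bsub>A\<^esub> f y) \<and>
        (\<forall>c. \<forall>x\<in>carrier A. f (c \<odot>\<^bsub>A\<^esub> x) = c \<odot>\<^bsub>A\<^esub> f x)}"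

definition End_alg :: "(complex, 'a) module \<Rightarrow> (complex, 'a \<Rightarrow> 'a) module" where
  "End_alg A =
     \<lparr>carrier = linear_endos A,
      mult = (\<lambda>f g. compose (carrier A) f g),
      one = (\<lambda>x\<in>carrier A. x),
      zero = (\<lambda>x\<in>carrier A. \<zero>\<^bsub>A\<^esub>),
      add = (\<lambda>f g. \<lambda>x\<in>carrier A. f x \<oplus>\<^bsub>A\<^esub> g x),
      smult = (\<lambda>c f. \<lambda>x\<in>carrier A. c \<odot>\<^bsub>A\<^esub> f x)\<rparr>"


section \<open>The tensor square and module algebras\<close>

text \<open>
  An element of \<open>H \<otimes> H\<close> is a coset of formal linear combinations of pairs of elements of \<open>H\<close>,
  modulo the span of the bilinearity relations; the formal combination with coefficient \<open>c\<close>
  at \<open>(u, v)\<close> stands for \<open>\<Sum> c u \<otimes> v\<close>.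
\<close>

definition bilinear_rels :: "(complex, 'h) module \<Rightarrow> ('h \<times> 'h \<Rightarrow>\<^sub>0 complex) set" where
  "bilinear_rels H =
     {Poly_Mapping.single (u \<oplus>\<^bsub>H\<^esub> u', v) 1 - Poly_Mapping.single (u, v) 1
        - Poly_Mapping.single (u', v) 1 | u u' v.
        u \<in> carrier H \<and> u' \<in> carrier H \<and> v \<in> carrier H} \<union>
     {Poly_Mapping.single (u, v \<oplus>\<^bsub>H\<^esub> v') 1 - Poly_Mapping.single (u, v) 1
        - Poly_Mapping.single (u, v') 1 | u v v'.
        u \<in> carrier H \<and> v \<in> carrier H \<and> v' \<in> carrier H} \<union>
     {Poly_Mapping.single (c \<odot>\<^bsub>H\<^esub> u, v) 1 - Poly_Mapping.single (u, v) c | c u v.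
        u \<in> carrier H \<and> v \<in> carrier H} \<union>
     {Poly_Mapping.single (u, c \<odot>\<^bsub>H\<^esub> v) 1 - Poly_Mapping.single (u, v) c | c u v.
        u \<in> carrier H \<and> v \<in> carrier H}"

definition tensor_null :: "(complex, 'h) module \<Rightarrow> ('h \<times> 'h \<Rightarrow>\<^sub>0 complex) set" where
  "tensor_null H = Modules.module.span (\<lambda>c t. Poly_Mapping.map ((*) c) t) (bilinear_rels H)"

definition tensor_class ::
  "(complex, 'h) module \<Rightarrow> ('h \<times> 'h \<Rightarrow>\<^sub>0 complex) \<Rightarrow> ('h \<times> 'h \<Rightarrow>\<^sub>0 complex) set" where
  "tensor_class H t = {s. s - t \<in> tensor_null H}"

text \<open>
  \<open>H\<close>-symmetries on \<open>A\<close>, for \<open>H\<close> with comultiplication \<open>\<Delta>\<close> and counit \<open>\<epsilon>\<close> (the antipode does not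
  enter). Each \<open>t \<in> \<Delta> h\<close> is one way of writing \<open>\<Delta> h\<close> as a Sweedler sum \<open>\<Sum> h\<^sub>1 \<otimes> h\<^sub>2\<close>.
\<close>

definition is_symmetry ::
  "(complex, 'h) module \<Rightarrow> ('h \<Rightarrow> ('h \<times> 'h \<Rightarrow>\<^sub>0 complex) set) \<Rightarrow> ('h \<Rightarrow> complex) \<Rightarrow>
   (complex, 'a) module \<Rightarrow> ('h \<Rightarrow> 'a \<Rightarrow> 'a) \<Rightarrow> bool" where
  "is_symmetry H \<Delta> \<epsilon> A \<pi> \<longleftrightarrow>
     \<pi> \<in> alg_hom H (End_alg A) \<and>
     (\<forall>h\<in>carrier H. \<forall>a\<in>carrier A. \<forall>b\<in>carrier A. \<forall>t\<in>\<Delta> h.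
        \<pi> h (a \<otimes>\<^bsub>A\<^esub> b) =
          (\<Oplus>\<^bsub>A\<^esub>p\<in>Poly_Mapping.keys t.
             Poly_Mapping.lookup t p \<odot>\<^bsub>A\<^esub> (\<pi> (fst p) a \<otimes>\<^bsub>A\<^esub> \<pi> (snd p) b))) \<and>
     (\<forall>h\<in>carrier H. \<pi> h \<one>\<^bsub>A\<^esub> = \<epsilon> h \<odot>\<^bsub>A\<^esub> \<one>\<^bsub>A\<^esub>)"


section \<open>The quantum disc\<close>

datatype disc_gen = D_z | D_zs

definition vz :: "disc_gen free_alg" where "vz = gen D_z"
definition vzs :: "disc_gen free_alg" where "vzs = gen D_zs"
definition vy :: "disc_gen free_alg" where "vy = 1 - vz * vzs"

definition disc_rels :: "complex \<Rightarrow> disc_gen free_alg set" where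
  "disc_rels q = {vz * vzs - (scal (q^2) * vzs * vz + scal (1 - q^2))}"

definition disc :: "complex \<Rightarrow> (complex, disc_gen free_alg set) module" where
  "disc q = presented_algebra (disc_rels q)"


section \<open>The quantum group \<open>U\<^sub>q(sl\<^sub>2)\<close>\<close>

datatype uq_gen = U_k | U_kinv | U_e | U_f

definition uq_rels :: "complex \<Rightarrow> uq_gen free_alg set" where
  "uq_rels q =
     {gen U_kinv * gen U_k - 1,
      gen U_k * gen U_kinv - 1,
      gen U_k * gen U_e - scal (q^2) * gen U_e * gen U_k,
      gen U_k * gen U_f - scal (inverse (q^2)) * gen U_f * gen U_k,
      gen U_e * gen U_f - gen U_f * gen U_e
        - scal (1 / (q - inverse q)) * (gen U_k - gen U_kinv)}"

definition uq :: "complex \<Rightarrow> (complex, uq_gen free_alg set) module" where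
  "uq q = presented_algebra (uq_rels q)"

text \<open>
  With \<open>F\<close> the free algebra on the generators of \<open>U\<^sub>q(sl\<^sub>2)\<close>, the algebra \<open>F \<otimes> F\<close> is the monoid
  algebra of pairs of monomials, and \<open>tens u v\<close> is the basis element \<open>u \<otimes> v\<close>.
\<close>

definition tens :: "'x list \<Rightarrow> 'x list \<Rightarrow> ('x monomial \<times> 'x monomial \<Rightarrow>\<^sub>0 complex)" where
  "tens u v = Poly_Mapping.single (Mon u, Mon v) 1"

fun uq_comul_gen :: "uq_gen \<Rightarrow> (uq_gen monomial \<times> uq_gen monomial \<Rightarrow>\<^sub>0 complex)" where
  "uq_comul_gen U_k = tens [U_k] [U_k]"
| "uq_comul_gen U_kinv = tens [U_kinv] [U_kinv]"
| "uq_comul_gen U_e = tens [] [U_e] + tens [U_e] [U_k]"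
| "uq_comul_gen U_f = tens [U_f] [] + tens [U_kinv] [U_f]"

fun uq_counit_gen :: "uq_gen \<Rightarrow> complex" where
  "uq_counit_gen U_k = 1"
| "uq_counit_gen U_kinv = 1"
| "uq_counit_gen U_e = 0"
| "uq_counit_gen U_f = 0"

definition tensor_proj ::
  "'x free_alg set \<Rightarrow> ('x monomial \<times> 'x monomial \<Rightarrow>\<^sub>0 complex) \<Rightarrow>
   ('x free_alg set \<times> 'x free_alg set \<Rightarrow>\<^sub>0 complex)" where
  "tensor_proj R t =
     (\<Sum>(u, v)\<in>Poly_Mapping.keys t.
        Poly_Mapping.single
          (pclass R (Poly_Mapping.single u 1), pclass R (Poly_Mapping.single v 1))
          (Poly_Mapping.lookup t (u, v)))"

text \<open>
  The homomorphisms \<open>F \<rightarrow> F \<otimes> F\<close> and \<open>F \<rightarrow> \<complex>\<close>, pushed down to \<open>U\<^sub>q(sl\<^sub>2)\<close>. As for multiplication of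
  cosets in \<^const>\<open>rcoset_mult\<close>, the union is over all representatives of \<open>X\<close>; they all
  give the same class in the tensor square.
\<close>

definition uq_comul ::
  "complex \<Rightarrow> uq_gen free_alg set \<Rightarrow>
   (uq_gen free_alg set \<times> uq_gen free_alg set \<Rightarrow>\<^sub>0 complex) set" where
  "uq_comul q X =
     (\<Union>x\<in>X. tensor_class (uq q) (tensor_proj (uq_rels q) (free_lift scal uq_comul_gen x)))"

definition uq_counit :: "uq_gen free_alg set \<Rightarrow> complex" where
  "uq_counit X = the_elem (free_lift id uq_counit_gen ` X)"


section \<open>Symmetries on the quantum disc and the series in the list\<close>

type_synonym action =
  "uq_gen free_alg set \<Rightarrow> disc_gen free_alg set \<Rightarrow> disc_gen free_alg set"

definition disc_symmetry :: "complex \<Rightarrow> action \<Rightarrow> bool" where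
  "disc_symmetry q \<pi> \<longleftrightarrow> is_symmetry (uq q) (uq_comul q) uq_counit (disc q) \<pi>"

text \<open>\<open>acts q \<pi> g p r\<close>: the generator \<open>g\<close> takes the element \<open>p\<close> of the quantum disc to \<open>r\<close>, where
  \<open>p\<close> and \<open>r\<close> are given as noncommutative polynomials in \<open>z\<close>, \<open>z\<^sup>*\<close>.\<close>

definition acts ::
  "complex \<Rightarrow> action \<Rightarrow> uq_gen \<Rightarrow> disc_gen free_alg \<Rightarrow> disc_gen free_alg \<Rightarrow> bool" where
  "acts q \<pi> g p r \<longleftrightarrow>
     \<pi> (pclass (uq_rels q) (gen g)) (pclass (disc_rels q) p) = pclass (disc_rels q) r"

definition series_0plus :: "complex \<Rightarrow> action \<Rightarrow> bool" where
  "series_0plus q \<pi> \<longleftrightarrow>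
     acts q \<pi> U_k vz vz \<and>
     acts q \<pi> U_k vzs vzs \<and>
     acts q \<pi> U_e vz 0 \<and>
     acts q \<pi> U_e vzs 0 \<and>
     acts q \<pi> U_f vz 0 \<and>
     acts q \<pi> U_f vzs 0"

definition series_0minus :: "complex \<Rightarrow> action \<Rightarrow> bool" where
  "series_0minus q \<pi> \<longleftrightarrow>
     acts q \<pi> U_k vz (- vz) \<and>
     acts q \<pi> U_k vzs (- vzs) \<and>
     acts q \<pi> U_e vz 0 \<and>
     acts q \<pi> U_e vzs 0 \<and>
     acts q \<pi> U_f vz 0 \<and>
     acts q \<pi> U_f vzs 0"

definition series_1a :: "complex \<Rightarrow> complex \<Rightarrow> complex \<Rightarrow> action \<Rightarrow> bool" where
  "series_1a q b0 b1 \<pi> \<longleftrightarrow>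
     acts q \<pi> U_k vz (scal (q^2) * vz) \<and>
     acts q \<pi> U_k vzs (scal (inverse (q^2)) * vzs) \<and>
     acts q \<pi> U_e vy (scal (inverse q * inverse b0) * vz * vy) \<and>
     acts q \<pi> U_e vz (scal (q * inverse b0) * vz^2) \<and>
     acts q \<pi> U_e vzs (scal (- inverse q * inverse b0)) \<and>
     acts q \<pi> U_f vy ((scal b0 * vy + scal b1 * vy^2) * vzs) \<and>
     acts q \<pi> U_f vz (- scal b0 - scal b1 * vy^2) \<and>
     acts q \<pi> U_f vzs (scal (q^2 * b0) * vzs^2)"

definition series_1b :: "complex \<Rightarrow> complex \<Rightarrow> complex \<Rightarrow> action \<Rightarrow> bool" where
  "series_1b q a0 a1 \<pi> \<longleftrightarrow>
     acts q \<pi> U_k vz (scal (q^2) * vz) \<and>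
     acts q \<pi> U_k vzs (scal (inverse (q^2)) * vzs) \<and>
     acts q \<pi> U_e vy (vz * (scal a0 * vy + scal a1 * vy^2)) \<and>
     acts q \<pi> U_e vz (scal (q^2 * a0) * vz^2) \<and>
     acts q \<pi> U_e vzs (- scal a0 - scal a1 * vy^2) \<and>
     acts q \<pi> U_f vy (scal (inverse q * inverse a0) * vy * vzs) \<and>
     acts q \<pi> U_f vz (scal (- inverse q * inverse a0)) \<and>
     acts q \<pi> U_f vzs (scal (q * inverse a0) * vzs^2)"

definition series_m1a :: "complex \<Rightarrow> complex \<Rightarrow> complex \<Rightarrow> action \<Rightarrow> bool" where
  "series_m1a q b0 b1 \<pi> \<longleftrightarrow>
     acts q \<pi> U_k vz (scal (inverse (q^2)) * vz) \<and>
     acts q \<pi> U_k vzs (scal (q^2) * vzs) \<and>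
     acts q \<pi> U_e vy (scal (- q * inverse b1) * vzs) \<and>
     acts q \<pi> U_e vz (scal (inverse q * inverse b1)) \<and>
     acts q \<pi> U_e vzs 0 \<and>
     acts q \<pi> U_f vy (vz * (scal b0 + scal b1 * vy)) \<and>
     acts q \<pi> U_f vz (scal (- (q^2) * b1) * vz^2) \<and>
     acts q \<pi> U_f vzs
       (scal (- inverse (q^2) * b0 + b1) - scal ((1 + inverse (q^2)) * b1) * vy)"

definition series_m1b :: "complex \<Rightarrow> complex \<Rightarrow> complex \<Rightarrow> action \<Rightarrow> bool" where
  "series_m1b q a0 a1 \<pi> \<longleftrightarrow>
     acts q \<pi> U_k vz (scal (inverse (q^2)) * vz) \<and>
     acts q \<pi> U_k vzs (scal (q^2) * vzs) \<and>
     acts q \<pi> U_e vy ((scal a0 + scal a1 * vy) * vzs) \<and>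
     acts q \<pi> U_e vz
       (scal (- inverse (q^2) * a0 + a1) - scal ((1 + inverse (q^2)) * a1) * vy) \<and>
     acts q \<pi> U_e vzs (scal (- (q^2) * a1) * vzs^2) \<and>
     acts q \<pi> U_f vy (scal (- q * inverse a1) * vz) \<and>
     acts q \<pi> U_f vz 0 \<and>
     acts q \<pi> U_f vzs (scal (inverse q * inverse a1))"

end

theory Submission
  imports Defs "HOL-Computational_Algebra.Polynomial"
begin

text \<open>
  The disc embeds into the algebra of band matrices, \<open>z\<close> going to the shift \<open>t\<close>, \<open>y\<close> to the diagonal
  matrix of the \<open>s\<^sub>i\<close> with \<open>s\<^sub>i = q\<^sup>-\<^sup>2s\<^sub>i\<^sub>-\<^sub>1\<close>, and \<open>z\<^sup>*\<close> to \<open>t\<^sup>-\<^sup>1(1 - y)\<close>. There \<open>y\<close> is invertible, and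
  this makes every symmetry with \<open>e \<noteq> 0\<close> inner: \<open>k\<close> scales the \<open>n\<close>-th diagonal by \<open>\<lambda>\<^sup>n\<close>, where
  \<open>\<lambda>\<^sup>m = q\<^sup>2\<close> for some integer \<open>m\<close>, and \<open>e(u) = uX - Xk(u)\<close>, \<open>f(u) = X'u - k\<^sup>-\<^sup>1(u)X'\<close> with
  \<open>X = x(y)t\<^sup>m\<close>, \<open>X' = x'(y)t\<^sup>-\<^sup>m\<close>. The relation between \<open>e\<close> and \<open>f\<close> becomes a linear recurrence for
  \<open>h = XX'\<close>, which leaves \<open>h\<close> with constant term and at most the exponents \<open>j\<close> of \<open>y\<close> with
  \<open>mj \<in> {1, 2}\<close>. That \<open>e\<close> and \<open>f\<close> preserve the disc forces factors into \<open>h\<close> whose degrees then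
  leave only \<open>m = \<plusminus>1\<close> and the four series. Conversely, such \<open>X\<close> and \<open>X'\<close> satisfy the relations of
  \<open>U\<^sub>q(sl\<^sub>2)\<close> on all band matrices, so that only the invariance of the disc is left to check. That
  \<open>k(z)\<close> is a multiple of \<open>z\<close> follows from the facts that commutators lie in the ideal \<open>yD\<close> and that
  the units of the disc \<open>D\<close> are scalars.
\<close>



section \<open>Free and presented algebras\<close>

text \<open>The element X behind \<open>e\<close> is found by dividing by y, which is why the disc
  is replaced by its image in a larger ring. Indexing by all integers makes both y and the shift
  invertible there. As K fixes y, the equation E(y) = yX - Xy is solved entry by entry: on diagonal
  m, commuting with y multiplies by \<open>s i - s (i - m)\<close>, nonzero for m \<noteq> 0 because
  q is not a root of 1. The values on z and \<open>w\<close> then follow from yz = q^-2 zy and yw =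
  q^2 wy. Two facts carry the classification. On each diagonal the entries of an element of the disc
  are polynomials in s i; as the s i are infinitely many, these polynomials may be compared by
  coefficients and evaluated at 0, although 0 is no s i. And with T = X'X - q^-2 XX', the relation
  between e and f makes T - 1/(q - q^-1) a multiple of the sequence l^(-2i), where \<open>l\<close>
  is \<lambda>. Translation by m multiplies this sequence by l^(-2m) = q^-4, which removes the
  unknown multiple. The resulting second-order recurrence has the characteristic values q^-2 and
  q^-4, and they are the origin of the condition mj = 1 or mj = 2.\<close>

lemma poly_mapping_induct_single [case_names single add]:
  fixes P :: "('a \<Rightarrow>\<^sub>0 'b::ab_group_add) \<Rightarrow> bool"
  assumes single: "\<And>k v. P (Poly_Mapping.single k v)"
    and add: "\<And>p r. P p \<Longrightarrow> P r \<Longrightarrow> P (p + r)"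
  shows "P p"
proof (induction p rule: update_induct)
  case const
  show ?case using single[of undefined 0] by simp
next
  case (update p a b)
  have "Poly_Mapping.update a b p = p + Poly_Mapping.single a b"
    using update(1)
    by (intro poly_mapping_eqI)
       (auto simp: lookup_update lookup_add lookup_single in_keys_iff when_def)
  then show ?case using update single add by metis
qed

lemma scal_single: "scal c * Poly_Mapping.single k v = Poly_Mapping.single k (c * v)"
  by (simp add: scal_def mult_single)

lemma single_scal: "Poly_Mapping.single k v * scal c = Poly_Mapping.single k (c * v)"
  by (simp add: scal_def mult_single mult.commute)

lemma scal_central: "scal c * p = p * scal c"
  by (induction p rule: poly_mapping_induct_single)
     (simp_all add: scal_single single_scal distrib_left distrib_right)

lemma scal_add: "scal (c + d) = scal c + scal d"
  by (simp add: scal_def single_add)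

lemma scal_diff: "scal (c - d) = scal c - scal d"
  by (simp add: scal_def single_diff)

lemma scal_uminus: "scal (- c) = - scal c"
  by (simp add: scal_def single_uminus)

lemma scal_mult: "scal (c * d) = scal c * scal d"
  by (simp add: scal_def mult_single)

lemma scal_0 [simp]: "scal 0 = 0"
  by (simp add: scal_def)

lemma scal_1 [simp]: "scal 1 = 1"
  by (simp add: scal_def)

lemma single_monomial:
  "Poly_Mapping.single w c = scal c * prod_list (map gen (letters w))"
proof -
  have "Poly_Mapping.single (Mon xs) 1 = prod_list (map gen xs)" for xs :: "'a list"
  proof (induction xs)
    case Nil
    then show ?case by (metis list.simps(8) prod_list.Nil single_one zero_monomial_def)
  next
    case (Cons x xs)
    have "Poly_Mapping.single (Mon (x # xs)) 1 =
        Poly_Mapping.single (Mon [x]) 1 * Poly_Mapping.single (Mon xs) (1 :: complex)"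
      by (simp add: mult_single plus_monomial_def)
    then show ?case by (simp add: Cons gen_def)
  qed
  then have "prod_list (map gen (letters w)) = Poly_Mapping.single w 1"
    by (metis monomial.collapse)
  then show ?thesis by (simp add: scal_single)
qed

text \<open>The step multiplies by one generator on the left because the product rules, the words
  and the comultiplication used below are all unfolded from the leftmost letter.\<close>

lemma free_alg_induct [case_names scal gen add]:
  assumes scal: "\<And>c. P (scal c)"
    and gen: "\<And>x p. P p \<Longrightarrow> P (gen x * p)"
    and add: "\<And>p r. P p \<Longrightarrow> P r \<Longrightarrow> P (p + r)"
  shows "P (p :: 'x free_alg)"
proof (induction p rule: poly_mapping_induct_single)
  case (single w c)
  have "P (scal c * prod_list (map gen xs))" for xs
  proof (induction xs)
    case Nil
    then show ?case using scal by simp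
  next
    case (Cons x xs)
    have "scal c * (gen x * prod_list (map gen xs)) = gen x * (scal c * prod_list (map gen xs))"
      by (metis mult.assoc scal_central)
    then show ?case using Cons gen by simp
  qed
  then show ?case by (metis single_monomial)
qed (rule add)

text \<open>Universal property of the free algebra. The target may be noncommutative, hence
  \<open>\<iota>_central\<close>: scalars have to commute with the images of the generators, and
  then commute with all words. The instances are the representation by band matrices, the
  comultiplication and the counit.\<close>

locale alg_lift =
  fixes \<iota> :: "complex \<Rightarrow> 'r::ring_1" and g :: "'x \<Rightarrow> 'r"
  assumes \<iota>_add: "\<iota> (c + d) = \<iota> c + \<iota> d"
    and \<iota>_mult: "\<iota> (c * d) = \<iota> c * \<iota> d"
    and \<iota>_one: "\<iota> 1 = 1"
    and \<iota>_central: "\<iota> c * g x = g x * \<iota> c"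
begin

abbreviation "\<phi> \<equiv> free_lift \<iota> g"

lemma \<iota>_zero: "\<iota> 0 = 0"
  using \<iota>_add[of 0 0] by simp

lemma \<iota>_central_word: "\<iota> c * prod_list (map g xs) = prod_list (map g xs) * \<iota> c"
  by (induction xs) (simp_all, metis \<iota>_central mult.assoc)

lemma add: "\<phi> (p + r) = \<phi> p + \<phi> r"
  unfolding free_lift_def
  by (rule setsum_keys_plus_distrib) (simp_all add: \<iota>_zero \<iota>_add distrib_right)

lemma single: "\<phi> (Poly_Mapping.single w c) = \<iota> c * prod_list (map g (letters w))"
  by (simp add: free_lift_def \<iota>_zero)

lemma zero: "\<phi> 0 = 0"
  by (simp add: free_lift_def)

lemma gen: "\<phi> (gen x) = g x"
  by (simp add: gen_def single \<iota>_one)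

lemma scal: "\<phi> (scal c) = \<iota> c"
  by (simp add: scal_def single zero_monomial_def)

lemma one: "\<phi> 1 = 1"
  by (metis scal scal_1 \<iota>_one)

lemma mult: "\<phi> (p * r) = \<phi> p * \<phi> r"
proof (induction p rule: poly_mapping_induct_single)
  case (single w c)
  note sw = single
  show ?case
  proof (induction r rule: poly_mapping_induct_single)
    case (single v d)
    have "\<phi> (Poly_Mapping.single w c * Poly_Mapping.single v d) =
        \<iota> c * (\<iota> d * prod_list (map g (letters w))) * prod_list (map g (letters v))"
      by (simp add: mult_single alg_lift.single[OF alg_lift_axioms] plus_monomial_def \<iota>_mult mult.assoc)
    then show ?case
      unfolding \<iota>_central_word by (simp add: alg_lift.single[OF alg_lift_axioms] mult.assoc)
  qed (simp add: distrib_left add)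
qed (simp add: distrib_right add)

lemma minus: "\<phi> (p - r) = \<phi> p - \<phi> r"
  by (metis add add_diff_cancel diff_add_cancel)

lemma uminus: "\<phi> (- p) = - \<phi> p"
  by (metis minus zero diff_0)

lemma power: "\<phi> (p ^ n) = \<phi> p ^ n"
  by (induction n) (simp_all add: mult one)

lemmas hom_simps = add mult minus uminus zero one power gen scal

end

section \<open>The free algebra as a ring, its ideal of relations and the cosets\<close>

interpretation free_ring: ring "free_algebra :: (complex, 'x free_alg) module"
proof (rule ringI)
  show "abelian_group (free_algebra :: (complex, 'x free_alg) module)"
  proof (rule abelian_groupI)
    fix x :: "'x free_alg"
    show "\<exists>y\<in>carrier free_algebra. y \<oplus>\<^bsub>free_algebra\<^esub> x = \<zero>\<^bsub>free_algebra\<^esub>"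
      by (rule bexI[of _ "- x"]) (simp_all add: free_algebra_def)
  qed (simp_all add: free_algebra_def add_ac)
  show "monoid (free_algebra :: (complex, 'x free_alg) module)"
    by (rule monoidI) (simp_all add: free_algebra_def mult.assoc)
qed (simp_all add: free_algebra_def distrib_left distrib_right)

lemma free_algebra_simps [simp]:
  "carrier free_algebra = UNIV"
  "x \<otimes>\<^bsub>free_algebra\<^esub> y = x * y"
  "x \<oplus>\<^bsub>free_algebra\<^esub> y = x + y"
  "\<one>\<^bsub>free_algebra\<^esub> = 1"
  "\<zero>\<^bsub>free_algebra\<^esub> = 0"
  "c \<odot>\<^bsub>free_algebra\<^esub> x = scal c * x"
  by (simp_all add: free_algebra_def)

lemma ideal_free_algebraI:
  assumes "0 \<in> I" "\<And>x y. x \<in> I \<Longrightarrow> y \<in> I \<Longrightarrow> x + y \<in> I"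
    "\<And>x y. x \<in> I \<Longrightarrow> y * x \<in> I" "\<And>x y. x \<in> I \<Longrightarrow> x * y \<in> I"
  shows "ideal I (free_algebra :: (complex, 'x free_alg) module)"
proof (rule idealI)
  have inv: "a_inv free_algebra x = - x" for x :: "'x free_alg"
    using free_ring.minus_equality[of "- x" x] by simp
  show "subgroup I (add_monoid (free_algebra :: (complex, 'x free_alg) module))"
  proof (rule subgroup.intro)
    fix x assume "x \<in> I"
    then have "a_inv free_algebra x \<in> I" unfolding inv using assms(3)[of x "-1"] by simp
    then show "inv\<^bsub>add_monoid free_algebra\<^esub> x \<in> I" by (simp only: a_inv_def)
  qed (use assms(1,2) in auto)
qed (use assms free_ring.ring_axioms in auto)

lemma ideal_rel_ideal: "ideal (rel_ideal R) (free_algebra :: (complex, 'x free_alg) module)"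
  unfolding rel_ideal_def by (rule free_ring.genideal_ideal) simp

lemma rel_ideal_base: "r \<in> R \<Longrightarrow> r \<in> rel_ideal R"
  unfolding rel_ideal_def using free_ring.genideal_self[of R] by auto

lemma rel_ideal_zero: "0 \<in> rel_ideal R"
  using additive_subgroup.zero_closed[OF ideal.axioms(1)[OF ideal_rel_ideal]] by fastforce

lemma rel_ideal_add: "x \<in> rel_ideal R \<Longrightarrow> y \<in> rel_ideal R \<Longrightarrow> x + y \<in> rel_ideal R"
  using additive_subgroup.a_closed[OF ideal.axioms(1)[OF ideal_rel_ideal]] by fastforce

lemma rel_ideal_mult_left: "x \<in> rel_ideal R \<Longrightarrow> y * x \<in> rel_ideal R"
  using ideal.I_l_closed[OF ideal_rel_ideal] by fastforce

lemma rel_ideal_mult_right: "x \<in> rel_ideal R \<Longrightarrow> x * y \<in> rel_ideal R"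
  using ideal.I_r_closed[OF ideal_rel_ideal] by fastforce

lemma rel_ideal_uminus: "x \<in> rel_ideal R \<Longrightarrow> - x \<in> rel_ideal R"
  using rel_ideal_mult_left[of x R "-1"] by simp

lemma rel_ideal_diff: "x \<in> rel_ideal R \<Longrightarrow> y \<in> rel_ideal R \<Longrightarrow> x - y \<in> rel_ideal R"
  using rel_ideal_add[OF _ rel_ideal_uminus, of x R y] by simp

text \<open>Serves as an induction over the ideal. In its uses \<open>I\<close> is the kernel of a
  map that is known to kill the relators.\<close>

lemma rel_ideal_subset:
  assumes "0 \<in> I" "\<And>x y. x \<in> I \<Longrightarrow> y \<in> I \<Longrightarrow> x + y \<in> I"
    "\<And>x y. x \<in> I \<Longrightarrow> y * x \<in> I" "\<And>x y. x \<in> I \<Longrightarrow> x * y \<in> I" "R \<subseteq> I"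
  shows "rel_ideal R \<subseteq> I"
  unfolding rel_ideal_def
  by (rule free_ring.genideal_minimal[OF ideal_free_algebraI]) (use assms in auto)

lemma (in alg_lift) vanishes_on_rel_ideal:
  assumes "\<And>r. r \<in> R \<Longrightarrow> \<phi> r = 0" and "p \<in> rel_ideal R"
  shows "\<phi> p = 0"
proof -
  have "rel_ideal R \<subseteq> {p. \<phi> p = 0}"
    by (rule rel_ideal_subset) (auto simp: assms(1) hom_simps)
  then show ?thesis using assms(2) by auto
qed

lemma mem_pclass_iff: "x \<in> pclass R p \<longleftrightarrow> x - p \<in> rel_ideal R"
  by (auto simp: pclass_def a_r_coset_def' intro: bexI[of _ "x - p"])

lemma pclass_self: "p \<in> pclass R p"
  by (simp add: mem_pclass_iff rel_ideal_zero)

lemma pclass_eq_iff: "pclass R p = pclass R r \<longleftrightarrow> p - r \<in> rel_ideal R"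
proof
  assume "pclass R p = pclass R r"
  then show "p - r \<in> rel_ideal R" using pclass_self mem_pclass_iff by metis
next
  assume pr: "p - r \<in> rel_ideal R"
  have "x - p \<in> rel_ideal R \<longleftrightarrow> x - r \<in> rel_ideal R" for x
    using rel_ideal_add[OF _ pr, of "x - p"] rel_ideal_diff[OF _ pr, of "x - r"] by auto
  then show "pclass R p = pclass R r" by (auto simp: mem_pclass_iff)
qed

lemma presented_carrier: "carrier (presented_algebra R) = range (pclass R)"
  by (auto simp: presented_algebra_def Let_def FactRing_def A_RCOSETS_def' pclass_def)

lemma presented_mult: "pclass R p \<otimes>\<^bsub>presented_algebra R\<^esub> pclass R r = pclass R (p * r)"
  using ideal.rcoset_mult_add[OF ideal_rel_ideal, of p r R]
  by (simp add: presented_algebra_def Let_def FactRing_def pclass_def)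

lemma presented_add: "pclass R p \<oplus>\<^bsub>presented_algebra R\<^esub> pclass R r = pclass R (p + r)"
  using abelian_subgroup.a_rcos_sum[OF abelian_subgroupI3[OF ideal.axioms(1)[OF ideal_rel_ideal] free_ring.abelian_group_axioms], of p r R]
  by (simp add: presented_algebra_def Let_def FactRing_def pclass_def)

lemma presented_one: "\<one>\<^bsub>presented_algebra R\<^esub> = pclass R 1"
  by (simp add: presented_algebra_def Let_def FactRing_def pclass_def)

lemma presented_zero: "\<zero>\<^bsub>presented_algebra R\<^esub> = pclass R 0"
proof -
  have "\<zero>\<^bsub>presented_algebra R\<^esub> = rel_ideal R"
    by (simp add: presented_algebra_def Let_def FactRing_def)
  also have "\<dots> = pclass R 0" by (auto simp: mem_pclass_iff)
  finally show ?thesis .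
qed

lemma presented_smult: "c \<odot>\<^bsub>presented_algebra R\<^esub> pclass R p = pclass R (scal c * p)"
  using presented_mult[of R "scal c" p] by (simp add: presented_algebra_def Let_def)

lemmas presented_simps =
  presented_mult presented_add presented_one presented_zero presented_smult


section \<open>Matrices with finitely many diagonals\<close>

text \<open>\<open>ent u n\<close> is the sequence on the \<open>n\<close>-th diagonal: \<open>u\<close> stands for the operator
  \<open>g \<mapsto> (\<lambda>i. \<Sum>\<^sub>n ent u n i * g (i - n))\<close> on functions on the integers.\<close>

typedef band = "{u :: int \<Rightarrow> int \<Rightarrow> complex. finite {n. u n \<noteq> (\<lambda>_. 0)}}"
  morphisms ent Band
  by (rule exI[of _ "\<lambda>_ _. 0"]) simp

setup_lifting type_definition_band

definition supp :: "band \<Rightarrow> int set" where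
  "supp u = {n. ent u n \<noteq> (\<lambda>_. 0)}"

lemma finite_supp [simp]: "finite (supp u)"
  using ent[of u] by (simp add: supp_def)

lemma ent_outside: "n \<notin> supp u \<Longrightarrow> ent u n i = 0"
  by (simp add: supp_def)

lemma band_eqI: "(\<And>n i. ent u n i = ent v n i) \<Longrightarrow> u = v"
  by (metis ent_inverse ext)

lemma finite_diagonals:
  fixes f :: "complex \<Rightarrow> complex \<Rightarrow> complex" and u v :: "int \<Rightarrow> int \<Rightarrow> complex"
  assumes "finite {n. u n \<noteq> (\<lambda>_. 0)}" "finite {n. v n \<noteq> (\<lambda>_. 0)}" "f 0 0 = 0"
  shows "finite {n. (\<lambda>i. f (u n i) (v n i)) \<noteq> (\<lambda>_. 0)}"
proof (rule finite_subset)
  show "{n. (\<lambda>i. f (u n i) (v n i)) \<noteq> (\<lambda>_. 0)}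
      \<subseteq> {n. u n \<noteq> (\<lambda>_. 0)} \<union> {n. v n \<noteq> (\<lambda>_. 0)}"
    using assms(3) by (auto simp: fun_eq_iff) metis
qed (use assms in simp)

instantiation band :: ring_1
begin

lift_definition zero_band :: band is "\<lambda>_ _. 0" by simp

lift_definition one_band :: band is "\<lambda>n _. if n = 0 then 1 else 0"
  by (rule finite_subset[of _ "{0}"]) auto

lift_definition plus_band :: "band \<Rightarrow> band \<Rightarrow> band" is "\<lambda>u v n i. u n i + v n i"
  by (rule finite_diagonals) simp_all

lift_definition uminus_band :: "band \<Rightarrow> band" is "\<lambda>u n i. - u n i"
  by (erule finite_subset[rotated]) (auto simp: fun_eq_iff)

lift_definition minus_band :: "band \<Rightarrow> band \<Rightarrow> band" is "\<lambda>u v n i. u n i - v n i"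
  by (rule finite_diagonals) simp_all

lift_definition times_band :: "band \<Rightarrow> band \<Rightarrow> band" is
  "\<lambda>u v n i. \<Sum>m | u m \<noteq> (\<lambda>_. 0). u m i * v (n - m) (i - m)"
proof -
  fix u v :: "int \<Rightarrow> int \<Rightarrow> complex"
  let ?A = "{m. u m \<noteq> (\<lambda>_. 0)}" and ?B = "{m. v m \<noteq> (\<lambda>_. 0)}"
  assume "finite ?A" "finite ?B"
  then have "finite ((\<lambda>(a, b). a + b) ` (?A \<times> ?B))" by simp
  moreover have "{n. (\<lambda>i. \<Sum>m\<in>?A. u m i * v (n - m) (i - m)) \<noteq> (\<lambda>_. 0)}
      \<subseteq> (\<lambda>(a, b). a + b) ` (?A \<times> ?B)"
  proof
    fix n assume "n \<in> {n. (\<lambda>i. \<Sum>m\<in>?A. u m i * v (n - m) (i - m)) \<noteq> (\<lambda>_. 0)}"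
    then obtain i where "(\<Sum>m\<in>?A. u m i * v (n - m) (i - m)) \<noteq> 0" by auto
    then obtain m where "m \<in> ?A" "u m i * v (n - m) (i - m) \<noteq> 0"
      by (meson sum.not_neutral_contains_not_neutral)
    then show "n \<in> (\<lambda>(a, b). a + b) ` (?A \<times> ?B)"
      by (intro image_eqI[of _ _ "(m, n - m)"]) auto
  qed
  ultimately show "finite {n. (\<lambda>i. \<Sum>m\<in>?A. u m i * v (n - m) (i - m)) \<noteq> (\<lambda>_. 0)}"
    by (rule finite_subset[rotated])
qed

text \<open>Enlarging the support to any finite set adds only zero terms. This puts products with
  different left factors over one index set, which distributivity and associativity rely on.\<close>

lemma ent_mult_superset:
  assumes "finite S" "supp u \<subseteq> S"
  shows "ent (u * v) n i = (\<Sum>m\<in>S. ent u m i * ent v (n - m) (i - m))"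
proof -
  have "ent (u * v) n i = (\<Sum>m\<in>supp u. ent u m i * ent v (n - m) (i - m))"
    unfolding supp_def by transfer simp
  also have "\<dots> = (\<Sum>m\<in>S. ent u m i * ent v (n - m) (i - m))"
    by (rule sum.mono_neutral_left) (use assms in \<open>auto simp: supp_def\<close>)
  finally show ?thesis .
qed

instance
proof
  fix u v w :: band
  show "u * v * w = u * (v * w)"
  proof (rule band_eqI)
    fix n i
    let ?A = "supp u" and ?B = "supp v"
    let ?C = "(\<lambda>(a, b). a + b) ` (?A \<times> ?B)"
    have sub: "supp (u * v) \<subseteq> ?C"
    proof
      fix m assume "m \<in> supp (u * v)"
      then obtain j where "ent (u * v) m j \<noteq> 0" by (auto simp: supp_def)
      then obtain l where "l \<in> ?A" "ent u l j * ent v (m - l) (j - l) \<noteq> 0"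
        unfolding ent_mult_superset[OF finite_supp order_refl]
        by (meson sum.not_neutral_contains_not_neutral)
      then show "m \<in> ?C"
        by (intro image_eqI[of _ _ "(l, m - l)"]) (auto simp: supp_def)
    qed
    have "ent (u * v * w) n i = (\<Sum>m\<in>?C. ent (u * v) m i * ent w (n - m) (i - m))"
      by (rule ent_mult_superset[OF _ sub]) simp
    also have "\<dots> = (\<Sum>m\<in>?C. \<Sum>l\<in>?A. ent u l i * ent v (m - l) (i - l) * ent w (n - m) (i - m))"
      by (simp add: ent_mult_superset[OF finite_supp order_refl] sum_distrib_right)
    also have "\<dots> = (\<Sum>l\<in>?A. \<Sum>m\<in>?C. ent u l i * ent v (m - l) (i - l) * ent w (n - m) (i - m))"
      by (rule sum.swap)
    \<comment> \<open>For fixed l a term can be nonzero only if m - l lies in the support of v, so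
      the sum over \<open>?C\<close> collapses to a translate of that support.\<close>
    also have "\<dots> = (\<Sum>l\<in>?A. ent u l i * ent (v * w) (n - l) (i - l))"
    proof (rule sum.cong[OF refl])
      fix l assume l: "l \<in> ?A"
      have "(\<Sum>m\<in>?C. ent u l i * ent v (m - l) (i - l) * ent w (n - m) (i - m)) =
          (\<Sum>m\<in>(\<lambda>k. l + k) ` ?B. ent u l i * ent v (m - l) (i - l) * ent w (n - m) (i - m))"
      proof (rule sum.mono_neutral_right)
        show "\<forall>m\<in>?C - (\<lambda>k. l + k) ` ?B.
            ent u l i * ent v (m - l) (i - l) * ent w (n - m) (i - m) = 0"
        proof
          fix m assume "m \<in> ?C - (\<lambda>k. l + k) ` ?B"
          then have "m - l \<notin> ?B" by (auto simp: image_iff)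
          then show "ent u l i * ent v (m - l) (i - l) * ent w (n - m) (i - m) = 0"
            by (simp add: ent_outside)
        qed
      qed (use l in auto)
      also have "\<dots> = (\<Sum>k\<in>?B. ent u l i * (ent v k (i - l) * ent w (n - l - k) (i - l - k)))"
        by (subst sum.reindex) (auto simp: algebra_simps)
      finally show "(\<Sum>m\<in>?C. ent u l i * ent v (m - l) (i - l) * ent w (n - m) (i - m)) =
          ent u l i * ent (v * w) (n - l) (i - l)"
        by (simp add: ent_mult_superset[OF finite_supp order_refl, of v] sum_distrib_left)
    qed
    finally show "ent (u * v * w) n i = ent (u * (v * w)) n i"
      by (simp add: ent_mult_superset[OF finite_supp order_refl, of u])
  qed
  show "(u + v) * w = u * w + v * w"
  proof (rule band_eqI)
    fix n i
    let ?S = "supp u \<union> supp v"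
    have sub: "supp (u + v) \<subseteq> ?S" by (auto simp: supp_def plus_band.rep_eq fun_eq_iff)
    show "ent ((u + v) * w) n i = ent (u * w + v * w) n i"
      by (simp add: plus_band.rep_eq ent_mult_superset[of ?S] sub distrib_right sum.distrib)
  qed
  show "u * (v + w) = u * v + u * w"
    by (rule band_eqI)
       (simp add: plus_band.rep_eq ent_mult_superset[OF finite_supp order_refl] distrib_left
          sum.distrib)
  have sub1: "supp 1 \<subseteq> {0}" by (auto simp: supp_def one_band.rep_eq fun_eq_iff)
  show "1 * u = u"
    by (rule band_eqI) (simp add: ent_mult_superset[OF _ sub1] one_band.rep_eq)
  show "u * 1 = u"
  proof (rule band_eqI)
    fix n i
    have "ent (u * 1) n i = (\<Sum>m\<in>supp u. if m = n then ent u m i else 0)"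
      unfolding ent_mult_superset[OF finite_supp order_refl]
      by (rule sum.cong) (auto simp: one_band.rep_eq)
    then show "ent (u * 1) n i = ent u n i" by (simp add: ent_outside)
  qed
  show "0 \<noteq> (1 :: band)"
    by transfer (auto simp: fun_eq_iff)
qed (transfer; simp add: algebra_simps)+

end

lemmas ent_simps = zero_band.rep_eq plus_band.rep_eq minus_band.rep_eq uminus_band.rep_eq

section \<open>Single diagonals and scalars\<close>

lift_definition dg :: "int \<Rightarrow> (int \<Rightarrow> complex) \<Rightarrow> band" is
  "\<lambda>n h m. if m = n then h else (\<lambda>_. 0)"
  by (rule finite_subset[of _ "{n}" for n]) auto

lemma ent_dg: "ent (dg n h) m i = (if m = n then h i else 0)"
  by transfer simp

text \<open>\<open>dg a h\<close> is the diagonal matrix of h times the a-th power of the shift;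
  moving that power past the diagonal matrix of g translates the argument of g by a. Arbitrary
  sequences are allowed, so that division by y and powers of \<open>l\<close> stay inside the
  ring.\<close>

lemma dg_mult: "dg a h * dg b g = dg (a + b) (\<lambda>i. h i * g (i - a))"
proof (rule band_eqI)
  fix n i
  have "supp (dg a h) \<subseteq> {a}" by (auto simp: supp_def ent_dg fun_eq_iff)
  then show "ent (dg a h * dg b g) n i = ent (dg (a + b) (\<lambda>i. h i * g (i - a))) n i"
    by (auto simp: ent_mult_superset[of "{a}"] ent_dg)
qed

lemma dg_add: "dg a h + dg a g = dg a (\<lambda>i. h i + g i)"
  by (rule band_eqI) (simp add: ent_dg ent_simps)

lemma dg_diff: "dg a h - dg a g = dg a (\<lambda>i. h i - g i)"
  by (rule band_eqI) (simp add: ent_dg ent_simps)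

lemma dg_uminus: "- dg a h = dg a (\<lambda>i. - h i)"
  by (rule band_eqI) (simp add: ent_dg ent_simps)

lemma dg_zero: "dg a (\<lambda>_. 0) = 0"
  by (rule band_eqI) (simp add: ent_dg ent_simps)

lemma dg_one: "dg 0 (\<lambda>_. 1) = 1"
  by (rule band_eqI) (simp add: ent_dg one_band.rep_eq)

lemma dg_eq_iff: "dg a h = dg a g \<longleftrightarrow> (\<forall>i. h i = g i)"
proof
  assume "dg a h = dg a g"
  then show "\<forall>i. h i = g i" using ent_dg[of a h a] ent_dg[of a g a] by simp
qed (simp add: fun_eq_iff[symmetric])

lemma dg_eqI: "a = b \<Longrightarrow> (\<And>i. h i = g i) \<Longrightarrow> dg a h = dg b g"
  by (simp add: dg_eq_iff)

lemma eq_dg_iff: "u = dg a h \<longleftrightarrow> (\<forall>n i. ent u n i = (if n = a then h i else 0))"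
  by (metis band_eqI ent_dg)

lemma ent_dg_mult: "ent (dg a h * u) n i = h i * ent u (n - a) (i - a)"
proof -
  have "supp (dg a h) \<subseteq> {a}" by (auto simp: supp_def ent_dg fun_eq_iff)
  then show ?thesis by (simp add: ent_mult_superset[of "{a}"] ent_dg)
qed

lemma ent_mult_dg: "ent (u * dg a h) n i = ent u (n - a) i * h (i - (n - a))"
proof -
  have "ent (u * dg a h) n i = (\<Sum>m\<in>supp u. if m = n - a then ent u m i * h (i - m) else 0)"
    unfolding ent_mult_superset[OF finite_supp order_refl]
    by (rule sum.cong) (auto simp: ent_dg)
  then show ?thesis by (simp add: ent_outside)
qed

definition sc :: "complex \<Rightarrow> band" where
  "sc c = dg 0 (\<lambda>_. c)"

lemma sc_add: "sc (c + d) = sc c + sc d"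
  by (simp add: sc_def dg_add)

lemma sc_diff: "sc (c - d) = sc c - sc d"
  by (simp add: sc_def dg_diff)

lemma sc_uminus: "sc (- c) = - sc c"
  by (simp add: sc_def dg_uminus)

lemma sc_mult: "sc (c * d) = sc c * sc d"
  by (simp add: sc_def dg_mult)

lemma sc_0 [simp]: "sc 0 = 0"
  by (simp add: sc_def dg_zero)

lemma sc_1 [simp]: "sc 1 = 1"
  by (simp add: sc_def dg_one)

lemma sc_mult_left [simp]: "sc c * (sc d * u) = sc (c * d) * u"
  by (simp add: sc_mult mult.assoc)

lemma ent_sc_mult: "ent (sc c * u) n i = c * ent u n i"
  by (simp add: sc_def ent_dg_mult)

lemma sc_central: "sc c * u = u * sc c"
  by (rule band_eqI) (simp add: ent_sc_mult, simp add: sc_def ent_mult_dg)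

lemma sc_left_commute: "u * (sc c * v) = sc c * (u * v)"
  by (metis mult.assoc sc_central)

lemma sc_mult_dg: "sc c * dg n h = dg n (\<lambda>i. c * h i)"
  by (simp add: sc_def dg_mult)

lemma dg_power0: "dg 0 h ^ k = dg 0 (\<lambda>i. h i ^ k)"
  by (induction k) (simp_all add: dg_one dg_mult)


section \<open>A faithful representation of the quantum disc\<close>

definition sp :: "complex \<Rightarrow> int \<Rightarrow> complex" where
  "sp q i = q powi (- 2 * i)"

definition op_z :: band where
  "op_z = dg 1 (\<lambda>_. 1)"

definition op_y :: "complex \<Rightarrow> band" where
  "op_y q = dg 0 (sp q)"

text \<open>The argument i + 1 is forced by zw = 1 - y: multiplication by the shift on the left
  evaluates the entries of \<open>op_w q\<close> at i - 1.\<close>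

definition op_w :: "complex \<Rightarrow> band" where
  "op_w q = dg (- 1) (\<lambda>i. 1 - sp q (i + 1))"

definition rep :: "complex \<Rightarrow> disc_gen free_alg \<Rightarrow> band" where
  "rep q = free_lift sc (case_disc_gen op_z (op_w q))"

interpretation rep: alg_lift sc "case_disc_gen op_z (op_w q)"
  rewrites "free_lift sc (case_disc_gen op_z (op_w q)) \<equiv> rep q"
  by (unfold_locales, rule sc_add, rule sc_mult, rule sc_1, rule sc_central) (simp only: rep_def)

lemma rep_vz: "rep q vz = op_z" and rep_vzs: "rep q vzs = op_w q"
  by (simp_all add: vz_def vzs_def rep.gen)

text \<open>\<open>pf q n\<close> is the polynomial with \<open>w\<^sup>m = pf q (- m)(y) t\<^sup>-\<^sup>m\<close>, where \<open>t\<close> is the shift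
  \<^const>\<open>op_z\<close> and \<open>w\<close> is \<^const>\<open>op_w\<close>.\<close>

definition pf :: "complex \<Rightarrow> int \<Rightarrow> complex poly" where
  "pf q n = (\<Prod>k=1..nat (- n). [:1, - (q powi (- 2 * int k)):])"

text \<open>The expected basis of the disc, with powers of z and of the second generator joined into
  one integer degree n. Spanning is shown by rewriting, independence by the representation, where n
  is the number of the diagonal.\<close>

definition nf :: "int \<times> nat \<Rightarrow> disc_gen free_alg" where
  "nf = (\<lambda>(n, j). vy ^ j * (if n \<ge> 0 then vz ^ nat n else vzs ^ nat (- n)))"

definition comb :: "(int \<times> nat \<Rightarrow>\<^sub>0 complex) \<Rightarrow> disc_gen free_alg" where
  "comb c = (\<Sum>k\<in>Poly_Mapping.keys c. scal (Poly_Mapping.lookup c k) * nf k)"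

lemma comb_add: "comb (c + d) = comb c + comb d"
  unfolding comb_def by (rule setsum_keys_plus_distrib) (simp_all add: scal_add distrib_right)

lemma comb_single: "comb (Poly_Mapping.single k a) = scal a * nf k"
  by (simp add: comb_def)

lemma comb_scal: "comb (scal a * c) = scal a * comb c"
  by (induction c rule: poly_mapping_induct_single)
     (simp_all add: scal_single comb_single comb_add distrib_left scal_mult mult.assoc)

definition cong_disc :: "complex \<Rightarrow> disc_gen free_alg \<Rightarrow> disc_gen free_alg \<Rightarrow> bool" where
  "cong_disc q p r \<longleftrightarrow> p - r \<in> rel_ideal (disc_rels q)"

lemma cong_disc_refl: "cong_disc q p p"
  by (simp add: cong_disc_def rel_ideal_zero)

lemma cong_disc_trans [trans]: "cong_disc q p r \<Longrightarrow> cong_disc q r t \<Longrightarrow> cong_disc q p t"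
  unfolding cong_disc_def using rel_ideal_add[of "p - r" _ "r - t"] by simp

lemma cong_disc_add: "cong_disc q p r \<Longrightarrow> cong_disc q p' r' \<Longrightarrow> cong_disc q (p + p') (r + r')"
  unfolding cong_disc_def using rel_ideal_add[of "p - r" _ "p' - r'"] by (simp add: algebra_simps)

lemma cong_disc_left: "cong_disc q p r \<Longrightarrow> cong_disc q (t * p) (t * r)"
  unfolding cong_disc_def using rel_ideal_mult_left[of "p - r" _ t] by (simp add: algebra_simps)

lemma cong_disc_right: "cong_disc q p r \<Longrightarrow> cong_disc q (p * t) (r * t)"
  unfolding cong_disc_def using rel_ideal_mult_right[of "p - r" _ t] by (simp add: algebra_simps)

locale quantum_disc =
  fixes q :: complex
  assumes q_nonzero [simp]: "q \<noteq> 0"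
    and q_not_root: "n > 0 \<Longrightarrow> q ^ n \<noteq> 1"
begin

abbreviation "s \<equiv> sp q"
abbreviation "w \<equiv> op_w q"
abbreviation "y \<equiv> op_y q"

lemma powi_eq_1_iff: "q powi n = 1 \<longleftrightarrow> n = 0"
proof
  assume *: "q powi n = 1"
  show "n = 0"
  proof (rule ccontr)
    assume "n \<noteq> 0"
    then have "q ^ nat \<bar>n\<bar> = 1"
      using * by (cases "n > 0") (auto simp: power_int_def power_inverse)
    then show False using q_not_root[of "nat \<bar>n\<bar>"] \<open>n \<noteq> 0\<close> by simp
  qed
qed simp

lemma powi_eq_iff: "q powi m = q powi n \<longleftrightarrow> m = n"
  using powi_eq_1_iff[of "m - n"] by (auto simp: power_int_diff)

lemma s_add: "s (i + n) = q powi (- 2 * n) * s i"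
  by (simp add: sp_def power_int_add[symmetric] algebra_simps)

lemma s_diff: "s (i - n) = q powi (2 * n) * s i"
  using s_add[of i "- n"] by simp

lemma s_nonzero [simp]: "s i \<noteq> 0"
  by (simp add: sp_def)

lemma inj_s: "inj s"
  by (rule injI) (simp add: sp_def powi_eq_iff)

text \<open>The s i are pairwise distinct because q is not a root of 1, so the difference of the two
  polynomials has infinitely many zeros.\<close>

lemma poly_eqI_s: assumes "\<And>i. poly P (s i) = poly R (s i)" shows "P = R"
proof (rule ccontr)
  assume "P \<noteq> R"
  then have "finite {x. poly (P - R) x = 0}" by (intro poly_roots_finite) simp
  moreover have "range s \<subseteq> {x. poly (P - R) x = 0}" using assms by auto
  ultimately have "finite (range s)" by (rule finite_subset[rotated])
  then show False using finite_imageD[OF _ inj_s] by simp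
qed

lemma op_z_mult_op_w: "op_z * w = 1 - y"
  by (simp add: op_z_def op_w_def op_y_def dg_mult dg_diff flip: dg_one)

lemma op_w_mult_op_z: "w * op_z = 1 - sc (inverse (q^2)) * y"
  by (simp add: op_z_def op_w_def op_y_def dg_mult dg_diff s_add sc_mult_dg power_int_minus flip: dg_one)

lemma y_z: "y * op_z = sc (inverse (q^2)) * op_z * y"
  unfolding mult.assoc
  by (simp add: op_z_def op_y_def dg_mult sc_mult_dg, rule dg_eqI) (simp_all add: s_diff)

lemma y_w: "y * w = sc (q^2) * w * y"
  unfolding mult.assoc
  by (simp add: op_w_def op_y_def dg_mult sc_mult_dg, rule dg_eqI)
     (simp_all add: s_add power_int_minus)

lemma rep_vy: "rep q vy = y"
  by (simp add: vy_def rep.hom_simps rep_vz rep_vzs op_z_mult_op_w)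

lemma rep_relator: assumes "r \<in> disc_rels q" shows "rep q r = 0"
proof -
  have "sc (q\<^sup>2) * (w * op_z) = sc (q\<^sup>2) - y"
    by (simp add: op_w_mult_op_z right_diff_distrib)
  then show ?thesis
    using assms
    by (simp add: disc_rels_def rep.hom_simps rep_vz rep_vzs op_z_mult_op_w mult.assoc sc_diff)
qed

text \<open>The representation is not yet known to be faithful, so a cofactor of the relator r is
  exhibited: the difference is -vz r here, q^-2 r vzs in \<open>cong_w_y\<close> and -q^-2 r in
  \<open>cong_w_z\<close>.\<close>

lemma cong_z_y: "cong_disc q (vz * vy) (scal (q^2) * vy * vz)"
proof -
  let ?r = "vz * vzs - (scal (q^2) * vzs * vz + scal (1 - q^2))"
  have c: "vz * (scal (q^2) * x) = scal (q^2) * (vz * x)" for x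
    by (metis mult.assoc scal_central)
  have "vz * vy - scal (q^2) * vy * vz = (- vz) * ?r"
    by (simp add: vy_def algebra_simps mult.assoc scal_diff c scal_central[of "q\<^sup>2" vz, symmetric])
  moreover have "(- vz) * ?r \<in> rel_ideal (disc_rels q)"
    by (rule rel_ideal_mult_left, rule rel_ideal_base) (simp add: disc_rels_def)
  ultimately show ?thesis by (simp add: cong_disc_def)
qed

lemma cong_w_y: "cong_disc q (vzs * vy) (scal (inverse (q^2)) * vy * vzs)"
proof -
  let ?r = "vz * vzs - (scal (q^2) * vzs * vz + scal (1 - q^2))"
  have c: "scal (inverse (q^2)) * (scal (q^2) * x) = x" for x :: "disc_gen free_alg"
    by (simp add: mult.assoc[symmetric] scal_mult[symmetric])
  have "vzs * vy - scal (inverse (q^2)) * vy * vzs = scal (inverse (q^2)) * ?r * vzs"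
    by (simp add: vy_def algebra_simps mult.assoc scal_diff c)
  moreover have "scal (inverse (q^2)) * ?r * vzs \<in> rel_ideal (disc_rels q)"
    by (rule rel_ideal_mult_right, rule rel_ideal_mult_left, rule rel_ideal_base)
       (simp add: disc_rels_def)
  ultimately show ?thesis by (simp add: cong_disc_def)
qed

lemma cong_w_z: "cong_disc q (vzs * vz) (1 - scal (inverse (q^2)) * vy)"
proof -
  let ?r = "vz * vzs - (scal (q^2) * vzs * vz + scal (1 - q^2))"
  have c: "scal (inverse (q^2)) * (scal (q^2) * x) = x" for x :: "disc_gen free_alg"
    by (simp add: mult.assoc[symmetric] scal_mult[symmetric])
  have c2: "scal (inverse (q^2)) * (scal (q^2)) = (1 :: disc_gen free_alg)"
    by (simp add: scal_mult[symmetric])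
  have "vzs * vz - (1 - scal (inverse (q^2)) * vy) = - scal (inverse (q^2)) * ?r"
    by (simp add: vy_def algebra_simps mult.assoc scal_diff c c2)
  moreover have "- scal (inverse (q^2)) * ?r \<in> rel_ideal (disc_rels q)"
    by (rule rel_ideal_mult_left, rule rel_ideal_base) (simp add: disc_rels_def)
  ultimately show ?thesis by (simp add: cong_disc_def)
qed

lemma cong_commute_power:
  assumes "cong_disc q (x * vy) (scal a * vy * x)"
  shows "cong_disc q (x * vy ^ j) (scal (a ^ j) * vy ^ j * x)"
proof (induction j)
  case 0
  then show ?case by (simp add: cong_disc_refl)
next
  case (Suc j)
  have "cong_disc q (x * vy ^ j * vy) (scal (a ^ j) * vy ^ j * x * vy)"
    by (rule cong_disc_right[OF Suc])
  also have "cong_disc q (scal (a ^ j) * vy ^ j * x * vy) (scal (a ^ j) * vy ^ j * (scal a * vy * x))"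
    unfolding mult.assoc[of "scal (a ^ j) * vy ^ j"] by (rule cong_disc_left[OF assms])
  also have "scal (a ^ j) * vy ^ j * (scal a * vy * x) = scal (a ^ Suc j) * vy ^ Suc j * x"
  proof -
    have "scal (a ^ j) * vy ^ j * (scal a * vy * x) = scal (a ^ j) * (vy ^ j * scal a) * vy * x"
      by (simp add: mult.assoc)
    also have "\<dots> = scal (a ^ j) * (scal a * vy ^ j) * vy * x"
      by (simp only: scal_central[of a "vy ^ j"])
    finally show ?thesis
      by (simp add: scal_mult mult.assoc power_Suc2 scal_central[of a "scal (a ^ j)"] del: power_Suc)
  qed
  finally show ?case by (simp add: mult.assoc power_Suc2 del: power_Suc)
qed

definition spanned :: "disc_gen free_alg set" where
  "spanned = {p. \<exists>c. cong_disc q p (comb c)}"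

lemma spannedI: "cong_disc q p (comb c) \<Longrightarrow> p \<in> spanned"
  by (auto simp: spanned_def)

lemma spannedE: assumes "p \<in> spanned" obtains c where "cong_disc q p (comb c)"
  using assms by (auto simp: spanned_def)

lemma spanned_add: assumes "p \<in> spanned" "r \<in> spanned" shows "p + r \<in> spanned"
proof -
  obtain c d where "cong_disc q p (comb c)" "cong_disc q r (comb d)"
    using assms by (auto elim!: spannedE)
  then have "cong_disc q (p + r) (comb (c + d))" unfolding comb_add by (rule cong_disc_add)
  then show ?thesis by (rule spannedI)
qed

lemma spanned_scal: assumes "p \<in> spanned" shows "scal a * p \<in> spanned"
proof -
  obtain c where "cong_disc q p (comb c)" using assms by (rule spannedE)
  then have "cong_disc q (scal a * p) (comb (scal a * c))"
    unfolding comb_scal by (rule cong_disc_left)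
  then show ?thesis by (rule spannedI)
qed

lemma spanned_cong: "cong_disc q p r \<Longrightarrow> r \<in> spanned \<Longrightarrow> p \<in> spanned"
  by (elim spannedE) (rule spannedI, rule cong_disc_trans)

lemma spanned_nf: "nf k \<in> spanned"
  by (rule spannedI[of _ "Poly_Mapping.single k 1"]) (simp add: comb_single cong_disc_refl)

lemma spanned_diff: "p \<in> spanned \<Longrightarrow> r \<in> spanned \<Longrightarrow> p - r \<in> spanned"
  using spanned_add[OF _ spanned_scal[of r "-1"], of p] by (simp add: scal_uminus)

text \<open>Moving past y^j costs a generator only a power of q^2. It then either lengthens the
  trailing power or meets the opposite generator; in that case vz vzs = 1 - vy, respectively vzs vz
  = 1 - q^-2 vy, shortens the power and raises the exponent of y by at most one.\<close>

lemma gen_nf_spanned: "gen x * nf k \<in> spanned"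
proof (cases k)
  case (Pair n j)
  have assoc4: "a * b * (c * d) = a * (b * c * d)" for a b c d :: "disc_gen free_alg"
    by (simp add: mult.assoc)
  show ?thesis
  proof (cases x)
    case D_z
    note cz = cong_commute_power[OF cong_z_y, of j]
    show ?thesis
    proof (cases "n \<ge> 0")
      case True
      then have n: "nat (n + 1) = Suc (nat n)" by simp
      have "cong_disc q (vz * nf k) (scal ((q^2) ^ j) * vy ^ j * vz * vz ^ nat n)"
        using cong_disc_right[OF cz] True Pair by (simp add: nf_def mult.assoc)
      also have "scal ((q^2) ^ j) * vy ^ j * vz * vz ^ nat n = scal ((q^2) ^ j) * nf (n + 1, j)"
        using True n by (simp add: nf_def mult.assoc)
      finally show ?thesis
        using spanned_cong spanned_scal spanned_nf D_z by (simp add: vz_def)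
    next
      case False
      then have n: "nat (- n) = Suc (nat (- (n + 1)))" by simp
      \<comment> \<open>At n = -1 the index n + 1 = 0 falls into the other branch of
        \<open>nf\<close>; both branches are 1 there.\<close>
      have if_n: "(if n + 1 \<ge> 0 then vz ^ nat (n + 1) else vzs ^ nat (- (n + 1))) =
          vzs ^ nat (- (n + 1))"
        using False by (cases "n = -1") auto
      have "cong_disc q (vz * nf k) (scal ((q^2) ^ j) * vy ^ j * vz * vzs ^ nat (- n))"
        using cong_disc_right[OF cz] False Pair by (simp add: nf_def mult.assoc)
      also have "scal ((q^2) ^ j) * vy ^ j * vz * vzs ^ nat (- n) =
          scal ((q^2) ^ j) * (vy ^ j * (1 - vy) * vzs ^ nat (- (n + 1)))"
        unfolding n by (simp add: vy_def mult.assoc)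
      also have "\<dots> = scal ((q^2) ^ j) * (nf (n + 1, j) - nf (n + 1, Suc j))"
        unfolding nf_def prod.case if_n
        by (simp add: algebra_simps mult.assoc power_commutes)
      finally show ?thesis
        using spanned_cong spanned_scal spanned_nf spanned_diff D_z by (simp add: vz_def)
    qed
  next
    case D_zs
    note cz = cong_commute_power[OF cong_w_y, of j]
    show ?thesis
    proof (cases "n > 0")
      case False
      then have n: "nat (- (n - 1)) = Suc (nat (- n))" by simp
      have if_n: "(if n \<ge> 0 then vz ^ nat n else vzs ^ nat (- n)) = vzs ^ nat (- n)"
        using False by (cases "n = 0") auto
      have "cong_disc q (vzs * nf k) (scal (inverse (q^2) ^ j) * vy ^ j * vzs * vzs ^ nat (- n))"
        using cong_disc_right[OF cz] Pair unfolding nf_def Pair prod.case if_n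
        by (simp add: mult.assoc)
      also have "scal (inverse (q^2) ^ j) * vy ^ j * vzs * vzs ^ nat (- n) =
          scal (inverse (q^2) ^ j) * nf (n - 1, j)"
        using False n by (simp add: nf_def mult.assoc)
      finally show ?thesis
        using spanned_cong spanned_scal spanned_nf D_zs by (simp add: vzs_def)
    next
      case True
      then have n: "nat n = Suc (nat (n - 1))" by simp
      have "cong_disc q (vzs * nf k) (scal (inverse (q^2) ^ j) * vy ^ j * vzs * vz ^ nat n)"
        using cong_disc_right[OF cz] True Pair by (simp add: nf_def mult.assoc)
      also have "scal (inverse (q^2) ^ j) * vy ^ j * vzs * vz ^ nat n =
          scal (inverse (q^2) ^ j) * vy ^ j * (vzs * vz * vz ^ nat (n - 1))"
        unfolding n by (simp add: mult.assoc)
      also have "cong_disc q \<dots> (scal (inverse (q^2) ^ j) * vy ^ j *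
          ((1 - scal (inverse (q^2)) * vy) * vz ^ nat (n - 1)))"
        by (intro cong_disc_left cong_disc_right cong_w_z)
      also have "scal (inverse (q^2) ^ j) * vy ^ j *
          ((1 - scal (inverse (q^2)) * vy) * vz ^ nat (n - 1)) =
          scal (inverse (q^2) ^ j) * (nf (n - 1, j) - scal (inverse (q^2)) * nf (n - 1, Suc j))"
      proof -
        have "vy ^ j * (scal (inverse (q^2)) * x) = scal (inverse (q^2)) * (vy ^ j * x)" for x
          by (metis mult.assoc scal_central)
        then show ?thesis using True
          by (simp add: nf_def algebra_simps mult.assoc power_Suc2 del: power_Suc)
      qed
      finally show ?thesis
        using spanned_cong spanned_scal spanned_nf spanned_diff D_zs by (simp add: vzs_def)
    qed
  qed
qed

lemma all_spanned: "p \<in> spanned"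
proof (induction p rule: free_alg_induct)
  case (scal c)
  have "nf (0, 0) = 1" by (simp add: nf_def)
  then show ?case using spanned_scal[OF spanned_nf[of "(0, 0)"], of c] by simp
next
  case (gen x p)
  then obtain c where "cong_disc q p (comb c)" by (auto simp: spanned_def)
  then have "cong_disc q (gen x * p) (gen x * comb c)" by (rule cong_disc_left)
  moreover have "gen x * comb c \<in> spanned"
  proof (induction c rule: poly_mapping_induct_single)
    case (single k v)
    have "gen x * (scal v * nf k) = scal v * (gen x * nf k)" by (metis mult.assoc scal_central)
    then show ?case using spanned_scal gen_nf_spanned by (simp add: comb_single)
  qed (simp add: comb_add distrib_left spanned_add)
  ultimately show ?case by (rule spanned_cong)
qed (rule spanned_add)

section \<open>Independence of the normal forms and the image of the disc\<close>

lemma pf_nonzero: "pf q n \<noteq> 0"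
  by (simp add: pf_def)

lemma degree_pf: "degree (pf q n) = nat (- n)"
  unfolding pf_def by (subst degree_prod_eq_sum_degree) auto

lemma pf_nonneg: "n \<ge> 0 \<Longrightarrow> pf q n = 1"
  by (simp add: pf_def)

lemma op_z_power: "op_z ^ m = dg (int m) (\<lambda>_. 1)"
  by (induction m) (simp_all add: op_z_def dg_mult flip: dg_one)

text \<open>The last factor \<open>w\<close>, moved past the (-m)-th power of the shift, contributes
  1 - s (i + m + 1), which is the factor with k = m + 1 in \<open>pf\<close>.\<close>

lemma op_w_power: "w ^ m = dg (- int m) (\<lambda>i. poly (pf q (- int m)) (s i))"
proof (induction m)
  case 0
  then show ?case by (simp add: pf_def flip: dg_one)
next
  case (Suc m)
  have "w ^ Suc m = w ^ m * w" by (simp add: power_Suc2 del: power_Suc)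
  also have "\<dots> = dg (- int (Suc m)) (\<lambda>i. poly (pf q (- int m)) (s i) * (1 - s (i + int (Suc m))))"
    unfolding Suc unfolding op_w_def dg_mult by (rule dg_eqI) (simp_all add: algebra_simps)
  also have "\<dots> = dg (- int (Suc m)) (\<lambda>i. poly (pf q (- int (Suc m))) (s i))"
  proof (rule dg_eqI[OF refl])
    fix i
    have "nat (- (- int (Suc m))) = Suc m" "nat (- (- int m)) = m" by simp_all
    then show "poly (pf q (- int m)) (s i) * (1 - s (i + int (Suc m))) =
        poly (pf q (- int (Suc m))) (s i)"
      unfolding pf_def s_add by (simp add: algebra_simps)
  qed
  finally show ?case .
qed

lemma rep_nf: "rep q (nf (n, j)) = dg n (\<lambda>i. s i ^ j * poly (pf q n) (s i))"
proof (cases "n \<ge> 0")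
  case True
  then show ?thesis
    by (simp add: nf_def rep.hom_simps rep_vy rep_vz op_y_def dg_power0 op_z_power dg_mult pf_nonneg)
next
  case False
  then show ?thesis
    by (simp add: nf_def rep.hom_simps rep_vy rep_vzs op_y_def dg_power0 op_w_power dg_mult)
qed

definition comb_poly :: "(int \<times> nat \<Rightarrow>\<^sub>0 complex) \<Rightarrow> int \<Rightarrow> complex poly" where
  "comb_poly c n = (\<Sum>k\<in>Poly_Mapping.keys c.
     if fst k = n then monom (Poly_Mapping.lookup c k) (snd k) else 0)"

lemma coeff_comb_poly: "coeff (comb_poly c n) j = Poly_Mapping.lookup c (n, j)"
proof -
  have "coeff (comb_poly c n) j =
      (\<Sum>k\<in>Poly_Mapping.keys c. if k = (n, j) then Poly_Mapping.lookup c k else 0)"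
    unfolding comb_poly_def coeff_sum by (rule sum.cong) auto
  then show ?thesis by (auto simp: in_keys_iff)
qed

lemma ent_rep_comb: "ent (rep q (comb c)) n i = poly (comb_poly c n * pf q n) (s i)"
proof (induction c rule: poly_mapping_induct_single)
  case (single k v)
  have "comb_poly (Poly_Mapping.single k v) n = (if fst k = n then monom v (snd k) else 0)"
    by (simp add: comb_poly_def)
  then show ?case
    by (cases k) (simp add: comb_single rep.hom_simps rep_nf ent_sc_mult ent_dg poly_monom)
next
  case (add p r)
  have "comb_poly (p + r) n = comb_poly p n + comb_poly r n"
    by (rule poly_eqI) (simp add: coeff_comb_poly lookup_add)
  then show ?case using add by (simp add: comb_add rep.hom_simps ent_simps distrib_right)
qed

text \<open>Different degrees n sit on different diagonals. On one diagonal, a vanishing combination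
  of normal forms gives a polynomial times the nonzero \<open>pf q n\<close> that is 0 at every s i,
  so all its coefficients are 0.\<close>

lemma rep_eq_0_iff: "rep q p = 0 \<longleftrightarrow> p \<in> rel_ideal (disc_rels q)"
proof
  assume "p \<in> rel_ideal (disc_rels q)"
  then show "rep q p = 0" using rep.vanishes_on_rel_ideal rep_relator by blast
next
  assume p0: "rep q p = 0"
  obtain c where c: "p - comb c \<in> rel_ideal (disc_rels q)"
    using all_spanned[of p] by (auto simp: spanned_def cong_disc_def)
  then have "rep q (p - comb c) = 0" using rep.vanishes_on_rel_ideal rep_relator by blast
  then have "rep q (comb c) = 0" using p0 by (simp add: rep.hom_simps)
  then have "poly (comb_poly c n * pf q n) (s i) = 0" for n i
    unfolding ent_rep_comb[symmetric] by (simp add: ent_simps)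
  then have "comb_poly c n * pf q n = 0" for n
    by (intro poly_eqI_s) simp
  then have "comb_poly c n = 0" for n using pf_nonzero by simp
  then have "Poly_Mapping.lookup c k = 0" for k
    using coeff_comb_poly[of c "fst k" "snd k"] by simp
  then have "c = 0" by (intro poly_mapping_eqI) simp
  then show "p \<in> rel_ideal (disc_rels q)" using c by (simp add: comb_def)
qed

lemma pclass_eq_iff_rep: "pclass (disc_rels q) p = pclass (disc_rels q) r \<longleftrightarrow> rep q p = rep q r"
  by (simp add: pclass_eq_iff rep.hom_simps flip: rep_eq_0_iff)

definition disc_ops :: "band set" where
  "disc_ops = range (rep q)"

text \<open>The form in which membership in the disc is exploited. For n < 0 the factor
  \<open>pf q n\<close> has degree -n, and this is what makes the size of m enter the degree counts
  of the classification.\<close>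

lemma disc_ops_ent:
  assumes "u \<in> disc_ops"
  obtains P where "\<And>n i. ent u n i = poly (P n * pf q n) (s i)"
proof -
  obtain p where p: "u = rep q p" using assms by (auto simp: disc_ops_def)
  obtain c where c: "p - comb c \<in> rel_ideal (disc_rels q)"
    using all_spanned[of p] by (auto simp: spanned_def cong_disc_def)
  then have "rep q p = rep q (comb c)"
    using rep_eq_0_iff[of "p - comb c"] by (simp add: rep.hom_simps)
  then show ?thesis using that ent_rep_comb p by metis
qed

lemma disc_ops_induct [consumes 1, case_names sc z w add]:
  assumes "u \<in> disc_ops"
    and "\<And>c. P (sc c)"
    and "\<And>u. u \<in> disc_ops \<Longrightarrow> P u \<Longrightarrow> P (op_z * u)"
    and "\<And>u. u \<in> disc_ops \<Longrightarrow> P u \<Longrightarrow> P (w * u)"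
    and "\<And>u v. u \<in> disc_ops \<Longrightarrow> v \<in> disc_ops \<Longrightarrow> P u \<Longrightarrow> P v \<Longrightarrow> P (u + v)"
  shows "P u"
proof -
  have "P (rep q p)" for p
  proof (induction p rule: free_alg_induct)
    case (gen x p)
    then show ?case using assms(3,4) by (cases x) (simp_all add: rep.hom_simps disc_ops_def)
  qed (use assms(2,5) in \<open>auto simp: rep.hom_simps disc_ops_def\<close>)
  then show ?thesis using assms(1) by (auto simp: disc_ops_def)
qed

lemma disc_ops_closed [intro, simp]:
  "op_z \<in> disc_ops" "w \<in> disc_ops" "y \<in> disc_ops" "sc c \<in> disc_ops" "0 \<in> disc_ops" "1 \<in> disc_ops"
  unfolding disc_ops_def
  using rep_vz[of q] rep_vzs[of q] rep_vy rep.scal[of q c] rep.zero[of q] rep.one[of q]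
  by (metis rangeI)+

lemma disc_ops_add [intro]: "u \<in> disc_ops \<Longrightarrow> v \<in> disc_ops \<Longrightarrow> u + v \<in> disc_ops"
  by (auto simp: disc_ops_def simp flip: rep.add)

lemma disc_ops_diff [intro]: "u \<in> disc_ops \<Longrightarrow> v \<in> disc_ops \<Longrightarrow> u - v \<in> disc_ops"
  by (auto simp: disc_ops_def simp flip: rep.minus)

lemma disc_ops_mult [intro]: "u \<in> disc_ops \<Longrightarrow> v \<in> disc_ops \<Longrightarrow> u * v \<in> disc_ops"
  by (auto simp: disc_ops_def simp flip: rep.mult)

end


section \<open>Symmetries as operators\<close>

lemma presented_abelian_group: "abelian_group (presented_algebra R)"
proof (rule abelian_groupI)
  fix X assume "X \<in> carrier (presented_algebra R)"
  then obtain p where p: "X = pclass R p" by (auto simp: presented_carrier)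
  show "\<exists>Y\<in>carrier (presented_algebra R).
      Y \<oplus>\<^bsub>presented_algebra R\<^esub> X = \<zero>\<^bsub>presented_algebra R\<^esub>"
    by (rule bexI[of _ "pclass R (- p)"]) (simp_all add: p presented_simps presented_carrier)
qed (auto simp: presented_carrier presented_simps add_ac)

lemma lookup_map_scale:
  "Poly_Mapping.lookup (Poly_Mapping.map ((*) c) t) k = (c :: complex) * Poly_Mapping.lookup t k"
  by (simp add: Poly_Mapping.map.rep_eq when_def)

lemma module_scale_poly_mapping:
  "Modules.module (\<lambda>(c :: complex) (t :: 'k \<Rightarrow>\<^sub>0 complex). Poly_Mapping.map ((*) c) t)"
  by standard (rule poly_mapping_eqI, simp add: lookup_map_scale lookup_add algebra_simps)+

lemma map_scale_single:
  "Poly_Mapping.map ((*) c) (Poly_Mapping.single k v) = Poly_Mapping.single k (c * v :: complex)"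
  by (simp add: map_single)

text \<open>For a bilinear \<open>g\<close> this induces a linear map on the tensor square, so that
  the value of a Sweedler sum does not depend on how it is written.\<close>

definition pair_sum :: "('h \<Rightarrow> 'h \<Rightarrow> band) \<Rightarrow> ('h \<times> 'h \<Rightarrow>\<^sub>0 complex) \<Rightarrow> band" where
  "pair_sum g t = (\<Sum>p\<in>Poly_Mapping.keys t. sc (Poly_Mapping.lookup t p) * g (fst p) (snd p))"

lemma pair_sum_add: "pair_sum g (t + t') = pair_sum g t + pair_sum g t'"
  unfolding pair_sum_def
  by (rule setsum_keys_plus_distrib) (simp_all add: sc_add distrib_right)

lemma pair_sum_single: "pair_sum g (Poly_Mapping.single k c) = sc c * g (fst k) (snd k)"
  by (simp add: pair_sum_def)

lemma pair_sum_diff: "pair_sum g (t - t') = pair_sum g t - pair_sum g t'"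
  using pair_sum_add[of g "t - t'" t'] by simp

lemma pair_sum_scale: "pair_sum g (Poly_Mapping.map ((*) c) t) = sc c * pair_sum g t"
proof (induction t rule: poly_mapping_induct_single)
  case (single k v)
  then show ?case by (simp add: map_scale_single pair_sum_single)
next
  case (add t t')
  then show ?case
    using Modules.module.scale_right_distrib[OF module_scale_poly_mapping, of c t t']
    by (simp add: pair_sum_add distrib_left)
qed

lemma tensor_null_induct [consumes 1, case_names zero add scale base]:
  assumes "t \<in> tensor_null H"
    and "P 0" "\<And>t t'. P t \<Longrightarrow> P t' \<Longrightarrow> P (t + t')"
    and "\<And>c t. P t \<Longrightarrow> P (Poly_Mapping.map ((*) c) t)"
    and "\<And>t. t \<in> bilinear_rels H \<Longrightarrow> P t"
  shows "P t"
proof -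
  have "Modules.module.subspace (\<lambda>c t. Poly_Mapping.map ((*) c) t) {t. P t}"
    unfolding Modules.module.subspace_def[OF module_scale_poly_mapping] using assms(2-4) by simp
  then show ?thesis
    using Modules.module.span_induct[OF module_scale_poly_mapping] assms(1,5)
    unfolding tensor_null_def by (metis (mono_tags, lifting) mem_Collect_eq)
qed

lemma zero_in_tensor_null: "0 \<in> tensor_null H"
  unfolding tensor_null_def by (rule Modules.module.span_zero[OF module_scale_poly_mapping])

lemma pair_sum_tensor_null:
  assumes "t \<in> tensor_null H"
    and "\<And>u u' v. u \<in> carrier H \<Longrightarrow> u' \<in> carrier H \<Longrightarrow> v \<in> carrier H \<Longrightarrow>
      g (u \<oplus>\<^bsub>H\<^esub> u') v = g u v + g u' v"
    and "\<And>u v v'. u \<in> carrier H \<Longrightarrow> v \<in> carrier H \<Longrightarrow> v' \<in> carrier H \<Longrightarrow>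
      g u (v \<oplus>\<^bsub>H\<^esub> v') = g u v + g u v'"
    and "\<And>c u v. u \<in> carrier H \<Longrightarrow> v \<in> carrier H \<Longrightarrow> g (c \<odot>\<^bsub>H\<^esub> u) v = sc c * g u v"
    and "\<And>c u v. u \<in> carrier H \<Longrightarrow> v \<in> carrier H \<Longrightarrow> g u (c \<odot>\<^bsub>H\<^esub> v) = sc c * g u v"
  shows "pair_sum g t = 0"
  using assms(1)
proof (induction t rule: tensor_null_induct)
  case zero
  then show ?case by (simp add: pair_sum_def)
next
  case (base t)
  then show ?case unfolding bilinear_rels_def
    by (auto simp: pair_sum_diff pair_sum_single assms(2-5))
qed (simp_all add: pair_sum_add pair_sum_scale)

text \<open>The sum in \<open>is_symmetry\<close> runs over the keys of a representative, and
  \<open>finsum\<close> is meaningful only for terms in the carrier. The keys of every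
  representative of a coproduct therefore have to be located.\<close>

definition supported :: "'h set \<Rightarrow> ('h \<times> 'h \<Rightarrow>\<^sub>0 complex) \<Rightarrow> bool" where
  "supported C t \<longleftrightarrow> Poly_Mapping.keys t \<subseteq> C \<times> C"

lemma supported_iff: "supported C t \<longleftrightarrow> (\<forall>k. k \<notin> C \<times> C \<longrightarrow> Poly_Mapping.lookup t k = 0)"
  unfolding supported_def by (auto simp: in_keys_iff)

lemma supported_add: "supported C t \<Longrightarrow> supported C t' \<Longrightarrow> supported C (t + t')"
  by (simp add: supported_iff lookup_add)

lemma supported_diff: "supported C t \<Longrightarrow> supported C t' \<Longrightarrow> supported C (t - t')"
  by (simp add: supported_iff lookup_minus)

lemma supported_single: "u \<in> C \<Longrightarrow> v \<in> C \<Longrightarrow> supported C (Poly_Mapping.single (u, v) c)"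
  by (auto simp: supported_iff lookup_single when_def)

lemma supported_tensor_null:
  assumes t: "t \<in> tensor_null H"
    and "\<And>u v. u \<in> carrier H \<Longrightarrow> v \<in> carrier H \<Longrightarrow> u \<oplus>\<^bsub>H\<^esub> v \<in> carrier H"
    and "\<And>c u. u \<in> carrier H \<Longrightarrow> c \<odot>\<^bsub>H\<^esub> u \<in> carrier H"
  shows "supported (carrier H) t"
  using t
proof (induction t rule: tensor_null_induct)
  case (base t)
  then show ?case unfolding bilinear_rels_def
    using assms(2,3) by (auto intro!: supported_diff supported_single)
qed (simp_all add: supported_add, simp_all add: supported_iff lookup_map_scale)

lemma tensor_proj_add: "tensor_proj R (t + t') = tensor_proj R t + tensor_proj R t'"
  unfolding tensor_proj_def split_def prod.collapse
  by (rule setsum_keys_plus_distrib) (simp_all add: single_add)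

lemma tensor_proj_single:
  "tensor_proj R (Poly_Mapping.single (u, v) c) = Poly_Mapping.single
     (pclass R (Poly_Mapping.single u 1), pclass R (Poly_Mapping.single v 1)) c"
  by (simp add: tensor_proj_def)

lemma supported_tensor_proj: "supported (range (pclass R)) (tensor_proj R t)"
proof (induction t rule: poly_mapping_induct_single)
  case (single k v)
  then show ?case by (cases k) (simp add: tensor_proj_single supported_single)
qed (simp add: tensor_proj_add supported_add)

lemma pair_sum_tensor_proj:
  "pair_sum g (tensor_proj R t) =
     pair_sum (\<lambda>u v. g (pclass R (Poly_Mapping.single u 1)) (pclass R (Poly_Mapping.single v 1))) t"
proof (induction t rule: poly_mapping_induct_single)
  case (single k v)
  then show ?case by (cases k) (simp add: tensor_proj_single pair_sum_single)
qed (simp add: tensor_proj_add pair_sum_add)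

interpretation comul: alg_lift scal uq_comul_gen
  by (unfold_locales, rule scal_add, rule scal_mult, rule scal_1, rule scal_central)

interpretation counit: alg_lift id uq_counit_gen
  by unfold_locales auto

lemma uq_counit_pclass: "uq_counit (pclass (uq_rels q) x) = free_lift id uq_counit_gen x"
proof -
  have "free_lift id uq_counit_gen r = 0" if "r \<in> uq_rels q" for r
    using that unfolding uq_rels_def by (auto simp: counit.hom_simps)
  then have "free_lift id uq_counit_gen x' = free_lift id uq_counit_gen x"
    if "x' \<in> pclass (uq_rels q) x" for x'
    using counit.vanishes_on_rel_ideal[of "uq_rels q" "x' - x"] that
    by (simp add: mem_pclass_iff counit.hom_simps)
  then have "free_lift id uq_counit_gen ` pclass (uq_rels q) x = {free_lift id uq_counit_gen x}"
    using pclass_self by (auto intro: rev_image_eqI)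
  then show ?thesis by (simp add: uq_counit_def)
qed

lemma free_alg_word:
  "Poly_Mapping.single (Mon []) 1 = (1 :: 'x free_alg)"
  "Poly_Mapping.single (Mon [g]) 1 = gen g"
  by (simp_all add: gen_def flip: zero_monomial_def)

section \<open>Passage between cosets and band matrices\<close>

context quantum_disc
begin

abbreviation "dc \<equiv> pclass (disc_rels q)"
abbreviation "uc \<equiv> pclass (uq_rels q)"

lemma carrier_disc: "carrier (disc q) = range dc"
  by (simp add: disc_def presented_carrier)

lemma carrier_uq: "carrier (uq q) = range uc"
  by (simp add: uq_def presented_carrier)

lemmas disc_alg_simps = presented_simps[of "disc_rels q", folded disc_def]
lemmas uq_alg_simps = presented_simps[of "uq_rels q", folded uq_def]

text \<open>\<open>val\<close> and \<open>cls\<close> are inverse bijections between the disc and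
  \<open>disc_ops\<close>. The choice made in \<open>val\<close> is harmless because
  \<open>rep q\<close> kills the ideal of relations, the one in \<open>cls\<close> because nothing
  else is killed.\<close>

definition val :: "disc_gen free_alg set \<Rightarrow> band" where
  "val Y = rep q (SOME p. p \<in> Y)"

definition cls :: "band \<Rightarrow> disc_gen free_alg set" where
  "cls u = dc (SOME p. rep q p = u)"

lemma val_dc [simp]: "val (dc p) = rep q p"
proof -
  have "(SOME p'. p' \<in> dc p) \<in> dc p" by (rule someI[of _ p]) (rule pclass_self)
  then show ?thesis
    using rep_eq_0_iff[of "(SOME p'. p' \<in> dc p) - p"]
    by (simp add: val_def mem_pclass_iff rep.hom_simps)
qed

lemma cls_rep [simp]: "cls (rep q p) = dc p"
  unfolding cls_def pclass_eq_iff_rep by (rule someI[of _ p]) simp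

lemma val_cls: "u \<in> disc_ops \<Longrightarrow> val (cls u) = u"
  by (auto simp: disc_ops_def)

lemma cls_val: "Y \<in> carrier (disc q) \<Longrightarrow> cls (val Y) = Y"
  by (auto simp: carrier_disc)

lemma val_mem: "Y \<in> carrier (disc q) \<Longrightarrow> val Y \<in> disc_ops"
  by (auto simp: carrier_disc disc_ops_def)

lemma cls_mem: "u \<in> disc_ops \<Longrightarrow> cls u \<in> carrier (disc q)"
  by (auto simp: carrier_disc disc_ops_def)

lemma val_inj: "Y \<in> carrier (disc q) \<Longrightarrow> Y' \<in> carrier (disc q) \<Longrightarrow> val Y = val Y' \<Longrightarrow> Y = Y'"
  using cls_val by metis

lemma val_ops:
  assumes "Y \<in> carrier (disc q)" "Y' \<in> carrier (disc q)"
  shows "val (Y \<otimes>\<^bsub>disc q\<^esub> Y') = val Y * val Y'" "val (Y \<oplus>\<^bsub>disc q\<^esub> Y') = val Y + val Y'"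
    "Y \<otimes>\<^bsub>disc q\<^esub> Y' \<in> carrier (disc q)" "Y \<oplus>\<^bsub>disc q\<^esub> Y' \<in> carrier (disc q)"
  using assms by (auto simp: carrier_disc disc_alg_simps rep.hom_simps)

lemma val_smult:
  assumes "Y \<in> carrier (disc q)"
  shows "val (c \<odot>\<^bsub>disc q\<^esub> Y) = sc c * val Y" "c \<odot>\<^bsub>disc q\<^esub> Y \<in> carrier (disc q)"
  using assms by (auto simp: carrier_disc disc_alg_simps rep.hom_simps)

lemma val_one: "val \<one>\<^bsub>disc q\<^esub> = 1" and one_mem: "\<one>\<^bsub>disc q\<^esub> \<in> carrier (disc q)"
  by (simp_all add: disc_alg_simps rep.hom_simps carrier_disc)

lemma val_finsum:
  assumes "finite S" "f \<in> S \<rightarrow> carrier (disc q)"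
  shows "val (\<Oplus>\<^bsub>disc q\<^esub>x\<in>S. f x) = (\<Sum>x\<in>S. val (f x)) \<and>
    (\<Oplus>\<^bsub>disc q\<^esub>x\<in>S. f x) \<in> carrier (disc q)"
proof -
  interpret abelian_group "disc q" unfolding disc_def by (rule presented_abelian_group)
  show ?thesis using assms
  proof (induction S rule: finite_induct)
    case empty
    then show ?case by (simp add: disc_alg_simps rep.hom_simps carrier_disc)
  next
    case (insert x S)
    then have f: "f \<in> S \<rightarrow> carrier (disc q)" "f x \<in> carrier (disc q)" by auto
    then show ?case
      using insert finsum_insert[OF insert(1,2) f] by (simp add: val_ops)
  qed
qed

definition act_cls :: "action \<Rightarrow> uq_gen free_alg set \<Rightarrow> band \<Rightarrow> band" where
  "act_cls \<pi> X u = val (\<pi> X (cls u))"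

definition act :: "action \<Rightarrow> uq_gen free_alg \<Rightarrow> band \<Rightarrow> band" where
  "act \<pi> x u = act_cls \<pi> (uc x) u"

lemma val_sweedler_sum:
  assumes "supported (carrier (uq q)) t"
    and "\<And>X u. X \<in> carrier (uq q) \<Longrightarrow> u \<in> disc_ops \<Longrightarrow> \<pi> X (cls u) \<in> carrier (disc q)"
    and "u \<in> disc_ops" "v \<in> disc_ops"
  shows "val (\<Oplus>\<^bsub>disc q\<^esub>p\<in>Poly_Mapping.keys t. Poly_Mapping.lookup t p \<odot>\<^bsub>disc q\<^esub>
        (\<pi> (fst p) (cls u) \<otimes>\<^bsub>disc q\<^esub> \<pi> (snd p) (cls v))) =
      pair_sum (\<lambda>X Y. act_cls \<pi> X u * act_cls \<pi> Y v) t" (is "val (finsum _ ?f ?K) = _")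
    and "(\<Oplus>\<^bsub>disc q\<^esub>p\<in>Poly_Mapping.keys t. Poly_Mapping.lookup t p \<odot>\<^bsub>disc q\<^esub>
        (\<pi> (fst p) (cls u) \<otimes>\<^bsub>disc q\<^esub> \<pi> (snd p) (cls v))) \<in> carrier (disc q)"
proof -
  have mem: "\<pi> (fst p) (cls u) \<in> carrier (disc q)" "\<pi> (snd p) (cls v) \<in> carrier (disc q)"
    if "p \<in> ?K" for p
    using that assms by (auto simp: supported_def)
  have f: "?f \<in> ?K \<rightarrow> carrier (disc q)" using mem by (auto intro!: val_ops val_smult)
  show "val (finsum (disc q) ?f ?K) = pair_sum (\<lambda>X Y. act_cls \<pi> X u * act_cls \<pi> Y v) t"
    using val_finsum[OF finite_keys f] mem
    by (auto simp: pair_sum_def act_cls_def val_ops val_smult intro!: sum.cong)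
  show "finsum (disc q) ?f ?K \<in> carrier (disc q)" using val_finsum[OF finite_keys f] by simp
qed

lemma uq_comul_supported: assumes "t \<in> uq_comul q X" shows "supported (carrier (uq q)) t"
proof -
  obtain x where x: "t - tensor_proj (uq_rels q) (free_lift scal uq_comul_gen x) \<in> tensor_null (uq q)"
    using assms by (auto simp: uq_comul_def tensor_class_def)
  have "supported (carrier (uq q)) (t - tensor_proj (uq_rels q) (free_lift scal uq_comul_gen x))"
    by (rule supported_tensor_null[OF x]) (auto simp: carrier_uq uq_alg_simps)
  from supported_add[OF this supported_tensor_proj[of "uq_rels q" "free_lift scal uq_comul_gen x", folded carrier_uq]]
  show ?thesis by simp
qed

lemma uq_comul_gen_mem: "tensor_proj (uq_rels q) (uq_comul_gen g) \<in> uq_comul q (uc (gen g))"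
  using pclass_self[of "gen g" "uq_rels q"] zero_in_tensor_null[of "uq q"]
  by (auto simp: uq_comul_def tensor_class_def comul.gen intro!: bexI[of _ "gen g"])

end

locale disc_action = quantum_disc +
  fixes \<pi> :: action
  assumes symmetry: "disc_symmetry q \<pi>"
begin

lemma \<pi>_hom: "\<pi> \<in> ring_hom (uq q) (End_alg (disc q))"
  and \<pi>_ext: "\<pi> \<in> extensional (carrier (uq q))"
  and \<pi>_scal: "X \<in> carrier (uq q) \<Longrightarrow> \<pi> (c \<odot>\<^bsub>uq q\<^esub> X) = c \<odot>\<^bsub>End_alg (disc q)\<^esub> \<pi> X"
  using symmetry by (auto simp: disc_symmetry_def is_symmetry_def alg_hom_def)

lemma \<pi>_endo: "\<pi> (uc x) \<in> linear_endos (disc q)"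
  using ring_hom_closed[OF \<pi>_hom, of "uc x"] by (simp add: End_alg_def carrier_uq)

lemma \<pi>_mem: "X \<in> carrier (uq q) \<Longrightarrow> Y \<in> carrier (disc q) \<Longrightarrow> \<pi> X Y \<in> carrier (disc q)"
proof -
  assume X: "X \<in> carrier (uq q)" and Y: "Y \<in> carrier (disc q)"
  from X obtain x where "X = uc x" by (auto simp: carrier_uq)
  then have "\<pi> X \<in> carrier (disc q) \<rightarrow>\<^sub>E carrier (disc q)"
    using \<pi>_endo[of x] by (simp add: linear_endos_def)
  then show "\<pi> X Y \<in> carrier (disc q)" using Y by (rule PiE_mem)
qed

lemma act_mem: "u \<in> disc_ops \<Longrightarrow> act \<pi> x u \<in> disc_ops"
  unfolding act_def act_cls_def by (intro val_mem \<pi>_mem cls_mem) (simp_all add: carrier_uq)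

lemma \<pi>_dc: "\<pi> (uc x) (dc p) = cls (act \<pi> x (rep q p))"
  using \<pi>_mem[of "uc x" "dc p"] by (simp add: act_def act_cls_def cls_val carrier_uq carrier_disc)

lemma acts_iff: "acts q \<pi> g p r \<longleftrightarrow> act \<pi> (gen g) (rep q p) = rep q r"
proof
  assume "acts q \<pi> g p r"
  then show "act \<pi> (gen g) (rep q p) = rep q r" by (simp add: acts_def act_def act_cls_def)
qed (simp add: acts_def \<pi>_dc)

lemma act_add_right: 
  assumes "u \<in> disc_ops" "v \<in> disc_ops"
  shows "act \<pi> x (u + v) = act \<pi> x u + act \<pi> x v"
proof -
  obtain p r where "u = rep q p" "v = rep q r" using assms by (auto simp: disc_ops_def)
  moreover have "\<pi> (uc x) (dc p \<oplus>\<^bsub>disc q\<^esub> dc r) = \<pi> (uc x) (dc p) \<oplus>\<^bsub>disc q\<^esub> \<pi> (uc x) (dc r)"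
    using \<pi>_endo by (auto simp: linear_endos_def carrier_disc)
  then have "val (\<pi> (uc x) (dc (p + r))) = val (\<pi> (uc x) (dc p)) + val (\<pi> (uc x) (dc r))"
    using val_ops(2)[OF \<pi>_mem \<pi>_mem, of "uc x" "dc p" "uc x" "dc r"]
    by (simp add: disc_alg_simps carrier_disc carrier_uq)
  ultimately show ?thesis by (simp add: act_def act_cls_def flip: rep.add)
qed

lemma act_sc_right:
  assumes "u \<in> disc_ops"
  shows "act \<pi> x (sc c * u) = sc c * act \<pi> x u"
proof -
  obtain p where "u = rep q p" using assms by (auto simp: disc_ops_def)
  moreover have "\<pi> (uc x) (c \<odot>\<^bsub>disc q\<^esub> dc p) = c \<odot>\<^bsub>disc q\<^esub> \<pi> (uc x) (dc p)"
    using \<pi>_endo by (auto simp: linear_endos_def carrier_disc)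
  then have "val (\<pi> (uc x) (dc (scal c * p))) = sc c * val (\<pi> (uc x) (dc p))"
    using val_smult(1)[OF \<pi>_mem, of "uc x" "dc p" c]
    by (simp add: disc_alg_simps carrier_disc carrier_uq)
  ultimately show ?thesis by (simp add: act_def act_cls_def flip: rep.mult rep.scal[of q c])
qed

lemma act_mult:
  assumes "u \<in> disc_ops" shows "act \<pi> (x * x') u = act \<pi> x (act \<pi> x' u)"
proof -
  have "\<pi> (uc (x * x')) = compose (carrier (disc q)) (\<pi> (uc x)) (\<pi> (uc x'))"
    using ring_hom_mult[OF \<pi>_hom, of "uc x" "uc x'"]
    by (simp add: carrier_uq uq_alg_simps End_alg_def)
  then have "\<pi> (uc (x * x')) (cls u) = \<pi> (uc x) (\<pi> (uc x') (cls u))"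
    using cls_mem[OF assms] by (simp add: compose_def)
  then show ?thesis
    using cls_val[of "\<pi> (uc x') (cls u)"] \<pi>_mem[of "uc x'" "cls u"] cls_mem[OF assms]
    by (simp add: act_def act_cls_def carrier_uq)
qed

lemma act_add_left:
  assumes "u \<in> disc_ops" shows "act \<pi> (x + x') u = act \<pi> x u + act \<pi> x' u"
proof -
  have "\<pi> (uc (x + x')) = (\<lambda>Y\<in>carrier (disc q). \<pi> (uc x) Y \<oplus>\<^bsub>disc q\<^esub> \<pi> (uc x') Y)"
    using ring_hom_add[OF \<pi>_hom, of "uc x" "uc x'"]
    by (simp add: carrier_uq uq_alg_simps End_alg_def)
  then show ?thesis using cls_mem[OF assms]
    by (simp add: act_def act_cls_def val_ops \<pi>_mem carrier_uq)
qed

lemma act_one: "u \<in> disc_ops \<Longrightarrow> act \<pi> 1 u = u"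
  using ring_hom_one[OF \<pi>_hom] cls_mem[of u] val_cls[of u]
  by (simp add: uq_alg_simps End_alg_def act_def act_cls_def)

lemma act_scal_mult:
  assumes "u \<in> disc_ops" shows "act \<pi> (scal c * x) u = sc c * act \<pi> x u"
  using \<pi>_scal[of "uc x" c] cls_mem[OF assms]
  by (simp add: carrier_uq uq_alg_simps End_alg_def act_def act_cls_def val_smult \<pi>_mem)

lemma act_scal: "u \<in> disc_ops \<Longrightarrow> act \<pi> (scal c) u = sc c * u"
  using act_scal_mult[of u c 1] by (simp add: act_one)

lemma act_diff_left: "u \<in> disc_ops \<Longrightarrow> act \<pi> (x - x') u = act \<pi> x u - act \<pi> x' u"
  using act_add_left[of u "x - x'" x'] by simp

lemma act_zero: "u \<in> disc_ops \<Longrightarrow> act \<pi> 0 u = 0"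
  using act_scal[of u 0] by simp

lemma act_relator:
  assumes "x \<in> uq_rels q" "u \<in> disc_ops" shows "act \<pi> x u = 0"
proof -
  have "uc x = uc 0" using rel_ideal_base[OF assms(1)] by (simp add: pclass_eq_iff)
  then show ?thesis using act_zero[OF assms(2)] by (simp add: act_def)
qed

text \<open>A symmetry satisfies the product rule for every representative of the coproduct; it is
  applied to the one that comes from the formula for the generator.\<close>

lemma act_gen_product:
  assumes "u \<in> disc_ops" "v \<in> disc_ops"
  shows "act \<pi> (gen g) (u * v) = pair_sum
    (\<lambda>a b. act \<pi> (Poly_Mapping.single a 1) u * act \<pi> (Poly_Mapping.single b 1) v) (uq_comul_gen g)"
proof -
  let ?t = "tensor_proj (uq_rels q) (uq_comul_gen g)"
  have uv: "cls u \<otimes>\<^bsub>disc q\<^esub> cls v = cls (u * v)"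
    using assms by (auto simp: disc_ops_def disc_alg_simps simp flip: rep.mult)
  have "\<pi> (uc (gen g)) (cls u \<otimes>\<^bsub>disc q\<^esub> cls v) =
      (\<Oplus>\<^bsub>disc q\<^esub>p\<in>Poly_Mapping.keys ?t. Poly_Mapping.lookup ?t p \<odot>\<^bsub>disc q\<^esub>
        (\<pi> (fst p) (cls u) \<otimes>\<^bsub>disc q\<^esub> \<pi> (snd p) (cls v)))"
    using symmetry uq_comul_gen_mem cls_mem[OF assms(1)] cls_mem[OF assms(2)]
    unfolding disc_symmetry_def is_symmetry_def by (simp add: carrier_uq)
  then have "act \<pi> (gen g) (u * v) = pair_sum (\<lambda>X Y. act_cls \<pi> X u * act_cls \<pi> Y v) ?t"
    unfolding uv act_def act_cls_def[of \<pi> "uc (gen g)"]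
    using val_sweedler_sum(1)[OF uq_comul_supported[OF uq_comul_gen_mem] _ assms, of \<pi>]
      \<pi>_mem cls_mem by simp
  then show ?thesis by (simp add: pair_sum_tensor_proj act_def)
qed

definition "K = act \<pi> (gen U_k)"
definition "K' = act \<pi> (gen U_kinv)"
definition "E = act \<pi> (gen U_e)"
definition "F = act \<pi> (gen U_f)"

lemmas KEF_defs = K_def K'_def E_def F_def

lemma KEF_mem [simp]:
  assumes "u \<in> disc_ops"
  shows "K u \<in> disc_ops" "K' u \<in> disc_ops" "E u \<in> disc_ops" "F u \<in> disc_ops"
  using assms by (simp_all add: KEF_defs act_mem)

lemma KEF_add:
  assumes "u \<in> disc_ops" "v \<in> disc_ops"
  shows "K (u + v) = K u + K v" "K' (u + v) = K' u + K' v"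
    "E (u + v) = E u + E v" "F (u + v) = F u + F v"
  using assms by (simp_all add: KEF_defs act_add_right)

lemma KEF_sc:
  assumes "u \<in> disc_ops"
  shows "K (sc c * u) = sc c * K u" "K' (sc c * u) = sc c * K' u"
    "E (sc c * u) = sc c * E u" "F (sc c * u) = sc c * F u"
  using assms by (simp_all add: KEF_defs act_sc_right)

lemma KEF_diff:
  assumes "u \<in> disc_ops" "v \<in> disc_ops"
  shows "K (u - v) = K u - K v" "K' (u - v) = K' u - K' v"
    "E (u - v) = E u - E v" "F (u - v) = F u - F v"
  using KEF_add[OF disc_ops_diff[OF assms] assms(2)] by (simp_all add: eq_diff_eq)

lemma KEF_mult:
  assumes "u \<in> disc_ops" "v \<in> disc_ops"
  shows "K (u * v) = K u * K v" "K' (u * v) = K' u * K' v"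
    "E (u * v) = u * E v + E u * K v" "F (u * v) = F u * v + K' u * F v"
  using assms
  by (simp_all add: KEF_defs act_gen_product tens_def pair_sum_add pair_sum_single free_alg_word
      act_one)

lemma KEF_one: "K 1 = 1" "K' 1 = 1" "E 1 = 0" "F 1 = 0"
proof -
  have "act \<pi> (gen g) 1 = sc (uq_counit_gen g)" for g
  proof -
    have "\<pi> (uc (gen g)) \<one>\<^bsub>disc q\<^esub> = uq_counit_gen g \<odot>\<^bsub>disc q\<^esub> \<one>\<^bsub>disc q\<^esub>"
      using symmetry unfolding disc_symmetry_def is_symmetry_def
      by (simp add: carrier_uq uq_counit_pclass counit.gen)
    moreover have "cls 1 = \<one>\<^bsub>disc q\<^esub>" using cls_rep[of 1] by (simp add: rep.one disc_alg_simps)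
    ultimately show ?thesis
      by (simp add: act_def act_cls_def val_smult one_mem val_one)
  qed
  then show "K 1 = 1" "K' 1 = 1" "E 1 = 0" "F 1 = 0" by (simp_all add: KEF_defs)
qed

lemma KEF_relations:
  assumes "u \<in> disc_ops"
  shows "K' (K u) = u" "K (K' u) = u" "K (E u) = sc (q^2) * E (K u)"
    "K (F u) = sc (inverse (q^2)) * F (K u)"
    "E (F u) - F (E u) = sc (1 / (q - inverse q)) * (K u - K' u)"
proof -
  note rel = act_relator[OF _ assms, unfolded uq_rels_def]
  show "K' (K u) = u" "K (K' u) = u" "K (E u) = sc (q^2) * E (K u)"
    "K (F u) = sc (inverse (q^2)) * F (K u)"
    "E (F u) - F (E u) = sc (1 / (q - inverse q)) * (K u - K' u)"
    using rel[of "gen U_kinv * gen U_k - 1"] rel[of "gen U_k * gen U_kinv - 1"]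
      rel[of "gen U_k * gen U_e - scal (q^2) * gen U_e * gen U_k"]
      rel[of "gen U_k * gen U_f - scal (inverse (q^2)) * gen U_f * gen U_k"]
      rel[of "gen U_e * gen U_f - gen U_f * gen U_e
        - scal (1 / (q - inverse q)) * (gen U_k - gen U_kinv)"] assms
    by (simp_all add: KEF_defs act_diff_left act_mult act_one act_mem act_scal_mult act_scal disc_ops_diff
        mult.assoc)
qed

end

context quantum_disc
begin

text \<open>The product rules spread agreement from the generators to the whole disc. K and K' come
  before E and F, whose product rules contain them. For K' agreement follows from its being inverse
  to K.\<close>

lemma symmetry_eqI:
  assumes "disc_symmetry q \<pi>" "disc_symmetry q \<rho>"
    and "\<And>g u. g \<in> {U_k, U_e, U_f} \<Longrightarrow> u \<in> {op_z, w} \<Longrightarrow> act \<pi> (gen g) u = act \<rho> (gen g) u"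
  shows "\<pi> = \<rho>"
proof -
  interpret P: disc_action q \<pi> by unfold_locales (rule assms(1))
  interpret R: disc_action q \<rho> by unfold_locales (rule assms(2))
  have eqs: "P.K op_z = R.K op_z" "P.K w = R.K w" "P.E op_z = R.E op_z" "P.E w = R.E w"
    "P.F op_z = R.F op_z" "P.F w = R.F w"
    using assms(3) by (simp_all add: P.KEF_defs R.KEF_defs)
  have sc1: "sc c = sc c * 1" for c by simp
  have K: "P.K u = R.K u" if "u \<in> disc_ops" for u
    using that
  proof (induction rule: disc_ops_induct)
    case (sc c)
    show ?case by (subst (1 2) sc1) (simp add: P.KEF_sc R.KEF_sc P.KEF_one R.KEF_one del: mult_1_right)
  qed (simp_all add: P.KEF_mult R.KEF_mult P.KEF_add R.KEF_add eqs)
  have K': "P.K' u = R.K' u" if "u \<in> disc_ops" for u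
    using K[of "P.K' u"] P.KEF_relations(2)[OF that] R.KEF_relations(1)[of "P.K' u"] that by simp
  have E: "P.E u = R.E u" if "u \<in> disc_ops" for u
    using that
  proof (induction rule: disc_ops_induct)
    case (sc c)
    show ?case by (subst (1 2) sc1) (simp add: P.KEF_sc R.KEF_sc P.KEF_one R.KEF_one del: mult_1_right)
  qed (simp_all add: P.KEF_mult R.KEF_mult P.KEF_add R.KEF_add eqs K)
  have F: "P.F u = R.F u" if "u \<in> disc_ops" for u
    using that
  proof (induction rule: disc_ops_induct)
    case (sc c)
    show ?case by (subst (1 2) sc1) (simp add: P.KEF_sc R.KEF_sc P.KEF_one R.KEF_one del: mult_1_right)
  qed (simp_all add: P.KEF_mult R.KEF_mult P.KEF_add R.KEF_add eqs K')
  have gens: "act \<pi> (gen g) u = act \<rho> (gen g) u" if "u \<in> disc_ops" for g u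
    using K[OF that] K'[OF that] E[OF that] F[OF that]
    by (cases g) (simp_all add: P.KEF_defs R.KEF_defs)
  have all: "act \<pi> x u = act \<rho> x u" if "u \<in> disc_ops" for x u
    using that
    by (induction x rule: free_alg_induct)
       (simp_all add: P.act_scal R.act_scal P.act_mult R.act_mult P.act_add_left R.act_add_left
          gens R.act_mem)
  show "\<pi> = \<rho>"
  proof (rule extensionalityI[OF P.\<pi>_ext R.\<pi>_ext])
    fix X assume "X \<in> carrier (uq q)"
    then obtain x where x: "X = uc x" by (auto simp: carrier_uq)
    have "\<pi> (uc x) = \<rho> (uc x)"
    proof (rule extensionalityI)
      show "\<pi> (uc x) \<in> extensional (carrier (disc q))" "\<rho> (uc x) \<in> extensional (carrier (disc q))"
        using P.\<pi>_endo R.\<pi>_endo by (auto simp: linear_endos_def PiE_def)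
      fix Y assume "Y \<in> carrier (disc q)"
      then obtain p where "Y = dc p" by (auto simp: carrier_disc)
      then show "\<pi> (uc x) Y = \<rho> (uc x) Y"
        using all[of "rep q p" x] by (simp add: P.\<pi>_dc R.\<pi>_dc disc_ops_def)
    qed
    then show "\<pi> X = \<rho> X" by (simp add: x)
  qed
qed

end


section \<open>Operators give symmetries\<close>

text \<open>The converse passage, from four operators to a symmetry. The identities are stated for
  all band matrices, where inner operators satisfy them identically; the disc enters through
  \<open>ops_closed\<close>.\<close>

locale operator_action = quantum_disc +
  fixes ops :: "uq_gen \<Rightarrow> band \<Rightarrow> band"
  assumes ops_add: "ops g (u + v) = ops g u + ops g v"
    and ops_sc: "ops g (sc c * u) = sc c * ops g u"
    and ops_closed: "u \<in> disc_ops \<Longrightarrow> ops g u \<in> disc_ops"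
    and ops_mult: "ops U_k (u * v) = ops U_k u * ops U_k v"
      "ops U_kinv (u * v) = ops U_kinv u * ops U_kinv v"
      "ops U_e (u * v) = u * ops U_e v + ops U_e u * ops U_k v"
      "ops U_f (u * v) = ops U_f u * v + ops U_kinv u * ops U_f v"
    and ops_one: "ops U_k 1 = 1" "ops U_kinv 1 = 1"
    and ops_relations: "ops U_kinv (ops U_k u) = u" "ops U_k (ops U_kinv u) = u"
      "ops U_k (ops U_e u) = sc (q^2) * ops U_e (ops U_k u)"
      "ops U_k (ops U_f u) = sc (inverse (q^2)) * ops U_f (ops U_k u)"
      "ops U_e (ops U_f u) - ops U_f (ops U_e u) =
         sc (1 / (q - inverse q)) * (ops U_k u - ops U_kinv u)"
begin

lemma word_add: "foldr ops xs (u + v) = foldr ops xs u + foldr ops xs v"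
  by (induction xs) (simp_all add: ops_add)

lemma word_sc: "foldr ops xs (sc c * u) = sc c * foldr ops xs u"
  by (induction xs) (simp_all add: ops_sc)

lemma word_closed: "u \<in> disc_ops \<Longrightarrow> foldr ops xs u \<in> disc_ops"
  by (induction xs) (simp_all add: ops_closed)

definition opx :: "uq_gen free_alg \<Rightarrow> band \<Rightarrow> band" where
  "opx x u = (\<Sum>k\<in>Poly_Mapping.keys x. sc (Poly_Mapping.lookup x k) * foldr ops (letters k) u)"

lemma opx_add: "opx (x + x') u = opx x u + opx x' u"
  unfolding opx_def by (rule setsum_keys_plus_distrib) (simp_all add: sc_add distrib_right)

lemma opx_single: "opx (Poly_Mapping.single k c) u = sc c * foldr ops (letters k) u"
  by (simp add: opx_def)

lemma opx_add_right: "opx x (u + v) = opx x u + opx x v"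
  by (simp add: opx_def word_add distrib_left sum.distrib)

lemma opx_sc_right: "opx x (sc c * u) = sc c * opx x u"
  by (simp add: opx_def word_sc sum_distrib_left mult.commute)

lemma opx_mult: "opx (x * x') u = opx x (opx x' u)"
proof (induction x rule: poly_mapping_induct_single)
  case (single k c)
  note k = single
  show ?case
  proof (induction x' rule: poly_mapping_induct_single)
    case (single l d)
    then show ?case by (simp add: mult_single opx_single plus_monomial_def word_sc)
  qed (simp add: distrib_left opx_add opx_add_right)
qed (simp add: distrib_right opx_add)

lemma opx_zero: "opx 0 u = 0"
  by (simp add: opx_def)

lemma opx_diff: "opx (x - x') u = opx x u - opx x' u"
  using opx_add[of "x - x'" x'] by (simp add: algebra_simps)

lemma opx_scal: "opx (scal c) u = sc c * u"
  by (simp add: scal_def opx_single zero_monomial_def)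

lemma opx_one: "opx 1 u = u"
  using opx_scal[of 1] by simp

lemma opx_gen: "opx (gen g) u = ops g u"
  by (simp add: gen_def opx_single)

lemma opx_closed: "u \<in> disc_ops \<Longrightarrow> opx x u \<in> disc_ops"
proof (induction x rule: poly_mapping_induct_single)
  case (single k v)
  then show ?case by (simp add: opx_single word_closed disc_ops_mult)
qed (simp add: opx_add disc_ops_add)

lemma opx_zero_right: "opx x 0 = 0"
  using opx_sc_right[of x 0 0] by simp

text \<open>The elements acting by zero on all band matrices form a two-sided ideal, so it is enough
  to test the relators.\<close>

lemma opx_rel_ideal: "x \<in> rel_ideal (uq_rels q) \<Longrightarrow> opx x u = 0"
proof -
  have "opx r v = 0" if "r \<in> uq_rels q" for r v
    using that ops_relations[of v]
    by (auto simp: uq_rels_def opx_diff opx_mult opx_gen opx_one opx_scal)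
  then have "rel_ideal (uq_rels q) \<subseteq> {x. \<forall>u. opx x u = 0}"
    by (intro rel_ideal_subset) (auto simp: opx_zero opx_add opx_mult opx_zero_right)
  then show "x \<in> rel_ideal (uq_rels q) \<Longrightarrow> opx x u = 0" by auto
qed

lemma opx_cong: "uc x = uc x' \<Longrightarrow> opx x u = opx x' u"
  using opx_rel_ideal[of "x - x'" u] by (simp add: pclass_eq_iff opx_diff)

definition opc :: action where
  "opc = (\<lambda>X\<in>carrier (uq q). \<lambda>Y\<in>carrier (disc q). cls (opx (SOME x. uc x = X) (val Y)))"

lemma opc_pclass: "opc (uc x) = (\<lambda>Y\<in>carrier (disc q). cls (opx x (val Y)))"
proof -
  have "uc (SOME x'. uc x' = uc x) = uc x" by (rule someI[of _ x]) simp
  then have "opx (SOME x'. uc x' = uc x) v = opx x v" for v by (rule opx_cong)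
  then show ?thesis by (simp add: opc_def carrier_uq)
qed

lemma opc_mem: "Y \<in> carrier (disc q) \<Longrightarrow> opc (uc x) Y \<in> carrier (disc q)"
  by (simp add: opc_pclass cls_mem opx_closed val_mem)

lemma val_opc: "Y \<in> carrier (disc q) \<Longrightarrow> val (opc (uc x) Y) = opx x (val Y)"
  by (simp add: opc_pclass val_cls opx_closed val_mem)

lemma act_opc: "u \<in> disc_ops \<Longrightarrow> act opc x u = opx x u"
  by (simp add: act_def act_cls_def val_opc cls_mem val_cls)

lemma opc_endo: "opc (uc x) \<in> linear_endos (disc q)"
  unfolding linear_endos_def
proof (intro CollectI conjI ballI allI)
  show "opc (uc x) \<in> carrier (disc q) \<rightarrow>\<^sub>E carrier (disc q)"
    by (rule PiE_I) (simp_all add: opc_mem, simp add: opc_pclass)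
next
  fix Y Y' assume Y: "Y \<in> carrier (disc q)" "Y' \<in> carrier (disc q)"
  show "opc (uc x) (Y \<oplus>\<^bsub>disc q\<^esub> Y') = opc (uc x) Y \<oplus>\<^bsub>disc q\<^esub> opc (uc x) Y'"
    by (rule val_inj) (use Y in \<open>simp_all add: opc_mem val_ops val_opc opx_add_right\<close>)
next
  fix c Y assume Y: "Y \<in> carrier (disc q)"
  show "opc (uc x) (c \<odot>\<^bsub>disc q\<^esub> Y) = c \<odot>\<^bsub>disc q\<^esub> opc (uc x) Y"
    by (rule val_inj) (use Y in \<open>simp_all add: opc_mem val_smult val_opc opx_sc_right\<close>)
qed

lemma opc_hom: "opc \<in> alg_hom (uq q) (End_alg (disc q))"
proof -
  have eqI: "f = g" if "f \<in> extensional (carrier (disc q))" "g \<in> extensional (carrier (disc q))"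
    "\<And>Y. Y \<in> carrier (disc q) \<Longrightarrow> f Y \<in> carrier (disc q)"
    "\<And>Y. Y \<in> carrier (disc q) \<Longrightarrow> g Y \<in> carrier (disc q)"
    "\<And>Y. Y \<in> carrier (disc q) \<Longrightarrow> val (f Y) = val (g Y)"
    for f g :: "disc_gen free_alg set \<Rightarrow> disc_gen free_alg set"
    using that by (intro extensionalityI[OF that(1,2)]) (simp add: val_inj)
  have ext: "opc (uc x) \<in> extensional (carrier (disc q))" for x
    by (simp add: opc_pclass)
  have "opc \<in> ring_hom (uq q) (End_alg (disc q))"
  proof (rule ring_hom_memI)
    show "opc X \<in> carrier (End_alg (disc q))" if "X \<in> carrier (uq q)" for X
      using that opc_endo by (auto simp: carrier_uq End_alg_def)
    show "opc (X \<otimes>\<^bsub>uq q\<^esub> X') = opc X \<otimes>\<^bsub>End_alg (disc q)\<^esub> opc X'"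
      if X: "X \<in> carrier (uq q)" "X' \<in> carrier (uq q)" for X X'
    proof -
      obtain x x' where x: "X = uc x" "X' = uc x'" using X by (auto simp: carrier_uq)
      have "opc (uc (x * x')) = compose (carrier (disc q)) (opc (uc x)) (opc (uc x'))"
        by (rule eqI) (auto simp: ext opc_mem compose_def val_opc opx_mult)
      then show ?thesis by (simp add: x uq_alg_simps End_alg_def)
    qed
    show "opc (X \<oplus>\<^bsub>uq q\<^esub> X') = opc X \<oplus>\<^bsub>End_alg (disc q)\<^esub> opc X'"
      if X: "X \<in> carrier (uq q)" "X' \<in> carrier (uq q)" for X X'
    proof -
      obtain x x' where x: "X = uc x" "X' = uc x'" using X by (auto simp: carrier_uq)
      have "opc (uc (x + x')) =
          (\<lambda>Y\<in>carrier (disc q). opc (uc x) Y \<oplus>\<^bsub>disc q\<^esub> opc (uc x') Y)"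
        by (rule eqI) (auto simp: ext opc_mem val_opc val_ops opx_add)
      then show ?thesis by (simp add: x uq_alg_simps End_alg_def)
    qed
    have "opc (uc 1) = (\<lambda>Y\<in>carrier (disc q). Y)"
      by (rule eqI) (auto simp: ext opc_mem val_opc opx_one)
    then show "opc \<one>\<^bsub>uq q\<^esub> = \<one>\<^bsub>End_alg (disc q)\<^esub>" by (simp add: uq_alg_simps End_alg_def)
  qed
  moreover have "opc (c \<odot>\<^bsub>uq q\<^esub> X) = c \<odot>\<^bsub>End_alg (disc q)\<^esub> opc X" if X: "X \<in> carrier (uq q)" for c X
  proof -
    obtain x where x: "X = uc x" using X by (auto simp: carrier_uq)
    have "opc (uc (scal c * x)) = (\<lambda>Y\<in>carrier (disc q). c \<odot>\<^bsub>disc q\<^esub> opc (uc x) Y)"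
      by (rule eqI) (auto simp: ext opc_mem val_opc val_smult opx_mult opx_scal)
    then show ?thesis by (simp add: x uq_alg_simps End_alg_def)
  qed
  ultimately show ?thesis by (auto simp: alg_hom_def opc_def)
qed

text \<open>With F the free algebra on the generators, this is the action of F \<otimes> F on u
  \<otimes> v followed by multiplication.\<close>

definition opx2 :: "(uq_gen monomial \<times> uq_gen monomial \<Rightarrow>\<^sub>0 complex) \<Rightarrow> band \<Rightarrow> band \<Rightarrow> band" where
  "opx2 T u v = pair_sum
     (\<lambda>a b. opx (Poly_Mapping.single a 1) u * opx (Poly_Mapping.single b 1) v) T"

lemma opx2_gen: "opx2 (uq_comul_gen g * T) u v = ops g (opx2 T u v)"
proof (induction T rule: poly_mapping_induct_single)
  case (single k c)
  obtain a b where k: "k = (Mon a, Mon b)" by (metis monomial.exhaust surj_pair)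
  show ?case
    by (cases g)
       (simp_all add: opx2_def k tens_def mult_single pair_sum_add pair_sum_single distrib_right
         opx_single plus_monomial_def plus_prod_def ops_sc ops_mult distrib_left)
next
  case (add T T')
  then show ?case by (simp add: distrib_left opx2_def pair_sum_add ops_add)
qed

text \<open>The comultiplication is multiplicative, so splitting off the leftmost generator reduces
  the claim to \<open>opx2_gen\<close>, the product rule of one generator applied to each term of a
  coproduct.\<close>

lemma opx_product: "opx x (u * v) = opx2 (free_lift scal uq_comul_gen x) u v"
proof (induction x rule: free_alg_induct)
  case (scal c)
  then show ?case
    unfolding comul.hom_simps
    by (simp add: opx_scal opx2_def scal_def pair_sum_single opx_single zero_prod_def
        zero_monomial_def)
next
  case (gen g x)
  then show ?case by (simp add: comul.hom_simps opx_mult opx_gen opx2_gen)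
next
  case (add x x')
  then show ?case by (simp add: comul.hom_simps opx_add opx2_def pair_sum_add)
qed

lemma opx_one_right: "opx x 1 = sc (free_lift id uq_counit_gen x)"
proof (induction x rule: free_alg_induct)
  case (gen g x)
  have "ops U_e 1 = 0" "ops U_f 1 = 0"
    using ops_mult(3)[of 1 1] ops_mult(4)[of 1 1] by (simp_all add: ops_one)
  then have "ops g 1 = sc (uq_counit_gen g)" by (cases g) (simp_all add: ops_one)
  moreover have "ops g (sc c) = sc c * ops g 1" for c using ops_sc[of g c 1] by simp
  ultimately show ?case
    unfolding counit.mult counit.gen opx_mult opx_gen gen by (simp add: mult.commute flip: sc_mult)
next
  case (scal c)
  then show ?case unfolding counit.scal opx_scal by simp
next
  case (add x x')
  then show ?case by (simp only: counit.add opx_add sc_add)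
qed

lemma opc_sweedler:
  assumes "t \<in> uq_comul q X" "X \<in> carrier (uq q)" "u \<in> disc_ops" "v \<in> disc_ops"
  shows "val (opc X (cls u \<otimes>\<^bsub>disc q\<^esub> cls v)) = pair_sum (\<lambda>X Y. act_cls opc X u * act_cls opc Y v) t"
proof -
  let ?g = "\<lambda>X Y. act_cls opc X u * act_cls opc Y v"
  obtain x where x: "x \<in> X" "t - tensor_proj (uq_rels q) (free_lift scal uq_comul_gen x) \<in> tensor_null (uq q)"
    using assms(1) by (auto simp: uq_comul_def tensor_class_def)
  have X: "X = uc x"
    using assms(2) x(1) by (auto simp: carrier_uq mem_pclass_iff simp flip: pclass_eq_iff)
  have ac: "act_cls opc (uc x) u' = opx x u'" if "u' \<in> disc_ops" for x u'
    using act_opc[OF that] by (simp add: act_def)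
  \<comment> \<open>An arbitrary representative \<open>t\<close> is exchanged for the one computed
    in the free algebra: they differ by a null tensor, and \<open>?g\<close> is bilinear.\<close>
  have "pair_sum ?g (t - tensor_proj (uq_rels q) (free_lift scal uq_comul_gen x)) = 0"
    by (rule pair_sum_tensor_null[OF x(2)])
       (auto simp: carrier_uq uq_alg_simps ac assms(3,4) opx_add opx_mult opx_scal distrib_left
         distrib_right mult.assoc sc_left_commute)
  then have "pair_sum ?g t = pair_sum ?g (tensor_proj (uq_rels q) (free_lift scal uq_comul_gen x))"
    by (simp add: pair_sum_diff)
  also have "\<dots> = opx2 (free_lift scal uq_comul_gen x) u v"
    by (simp add: pair_sum_tensor_proj opx2_def ac assms(3,4))
  also have "\<dots> = opx x (u * v)" by (simp add: opx_product)
  finally show ?thesis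
    using assms(3,4) by (simp add: X val_opc val_ops cls_mem val_cls)
qed

lemma symmetry_opc: "disc_symmetry q opc"
  unfolding disc_symmetry_def is_symmetry_def
proof (intro conjI ballI)
  fix X Y Y' t
  assume X: "X \<in> carrier (uq q)" and Y: "Y \<in> carrier (disc q)" "Y' \<in> carrier (disc q)"
    and t: "t \<in> uq_comul q X"
  have mem: "opc X (cls u) \<in> carrier (disc q)" if "X \<in> carrier (uq q)" "u \<in> disc_ops" for X u
    using that by (auto simp: carrier_uq intro: opc_mem cls_mem)
  note sum = val_sweedler_sum[where \<pi> = opc, OF uq_comul_supported[OF t] mem val_mem[OF Y(1)] val_mem[OF Y(2)],
      unfolded cls_val[OF Y(1)] cls_val[OF Y(2)]]
  have "opc X (Y \<otimes>\<^bsub>disc q\<^esub> Y') \<in> carrier (disc q)"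
    using X Y by (auto simp: carrier_uq intro!: opc_mem val_ops)
  then show "opc X (Y \<otimes>\<^bsub>disc q\<^esub> Y') =
      (\<Oplus>\<^bsub>disc q\<^esub>p\<in>Poly_Mapping.keys t.
         Poly_Mapping.lookup t p \<odot>\<^bsub>disc q\<^esub> (opc (fst p) Y \<otimes>\<^bsub>disc q\<^esub> opc (snd p) Y'))"
    using sum opc_sweedler[OF t X val_mem[OF Y(1)] val_mem[OF Y(2)]] Y
    by (intro val_inj) (simp_all add: cls_val)
next
  fix X assume "X \<in> carrier (uq q)"
  then obtain x where X: "X = uc x" by (auto simp: carrier_uq)
  have "val (opc (uc x) \<one>\<^bsub>disc q\<^esub>) = val (uq_counit X \<odot>\<^bsub>disc q\<^esub> \<one>\<^bsub>disc q\<^esub>)"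
    by (simp add: X val_opc one_mem val_one val_smult opx_one_right uq_counit_pclass)
  then show "opc X \<one>\<^bsub>disc q\<^esub> = uq_counit X \<odot>\<^bsub>disc q\<^esub> \<one>\<^bsub>disc q\<^esub>"
    unfolding X by (intro val_inj) (simp_all add: opc_mem one_mem val_smult)
qed (rule opc_hom)

lemma acts_opc: "acts q opc g p r \<longleftrightarrow> ops g (rep q p) = rep q r"
proof -
  interpret disc_action q opc by unfold_locales (rule symmetry_opc)
  show ?thesis by (simp add: acts_iff act_opc opx_gen disc_ops_def)
qed

end

text \<open>\<open>X\<close> and \<open>X'\<close> need not lie in the image of the disc; in the applications they have \<open>y\<^sup>-\<^sup>1\<close> in them.\<close>

locale inner_action = quantum_disc +
  fixes G G' X X' :: band
  assumes G_inverse: "G * G' = 1" "G' * G = 1"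
    and X_weight: "G * X * G' = sc (q^2) * X"
    and X'_weight: "G * X' * G' = sc (inverse (q^2)) * X'"
    and commutation: "(X' * X - sc (inverse (q^2)) * (X * X')) * (G * u * G') -
        G' * u * G * (X' * X - sc (inverse (q^2)) * (X * X')) =
      sc (1 / (q - inverse q)) * (G * u * G' - G' * u * G)"
    and K_closed: "G * op_z * G' \<in> disc_ops" "G * w * G' \<in> disc_ops"
      "G' * op_z * G \<in> disc_ops" "G' * w * G \<in> disc_ops"
    and E_closed: "op_z * X - X * (G * op_z * G') \<in> disc_ops" "w * X - X * (G * w * G') \<in> disc_ops"
    and F_closed: "X' * op_z - G' * op_z * G * X' \<in> disc_ops" "X' * w - G' * w * G * X' \<in> disc_ops"
begin

fun iops :: "uq_gen \<Rightarrow> band \<Rightarrow> band" where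
  "iops U_k u = G * u * G'"
| "iops U_kinv u = G' * u * G"
| "iops U_e u = u * X - X * (G * u * G')"
| "iops U_f u = X' * u - G' * u * G * X'"

lemma G_cancel: "G * (G' * u) = u" "G' * (G * u) = u"
  by (simp_all add: G_inverse flip: mult.assoc)

lemma iops_mult:
  "iops U_k (u * v) = iops U_k u * iops U_k v"
  "iops U_kinv (u * v) = iops U_kinv u * iops U_kinv v"
  "iops U_e (u * v) = u * iops U_e v + iops U_e u * iops U_k v"
  "iops U_f (u * v) = iops U_f u * v + iops U_kinv u * iops U_f v"
  by (simp_all add: mult.assoc algebra_simps G_cancel)

lemma iops_add: "iops g (u + v) = iops g u + iops g v"
  by (cases g) (simp_all add: algebra_simps)

lemma iops_sc: "iops g (sc c * u) = sc c * iops g u"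
  by (cases g) (simp_all add: mult.assoc sc_left_commute right_diff_distrib)

lemma iops_one: "iops U_k 1 = 1" "iops U_kinv 1 = 1" "iops U_e 1 = 0" "iops U_f 1 = 0"
  by (simp_all add: G_inverse)

lemma iops_closed: "u \<in> disc_ops \<Longrightarrow> iops g u \<in> disc_ops"
proof -
  have sc1: "iops g (sc c) = sc c * iops g 1" for g c using iops_sc[of g c 1] by simp
  have k: "iops U_k u \<in> disc_ops" if "u \<in> disc_ops" for u
    using that
    by (induction rule: disc_ops_induct)
       (simp_all add: sc1 iops_one iops_mult iops_add K_closed disc_ops_mult disc_ops_add
         del: iops.simps, simp_all add: K_closed disc_ops_mult)
  have k': "iops U_kinv u \<in> disc_ops" if "u \<in> disc_ops" for u
    using that
    by (induction rule: disc_ops_induct)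
       (simp_all add: sc1 iops_one iops_mult iops_add K_closed disc_ops_mult disc_ops_add
         del: iops.simps, simp_all add: K_closed disc_ops_mult)
  have ez: "iops U_e op_z \<in> disc_ops" "iops U_e w \<in> disc_ops" "iops U_f op_z \<in> disc_ops"
    "iops U_f w \<in> disc_ops" "iops U_kinv op_z \<in> disc_ops" "iops U_kinv w \<in> disc_ops"
    using E_closed F_closed K_closed by simp_all
  have e: "iops U_e u \<in> disc_ops" if "u \<in> disc_ops" for u
    using that
    by (induction rule: disc_ops_induct)
       (simp_all add: sc1 iops_one iops_mult iops_add ez k disc_ops_mult disc_ops_add
         del: iops.simps)
  have f: "iops U_f u \<in> disc_ops" if "u \<in> disc_ops" for u
    using that
    by (induction rule: disc_ops_induct)
       (simp_all add: sc1 iops_one iops_mult iops_add ez k' disc_ops_mult disc_ops_add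
         del: iops.simps)
  show "u \<in> disc_ops \<Longrightarrow> iops g u \<in> disc_ops"
    by (cases g) (use k k' e f in auto)
qed

lemma iops_relations:
  "iops U_kinv (iops U_k u) = u" "iops U_k (iops U_kinv u) = u"
  "iops U_k (iops U_e u) = sc (q^2) * iops U_e (iops U_k u)"
  "iops U_k (iops U_f u) = sc (inverse (q^2)) * iops U_f (iops U_k u)"
  "iops U_e (iops U_f u) - iops U_f (iops U_e u) =
     sc (1 / (q - inverse q)) * (iops U_k u - iops U_kinv u)"
proof -
  show "iops U_kinv (iops U_k u) = u" "iops U_k (iops U_kinv u) = u"
    by (simp_all add: mult.assoc G_cancel G_inverse)
  have KX: "iops U_k X = sc (q^2) * X" "iops U_k X' = sc (inverse (q^2)) * X'"
    using X_weight X'_weight by simp_all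
  have KK: "iops U_k (G' * v * G) = v" for v by (simp add: mult.assoc G_cancel G_inverse)
  have diff: "iops g (u - v) = iops g u - iops g v" for g u v
    using iops_add[of g "u - v" v] by simp
  have e: "iops U_e v = v * X - X * iops U_k v" for v by simp
  have f: "iops U_f v = X' * v - iops U_kinv v * X'" for v by simp
  have kk': "iops U_k (iops U_kinv v) = v" "iops U_kinv (iops U_k v) = v" for v
    by (simp_all add: mult.assoc G_cancel G_inverse)
  have K'X: "iops U_kinv X = sc (inverse (q^2)) * X"
  proof -
    have "X = sc (q^2) * iops U_kinv X"
      using kk'(2)[of X] unfolding KX iops_sc by simp
    then have "sc (inverse (q^2)) * X = sc (inverse (q^2)) * (sc (q^2) * iops U_kinv X)" by simp
    then show ?thesis by simp
  qed
  show "iops U_k (iops U_e u) = sc (q^2) * iops U_e (iops U_k u)"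
    unfolding e diff iops_mult KX by (simp only: right_diff_distrib sc_left_commute mult.assoc)
  show "iops U_k (iops U_f u) = sc (inverse (q^2)) * iops U_f (iops U_k u)"
    unfolding f diff iops_mult KX kk' by (simp only: right_diff_distrib sc_left_commute mult.assoc)
  \<comment> \<open>X'uX and q^-2 XuX' occur in both products and cancel. The remaining terms
    contain X and X' only through X'X - q^-2 XX', the factor q^-2 being the weight of X' under k and
    of X under the inverse of k.\<close>
  have "iops U_e (iops U_f u) - iops U_f (iops U_e u) =
      (X' * X - sc (inverse (q^2)) * (X * X')) * iops U_k u -
      iops U_kinv u * (X' * X - sc (inverse (q^2)) * (X * X'))"
    unfolding e f diff iops_mult KX K'X kk'
    by (simp only: right_diff_distrib left_diff_distrib sc_left_commute mult.assoc)
       (simp add: algebra_simps)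
  also have "\<dots> = sc (1 / (q - inverse q)) * (iops U_k u - iops U_kinv u)"
    using commutation by simp
  finally show "iops U_e (iops U_f u) - iops U_f (iops U_e u) =
      sc (1 / (q - inverse q)) * (iops U_k u - iops U_kinv u)" .
qed

sublocale operator_action q iops
  by unfold_locales (rule iops_add iops_sc iops_closed iops_mult iops_one iops_relations; assumption?)+

end


section \<open>Existence\<close>

text \<open>Conjugation by this diagonal matrix multiplies the n-th diagonal by l^n, so that the
  action of k becomes inner as well.\<close>

definition cz :: "complex \<Rightarrow> band" where
  "cz l = dg 0 (\<lambda>i. l powi i)"

lemma cz_conj_dg:
  assumes "l \<noteq> 0"
  shows "cz l * dg n h * cz (inverse l) = dg n (\<lambda>i. l powi n * h i)"
  unfolding cz_def dg_mult
  using assms by (intro dg_eqI) (simp_all add: power_int_diff power_int_inverse field_simps)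

lemma ent_cz_conj:
  assumes "l \<noteq> 0"
  shows "ent (cz l * u * cz (inverse l)) n i = l powi n * ent u n i"
  using assms
  by (simp add: cz_def ent_dg_mult ent_mult_dg power_int_diff power_int_inverse field_simps)

lemma cz_inverse: "l \<noteq> 0 \<Longrightarrow> cz l * cz (inverse l) = 1"
  by (simp add: cz_def dg_mult power_int_inverse flip: dg_one)

context quantum_disc
begin

lemma s_simps:
  "s (i + 1) = s i / q^2" "s (i - 1) = q^2 * s i" "s (1 + i) = s i / q^2"
  "s (i + 2) = s i / q^4" "s (2 + i) = s i / q^4"
  using s_add[of i 1] s_add[of i 2] s_diff[of i 1]
  by (simp_all add: power_int_minus field_simps add.commute)

lemma q2: "q^2 \<noteq> 1"
  using q_not_root[of 2] by simp

text \<open>The formulas for \<open>E z\<close>, \<open>E w\<close>, \<open>F z\<close>, \<open>F w\<close> spell out \<open>uX - XK(u)\<close> and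
  \<open>X'u - K\<^sup>-\<^sup>1(u)X'\<close> for \<open>X = x t\<^sup>n\<close> and \<open>X' = x' t\<^sup>-\<^sup>n\<close>.\<close>

definition inner_formulas ::
  "complex \<Rightarrow> int \<Rightarrow> (int \<Rightarrow> complex) \<Rightarrow> (int \<Rightarrow> complex) \<Rightarrow> disc_gen free_alg \<Rightarrow> disc_gen free_alg \<Rightarrow>
   disc_gen free_alg \<Rightarrow> disc_gen free_alg \<Rightarrow> disc_gen free_alg \<Rightarrow> disc_gen free_alg \<Rightarrow> bool" where
  "inner_formulas l n x x' ey ez ezs fy fz fzs \<longleftrightarrow>
     rep q ey = dg n (\<lambda>i. (s i - s (i - n)) * x i) \<and>
     rep q ez = dg (n + 1) (\<lambda>i. x (i - 1) - l * x i) \<and>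
     rep q ezs = dg (n - 1) (\<lambda>i. (1 - s (i + 1)) * x (i + 1) - x i * (1 - s (i - n + 1)) / l) \<and>
     rep q fy = dg (- n) (\<lambda>i. (s (i + n) - s i) * x' i) \<and>
     rep q fz = dg (1 - n) (\<lambda>i. x' i - x' (i - 1) / l) \<and>
     rep q fzs = dg (- 1 - n) (\<lambda>i. x' i * (1 - s (i + n + 1)) - l * (1 - s (i + 1)) * x' (i + 1))"

text \<open>With G = \<open>cz l\<close>, assumption \<open>T\<close> says X'X - q^-2 XX' = 1/(q -
  q^-1) + d G^-2. The last term drops out of the commutation condition for every d, since G^-2 K(u)
  and K^-1(u) G^-2 are both G^-1 u G^-1.\<close>

lemma ex_symmetry:
  fixes x x' :: "int \<Rightarrow> complex" and n :: int
  assumes l: "l \<noteq> 0"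
    and x: "\<And>i. l powi n * x i = q^2 * x i" and x': "\<And>i. l powi n * x' i = q^2 * x' i"
    and T: "\<And>i. x' i * x (i + n) - x i * x' (i - n) / q^2 =
      1 / (q - inverse q) + d * l powi (- 2 * i)"
    and formulas: "inner_formulas l n x x' ey ez ezs fy fz fzs"
  shows "\<exists>\<pi>. disc_symmetry q \<pi> \<and> acts q \<pi> U_k vz (scal l * vz) \<and>
    acts q \<pi> U_k vzs (scal (inverse l) * vzs) \<and>
    acts q \<pi> U_e vy ey \<and> acts q \<pi> U_e vz ez \<and> acts q \<pi> U_e vzs ezs \<and>
    acts q \<pi> U_f vy fy \<and> acts q \<pi> U_f vz fz \<and> acts q \<pi> U_f vzs fzs"
proof -
  have e: "rep q ez = dg (n + 1) (\<lambda>i. x (i - 1) - l * x i)"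
      "rep q ezs = dg (n - 1) (\<lambda>i. (1 - s (i + 1)) * x (i + 1) - x i * (1 - s (i - n + 1)) / l)"
    and f: "rep q fz = dg (1 - n) (\<lambda>i. x' i - x' (i - 1) / l)"
      "rep q fzs = dg (- 1 - n) (\<lambda>i. x' i * (1 - s (i + n + 1)) - l * (1 - s (i + 1)) * x' (i + 1))"
    and y: "rep q ey = dg n (\<lambda>i. (s i - s (i - n)) * x i)"
      "rep q fy = dg (- n) (\<lambda>i. (s (i + n) - s i) * x' i)"
    using formulas by (simp_all add: inner_formulas_def)
  let ?G = "cz l" and ?G' = "cz (inverse l)"
  define X where "X = dg n x"
  define X' where "X' = dg (- n) x'"
  have l': "inverse l \<noteq> 0" "inverse (inverse l) = l" using l by simp_all
  have G: "?G * dg m h * ?G' = dg m (\<lambda>i. l powi m * h i)"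
    "?G' * dg m h * ?G = dg m (\<lambda>i. l powi (- m) * h i)" for m h
    using cz_conj_dg[OF l] cz_conj_dg[OF l'(1)]
    by (simp_all add: l power_int_minus power_int_inverse)
  have G1: "?G * op_z * ?G' = sc l * op_z" "?G' * op_z * ?G = sc (inverse l) * op_z"
    "?G * w * ?G' = sc (inverse l) * w" "?G' * w * ?G = sc l * w"
    unfolding op_z_def op_w_def G by (simp_all add: sc_mult_dg power_int_minus)
  have T': "X' * X - sc (inverse (q^2)) * (X * X') =
      dg 0 (\<lambda>i. 1 / (q - inverse q) + d * l powi (- 2 * i))"
    unfolding X_def X'_def dg_mult sc_mult_dg
    using T by (simp add: dg_diff dg_eq_iff field_simps)
  have e': "op_z * X - X * (?G * op_z * ?G') = rep q ez" "w * X - X * (?G * w * ?G') = rep q ezs"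
    unfolding G1 unfolding e X_def op_z_def op_w_def
    by (simp_all add: dg_mult sc_mult_dg dg_diff add.commute sc_left_commute dg_eq_iff field_simps)
  have f': "X' * op_z - ?G' * op_z * ?G * X' = rep q fz" "X' * w - ?G' * w * ?G * X' = rep q fzs"
    unfolding G1 unfolding f X'_def op_z_def op_w_def mult.assoc
    by (simp_all add: dg_mult sc_mult_dg dg_diff add.commute dg_eq_iff field_simps)
  interpret inner_action q ?G ?G' X X'
  proof
    show "?G * ?G' = 1" "?G' * ?G = 1" using cz_inverse[OF l] cz_inverse[OF l'(1)] by simp_all
    show "?G * X * ?G' = sc (q^2) * X"
      unfolding X_def G x by (simp only: sc_mult_dg)
    show "?G * X' * ?G' = sc (inverse (q^2)) * X'"
      unfolding X'_def G
    proof -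
      have "l powi (- n) * x' i = inverse (q^2) * x' i" for i
        using x'[of i] l by (simp add: power_int_minus field_simps)
      then show "dg (- n) (\<lambda>i. l powi (- n) * x' i) = sc (inverse (q^2)) * dg (- n) x'"
        by (simp only: sc_mult_dg)
    qed
    show "(X' * X - sc (inverse (q^2)) * (X * X')) * (?G * u * ?G') -
        ?G' * u * ?G * (X' * X - sc (inverse (q^2)) * (X * X')) =
        sc (1 / (q - inverse q)) * (?G * u * ?G' - ?G' * u * ?G)" for u
    proof (rule band_eqI)
      fix m i
      define t where "t = l powi i"
      define r where "r = l powi m"
      have nz: "t \<noteq> 0" "r \<noteq> 0" using l by (simp_all add: t_def r_def)
      have sq: "t * t = l powi (2 * i)" "r * r = l powi (2 * m)"
        using l by (simp_all add: t_def r_def flip: power_int_add)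
      have "- 2 * (i - m) = 2 * m - 2 * i" by simp
      then have T_shift: "l powi (- 2 * i) = 1 / (t * t)" "l powi (- 2 * (i - m)) = r * r / (t * t)"
        using power_int_minus[of l "2 * i"] power_int_diff[of l "2 * m" "2 * i"] l
        by (simp_all only: sq mult_minus_left inverse_eq_divide) simp_all
      have conj: "ent (?G * u * ?G') m i = r * ent u m i" "ent (?G' * u * ?G) m i = ent u m i / r"
        using ent_cz_conj[OF l, of u m i] ent_cz_conj[OF l'(1), of u m i]
        by (simp_all only: l'(2) r_def power_int_inverse divide_inverse mult.commute[of _ "ent u m i"])
      have "(c + d * (1 / (t * t))) * (r * e) - e / r * (c + d * (r * r / (t * t))) =
          c * (r * e - e / r)" for c e
        using nz by (simp add: field_simps)
      then show "ent ((X' * X - sc (inverse (q^2)) * (X * X')) * (?G * u * ?G') -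
          ?G' * u * ?G * (X' * X - sc (inverse (q^2)) * (X * X'))) m i =
          ent (sc (1 / (q - inverse q)) * (?G * u * ?G' - ?G' * u * ?G)) m i"
        unfolding T' ent_simps ent_dg_mult ent_mult_dg ent_sc_mult diff_zero conj T_shift .
    qed
    show "?G * op_z * ?G' \<in> disc_ops" "?G * w * ?G' \<in> disc_ops"
      "?G' * op_z * ?G \<in> disc_ops" "?G' * w * ?G \<in> disc_ops"
      unfolding G1 by (auto intro: disc_ops_mult)
    show "op_z * X - X * (?G * op_z * ?G') \<in> disc_ops" "w * X - X * (?G * w * ?G') \<in> disc_ops"
      "X' * op_z - ?G' * op_z * ?G * X' \<in> disc_ops" "X' * w - ?G' * w * ?G * X' \<in> disc_ops"
      unfolding e' f' by (simp_all add: disc_ops_def)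
  qed
  have yX: "y * X - X * (?G * y * ?G') = rep q ey"
    unfolding y op_y_def G X_def by (simp add: dg_mult dg_diff dg_eq_iff algebra_simps)
  have yX': "X' * y - ?G' * y * ?G * X' = rep q fy"
    unfolding y op_y_def G X'_def by (simp add: dg_mult dg_diff dg_eq_iff algebra_simps)
  show ?thesis
    by (rule exI[of _ opc], intro conjI symmetry_opc)
       (simp_all add: acts_opc rep.hom_simps rep_vz rep_vzs rep_vy G1 e'[unfolded G1] f'[unfolded G1] yX yX')
qed

lemma symmetry_unique:
  assumes "disc_symmetry q \<pi>" "disc_symmetry q \<rho>"
    and "\<And>g p. g \<in> {U_k, U_e, U_f} \<Longrightarrow> p \<in> {vz, vzs} \<Longrightarrow> \<exists>r. acts q \<pi> g p r \<and> acts q \<rho> g p r"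
  shows "\<pi> = \<rho>"
proof (rule symmetry_eqI[OF assms(1,2)])
  interpret P: disc_action q \<pi> by unfold_locales (rule assms(1))
  interpret R: disc_action q \<rho> by unfold_locales (rule assms(2))
  fix g u assume g: "g \<in> {U_k, U_e, U_f}" and "u \<in> {op_z, w}"
  then obtain p where p: "p \<in> {vz, vzs}" "u = rep q p" by (auto simp flip: rep_vz[of q] rep_vzs)
  then show "act \<pi> (gen g) u = act \<rho> (gen g) u"
    using assms(3)[OF g p(1)] by (auto simp: P.acts_iff R.acts_iff)
qed

lemma ex1_symmetry:
  assumes "\<exists>\<pi>. disc_symmetry q \<pi> \<and> S \<pi>"
    and "\<And>g p. g \<in> {U_k, U_e, U_f} \<Longrightarrow> p \<in> {vz, vzs} \<Longrightarrow> \<exists>r. \<forall>\<pi>. S \<pi> \<longrightarrow> acts q \<pi> g p r"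
  shows "\<exists>!\<pi>. disc_symmetry q \<pi> \<and> S \<pi>"
proof (rule ex_ex1I[OF assms(1)])
  fix \<pi> \<rho> assume *: "disc_symmetry q \<pi> \<and> S \<pi>" "disc_symmetry q \<rho> \<and> S \<rho>"
  show "\<pi> = \<rho>"
  proof (rule symmetry_unique)
    fix g p assume "g \<in> {U_k, U_e, U_f}" "p \<in> {vz, vzs}"
    from assms(2)[OF this] * show "\<exists>r. acts q \<pi> g p r \<and> acts q \<rho> g p r" by blast
  qed (use * in auto)
qed

lemmas rep_dg_simps = rep.hom_simps rep_vz rep_vzs rep_vy op_z_def op_w_def op_y_def sc_def
  dg_mult dg_add dg_diff dg_uminus power2_eq_square[of "dg n h" for n h]

lemma ex1_series_0plus: "\<exists>!\<pi>. disc_symmetry q \<pi> \<and> series_0plus q \<pi>"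
proof (rule ex1_symmetry)
  have "\<exists>\<pi>. disc_symmetry q \<pi> \<and> acts q \<pi> U_k vz (scal 1 * vz) \<and>
      acts q \<pi> U_k vzs (scal (inverse 1) * vzs) \<and>
      acts q \<pi> U_e vy 0 \<and> acts q \<pi> U_e vz 0 \<and> acts q \<pi> U_e vzs 0 \<and>
      acts q \<pi> U_f vy 0 \<and> acts q \<pi> U_f vz 0 \<and> acts q \<pi> U_f vzs 0"
    \<comment> \<open>X and X' are 0, and l^(-2i) = 1; hence d has to cancel the constant 1/(q -
      q^-1). The same d serves l = -1, where l^(-2i) is again 1.\<close>
    by (rule ex_symmetry[of 1 0 "\<lambda>_. 0" "\<lambda>_. 0" "- 1 / (q - inverse q)"])
       (simp_all add: inner_formulas_def rep.hom_simps dg_zero)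
  then show "\<exists>\<pi>. disc_symmetry q \<pi> \<and> series_0plus q \<pi>" by (auto simp: series_0plus_def)
qed (auto simp: series_0plus_def)

lemma ex1_series_0minus: "\<exists>!\<pi>. disc_symmetry q \<pi> \<and> series_0minus q \<pi>"
proof (rule ex1_symmetry)
  have "\<exists>\<pi>. disc_symmetry q \<pi> \<and> acts q \<pi> U_k vz (scal (-1) * vz) \<and>
      acts q \<pi> U_k vzs (scal (inverse (-1)) * vzs) \<and>
      acts q \<pi> U_e vy 0 \<and> acts q \<pi> U_e vz 0 \<and> acts q \<pi> U_e vzs 0 \<and>
      acts q \<pi> U_f vy 0 \<and> acts q \<pi> U_f vz 0 \<and> acts q \<pi> U_f vzs 0"
    by (rule ex_symmetry[of "-1" 0 "\<lambda>_. 0" "\<lambda>_. 0" "- 1 / (q - inverse q)"])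
       (simp_all add: inner_formulas_def rep.hom_simps dg_zero power_int_minus power_int_mult)
  then show "\<exists>\<pi>. disc_symmetry q \<pi> \<and> series_0minus q \<pi>"
    by (auto simp: series_0minus_def scal_uminus)
qed (auto simp: series_0minus_def)

text \<open>For l = q^2 and l = q^-2 the correction term l^(-2i) of \<open>ex_symmetry\<close> is
  y^2 and y^-2, respectively.\<close>

lemma powi_sp: "(q^2) powi (- 2 * i) = s i * s i" "(inverse (q^2)) powi (- 2 * i) = 1 / (s i * s i)"
proof -
  have "(q^2) powi (- 2 * i) = q powi (2 * (- 2 * i))"
    using power_int_mult[of q 2 "- 2 * i"] by simp
  also have "\<dots> = s i * s i" by (simp add: sp_def flip: power_int_add)
  finally show "(q^2) powi (- 2 * i) = s i * s i" .
  then show "(inverse (q^2)) powi (- 2 * i) = 1 / (s i * s i)"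
    by (simp only: power_int_inverse) (simp add: divide_inverse)
qed

lemma c_eq: "1 / (q - inverse q) = - q / (1 - q^2)"
  using q2 by (simp add: divide_simps) (simp add: algebra_simps power2_eq_square)

text \<open>x and x' are found by dividing the entries of e(y) and f(y) by
  \<open>s i - s (i - n)\<close> and \<open>s (i + n) - s i\<close>. For n = 1 these divisors are (1
  - q^2) s i and q^-2 (1 - q^2) s i, and the factor s i cancels against the y in e(y) and
  f(y).\<close>

lemma formulas_1a:
  assumes "b0 \<noteq> 0"
  shows "inner_formulas (q^2) (1) (\<lambda>_. q / (b0 * (1 - q^2)))
    (\<lambda>i. (1 - s i / q^2) * (b0 + b1 * s i) * q^2 / (1 - q^2))
    (scal (inverse q * inverse b0) * vz * vy)
    (scal (q * inverse b0) * vz^2)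
    (scal (- inverse q * inverse b0))
    ((scal b0 * vy + scal b1 * vy^2) * vzs)
    (- scal b0 - scal b1 * vy^2)
    (scal (q^2 * b0) * vzs^2)"
  unfolding inner_formulas_def using assms q2
  by (simp add: rep_dg_simps dg_eq_iff s_simps)
     (simp add: divide_simps power2_eq_square power3_eq_cube power4_eq_xxxx dg_zero,
      simp add: algebra_simps)

lemma ex1_series_1a:
  assumes "b0 \<noteq> 0" shows "\<exists>!\<pi>. disc_symmetry q \<pi> \<and> series_1a q b0 b1 \<pi>"
proof (rule ex1_symmetry)
  have q1: "q * q \<noteq> 1" "1 \<noteq> q * q" using q2 by (auto simp: power2_eq_square)
  show "\<exists>\<pi>. disc_symmetry q \<pi> \<and> series_1a q b0 b1 \<pi>"
    unfolding series_1a_def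
  \<comment> \<open>In X'X - q^-2 XX' the terms linear in y cancel, the constant term is 1/(q -
    q^-1), and d is the coefficient of y^2.\<close>
  proof (rule ex_symmetry[OF _ _ _ _ formulas_1a[OF assms], where d = "- q * b1 / (b0 * (1 - q^2))"], goal_cases)
    case (4 i)
    show ?case
      unfolding powi_sp c_eq s_simps using q1 assms
      by (simp add: s_simps divide_simps power2_eq_square power3_eq_cube) (simp add: algebra_simps)
  qed (simp_all add: power_int_minus)
qed (auto simp: series_1a_def)

lemma formulas_1b:
  assumes "a0 \<noteq> 0"
  shows "inner_formulas (q^2) (1) (\<lambda>i. (a0 + q^2 * a1 * s i) * q^2 / (1 - q^2))
    (\<lambda>i. (1 - s i / q^2) * q / (a0 * (1 - q^2)))
    (vz * (scal a0 * vy + scal a1 * vy^2))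
    (scal (q^2 * a0) * vz^2)
    (- scal a0 - scal a1 * vy^2)
    (scal (inverse q * inverse a0) * vy * vzs)
    (scal (- inverse q * inverse a0))
    (scal (q * inverse a0) * vzs^2)"
  unfolding inner_formulas_def using assms q2
  by (simp add: rep_dg_simps dg_eq_iff s_simps)
     (simp add: divide_simps power2_eq_square power3_eq_cube power4_eq_xxxx dg_zero,
      simp add: algebra_simps)

lemma ex1_series_1b:
  assumes "a0 \<noteq> 0" shows "\<exists>!\<pi>. disc_symmetry q \<pi> \<and> series_1b q a0 a1 \<pi>"
proof (rule ex1_symmetry)
  have q1: "q * q \<noteq> 1" "1 \<noteq> q * q" using q2 by (auto simp: power2_eq_square)
  show "\<exists>\<pi>. disc_symmetry q \<pi> \<and> series_1b q a0 a1 \<pi>"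
    unfolding series_1b_def
  proof (rule ex_symmetry[OF _ _ _ _ formulas_1b[OF assms], where d = "- q * a1 / (a0 * (1 - q^2))"], goal_cases)
    case (4 i)
    show ?case
      unfolding powi_sp c_eq s_simps using q1 assms
      by (simp add: s_simps divide_simps power2_eq_square power3_eq_cube) (simp add: algebra_simps)
  qed (simp_all add: power_int_minus)
qed (auto simp: series_1b_def)

text \<open>Again x and x' are the entries of e(y) and f(y) divided by the differences of s. For n =
  -1 the numerators are in general not divisible by s i, so y^-1 remains in X and X', and d becomes
  the coefficient of y^-2.\<close>

lemma formulas_m1a:
  assumes "b1 \<noteq> 0"
  shows "inner_formulas (inverse (q^2)) (- 1) (\<lambda>i. q ^ 3 * (1 - s i / q^2) / (b1 * s i * (1 - q^2)))
    (\<lambda>i. (b0 + q^2 * b1 * s i) / (s i * (q^2 - 1)))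
    (scal (- q * inverse b1) * vzs)
    (scal (inverse q * inverse b1))
    0
    (vz * (scal b0 + scal b1 * vy))
    (scal (- (q^2) * b1) * vz^2)
    (scal (- inverse (q^2) * b0 + b1) - scal ((1 + inverse (q^2)) * b1) * vy)"
  unfolding inner_formulas_def using assms q2
  by (simp add: rep_dg_simps dg_eq_iff s_simps)
     (simp add: divide_simps power2_eq_square power3_eq_cube power4_eq_xxxx dg_zero,
      simp add: algebra_simps)

lemma ex1_series_m1a:
  assumes "b1 \<noteq> 0" shows "\<exists>!\<pi>. disc_symmetry q \<pi> \<and> series_m1a q b0 b1 \<pi>"
proof (rule ex1_symmetry)
  have q1: "q * q \<noteq> 1" "1 \<noteq> q * q" using q2 by (auto simp: power2_eq_square)
  show "\<exists>\<pi>. disc_symmetry q \<pi> \<and> series_m1a q b0 b1 \<pi>"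
    unfolding series_m1a_def
  proof (rule ex_symmetry[OF _ _ _ _ formulas_m1a[OF assms], where d = "q * b0 / (b1 * (q^2 - 1))", unfolded inverse_inverse_eq], goal_cases)
    case (4 i)
    show ?case
      unfolding powi_sp c_eq s_simps using q1 assms
      by (simp add: s_simps divide_simps power2_eq_square power3_eq_cube) (simp add: algebra_simps)
  qed (simp_all add: power_int_minus)
qed (auto simp: series_m1a_def)

lemma formulas_m1b:
  assumes "a1 \<noteq> 0"
  shows "inner_formulas (inverse (q^2)) (- 1) (\<lambda>i. q^2 * (1 - s i / q^2) * (a0 + a1 * s i) / (s i * (q^2 - 1)))
    (\<lambda>i. - q / (a1 * s i * (q^2 - 1)))
    ((scal a0 + scal a1 * vy) * vzs)
    (scal (- inverse (q^2) * a0 + a1) - scal ((1 + inverse (q^2)) * a1) * vy)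
    (scal (- (q^2) * a1) * vzs^2)
    (scal (- q * inverse a1) * vz)
    0
    (scal (inverse q * inverse a1))"
  unfolding inner_formulas_def using assms q2
  by (simp add: rep_dg_simps dg_eq_iff s_simps)
     (simp add: divide_simps power2_eq_square power3_eq_cube power4_eq_xxxx dg_zero,
      simp add: algebra_simps)

lemma ex1_series_m1b:
  assumes "a1 \<noteq> 0" shows "\<exists>!\<pi>. disc_symmetry q \<pi> \<and> series_m1b q a0 a1 \<pi>"
proof (rule ex1_symmetry)
  have q1: "q * q \<noteq> 1" "1 \<noteq> q * q" using q2 by (auto simp: power2_eq_square)
  show "\<exists>\<pi>. disc_symmetry q \<pi> \<and> series_m1b q a0 a1 \<pi>"
    unfolding series_m1b_def
  proof (rule ex_symmetry[OF _ _ _ _ formulas_m1b[OF assms], where d = "q * a0 / (a1 * (q^2 - 1))", unfolded inverse_inverse_eq], goal_cases)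
    case (4 i)
    show ?case
      unfolding powi_sp c_eq s_simps using q1 assms
      by (simp add: s_simps divide_simps power2_eq_square power3_eq_cube) (simp add: algebra_simps)
  qed (simp_all add: power_int_minus)
qed (auto simp: series_m1b_def)

end


section \<open>Automorphisms of the disc\<close>

context quantum_disc
begin

lemma z_y: "op_z * y = sc (q^2) * y * op_z"
  by (simp add: y_z mult.assoc)

lemma w_y: "w * y = sc (inverse (q^2)) * y * w"
  by (simp add: y_w mult.assoc)

text \<open>A generator moves past y at the cost of a power of q^2. This is what makes
  \<open>y_ideal\<close> two-sided.\<close>

lemma y_normal:
  assumes "u \<in> disc_ops" obtains v where "v \<in> disc_ops" "u * y = y * v"
proof -
  have "\<exists>v\<in>disc_ops. u * y = y * v"
    using assms
  proof (induction rule: disc_ops_induct)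
    case (sc c)
    then show ?case using sc_central by blast
  next
    case (z u)
    then obtain v where v: "v \<in> disc_ops" "u * y = y * v" by auto
    have "op_z * u * y = y * (sc (q^2) * op_z * v)"
      by (simp add: mult.assoc v(2), simp add: z_y sc_left_commute flip: mult.assoc)
        (simp add: mult.assoc sc_left_commute)
    then show ?case using v(1) by (intro bexI[of _ "sc (q^2) * op_z * v"]) auto
  next
    case (w u)
    then obtain v where v: "v \<in> disc_ops" "u * y = y * v" by auto
    have "w * u * y = y * (sc (inverse (q^2)) * w * v)"
      by (simp add: mult.assoc v(2), simp add: w_y sc_left_commute flip: mult.assoc)
        (simp add: mult.assoc sc_left_commute)
    then show ?case using v(1) by (intro bexI[of _ "sc (inverse (q^2)) * w * v"]) auto
  next
    case (add u u')
    then obtain v v' where "v \<in> disc_ops" "v' \<in> disc_ops" "u * y = y * v" "u' * y = y * v'"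
      by auto
    then show ?case by (intro bexI[of _ "v + v'"]) (auto simp: distrib_right distrib_left)
  qed
  then show ?thesis using that by auto
qed

definition y_ideal :: "band set" where
  "y_ideal = (\<lambda>v. y * v) ` disc_ops"

lemma y_ideal_add: "a \<in> y_ideal \<Longrightarrow> b \<in> y_ideal \<Longrightarrow> a + b \<in> y_ideal"
  unfolding y_ideal_def by (auto simp flip: distrib_left)

lemma y_ideal_right: "a \<in> y_ideal \<Longrightarrow> u \<in> disc_ops \<Longrightarrow> a * u \<in> y_ideal"
  unfolding y_ideal_def by (auto simp: mult.assoc)

lemma y_ideal_left: assumes "a \<in> y_ideal" "u \<in> disc_ops" shows "u * a \<in> y_ideal"
proof -
  obtain v where v: "v \<in> disc_ops" "a = y * v" using assms(1) by (auto simp: y_ideal_def)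
  obtain u' where u': "u' \<in> disc_ops" "u * y = y * u'" using assms(2) by (rule y_normal)
  have "u * a = y * (u' * v)" by (simp add: v u' flip: mult.assoc)
  then show ?thesis using u'(1) v(1) by (auto simp: y_ideal_def)
qed

lemma y_ideal_sc: "a \<in> y_ideal \<Longrightarrow> sc c * a \<in> y_ideal"
  by (rule y_ideal_left) auto

lemma y_ideal_uminus: "a \<in> y_ideal \<Longrightarrow> - a \<in> y_ideal"
  using y_ideal_sc[of a "-1"] by (simp add: sc_uminus)

lemma q2': "inverse (q^2) - 1 \<noteq> 0"
  using q2 by simp

lemma y_commutator: "y = sc (1 / (inverse (q^2) - 1)) * (op_z * w - w * op_z)"
proof -
  have "op_z * w - w * op_z = sc (inverse (q^2) - 1) * y"
    by (simp add: op_z_mult_op_w op_w_mult_op_z sc_diff algebra_simps)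
  then show ?thesis using q2' by simp
qed

text \<open>The generators commute modulo \<open>y_ideal\<close> because zw - wz is a multiple of y.
  A commutator is a derivation in each argument, so this extends to all elements, one argument at a
  time.\<close>

lemma commutator_in_y_ideal:
  assumes "u \<in> disc_ops" "v \<in> disc_ops"
  shows "u * v - v * u \<in> y_ideal"
proof -
  have zero: "0 \<in> y_ideal" unfolding y_ideal_def by (rule image_eqI[of _ _ 0]) auto
  have zw: "op_z * w - w * op_z \<in> y_ideal"
  proof -
    have "op_z * w - w * op_z = y * sc (inverse (q^2) - 1)"
      by (simp add: op_z_mult_op_w op_w_mult_op_z sc_diff algebra_simps sc_central)
    then show ?thesis unfolding y_ideal_def by auto
  qed
  have step: "g * u - u * g \<in> y_ideal"
    if g: "g \<in> disc_ops" "g * op_z - op_z * g \<in> y_ideal" "g * w - w * g \<in> y_ideal"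
      and "u \<in> disc_ops" for g u
    using that(4)
  proof (induction rule: disc_ops_induct)
    case (sc c)
    then show ?case using zero by (simp add: sc_central)
  next
    case (z u)
    have "g * (op_z * u) - op_z * u * g = (g * op_z - op_z * g) * u + op_z * (g * u - u * g)"
      by (simp add: algebra_simps mult.assoc)
    then show ?case using z g by (simp add: y_ideal_add y_ideal_right y_ideal_left)
  next
    case (w u)
    have "g * (w * u) - w * u * g = (g * w - w * g) * u + w * (g * u - u * g)"
      by (simp add: algebra_simps mult.assoc)
    then show ?case using w g by (simp add: y_ideal_add y_ideal_right y_ideal_left)
  next
    case (add u u')
    have "g * (u + u') - (u + u') * g = (g * u - u * g) + (g * u' - u' * g)"
      by (simp add: algebra_simps)
    then show ?case using add by (simp add: y_ideal_add)
  qed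
  have neg: "v * u - u * v \<in> y_ideal" if "u * v - v * u \<in> y_ideal" for u v
    using y_ideal_uminus[OF that] by simp
  have "op_z * u - u * op_z \<in> y_ideal" "w * u - u * w \<in> y_ideal" if "u \<in> disc_ops" for u
    by (rule step; use that zw neg zero in simp)+
  then show ?thesis using step[OF assms(1) _ _ assms(2)] assms(1) neg by blast
qed

section \<open>Units of the disc\<close>

lemma ent_mult_single:
  assumes "\<And>m. m \<in> supp u \<Longrightarrow> m \<noteq> a \<Longrightarrow> n - m \<notin> supp v"
  shows "ent (u * v) n i = ent u a i * ent v (n - a) (i - a)"
proof -
  have "ent (u * v) n i = (\<Sum>m\<in>supp u \<union> {a}. ent u m i * ent v (n - m) (i - m))"
    by (rule ent_mult_superset) auto
  also have "\<dots> = (\<Sum>m\<in>{a}. ent u m i * ent v (n - m) (i - m))"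
    by (rule sum.mono_neutral_right) (use assms in \<open>auto simp: ent_outside\<close>)
  finally show ?thesis by simp
qed

abbreviation dilate :: "complex \<Rightarrow> complex poly \<Rightarrow> complex poly" where
  "dilate c P \<equiv> pcompose P [:0, c:]"

lemma dilate_eq_0: "c \<noteq> 0 \<Longrightarrow> dilate c P = 0 \<longleftrightarrow> P = 0"
  by (simp add: pcompose_eq_0_iff)

lemma poly_dilate_s: "poly (dilate (q powi (2 * n)) P) (s i) = poly P (s (i - n))"
  by (simp add: poly_pcompose s_diff mult.commute)

text \<open>The highest diagonals of u and v multiply without interference, and so do the lowest
  ones; each of the two products is nonzero and hence has to be the diagonal 0 of the matrix 1. For
  the highest ones the product of the polynomials is 1, so that all degrees are 0.\<close>

lemma unit_is_scalar:
  assumes "u \<in> disc_ops" "v \<in> disc_ops" "u * v = 1"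
  obtains c where "u = sc c"
proof -
  obtain P where P: "\<And>n i. ent u n i = poly (P n * pf q n) (s i)"
    by (rule disc_ops_ent[OF assms(1)]) blast
  obtain R where R: "\<And>n i. ent v n i = poly (R n * pf q n) (s i)"
    by (rule disc_ops_ent[OF assms(2)]) blast
  let ?S = "supp u" and ?T = "supp v"
  have ne: "?S \<noteq> {}" "?T \<noteq> {}"
  proof -
    have "u \<noteq> 0" "v \<noteq> 0" using assms(3) by auto
    moreover have "x = 0" if "supp x = {}" for x
      by (rule band_eqI) (use that ent_outside in \<open>simp add: ent_simps\<close>)
    ultimately show "?S \<noteq> {}" "?T \<noteq> {}" by auto
  qed
  have supp_poly: "n \<in> ?S \<Longrightarrow> P n * pf q n \<noteq> 0" "n \<in> ?T \<Longrightarrow> R n * pf q n \<noteq> 0" for n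
    by (auto simp: supp_def P R fun_eq_iff simp del: poly_mult mult_eq_0_iff)
  have extremal: "a + b = 0 \<and> P a * pf q a * dilate (q powi (2 * a)) (R b * pf q b) = 1"
    if "a \<in> ?S" "b \<in> ?T" and unique: "\<And>m. m \<in> ?S \<Longrightarrow> m \<noteq> a \<Longrightarrow> a + b - m \<notin> ?T" for a b
  proof -
    let ?H = "P a * pf q a * dilate (q powi (2 * a)) (R b * pf q b)"
    have "ent (u * v) (a + b) i = ent u a i * ent v (a + b - a) (i - a)" for i
      by (rule ent_mult_single) (rule unique)
    then have ent1: "ent 1 (a + b) i = poly ?H (s i)" for i
      unfolding assms(3) by (simp only: P R poly_mult poly_dilate_s add_diff_cancel_left')
    have "?H \<noteq> 0"
      using supp_poly(1)[OF that(1)] supp_poly(2)[OF that(2)] dilate_eq_0[of "q powi (2 * a)"] by auto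
    then obtain i where "poly ?H (s i) \<noteq> 0" using poly_eqI_s[of ?H 0] by auto
    then have "a + b = 0" using ent1[of i] by (simp add: one_band.rep_eq split: if_splits)
    moreover have "?H = 1"
      by (rule poly_eqI_s) (use ent1 \<open>a + b = 0\<close> in \<open>simp add: one_band.rep_eq\<close>)
    ultimately show ?thesis by simp
  qed
  define a b where "a = Max ?S" and "b = Max ?T"
  define a' b' where "a' = Min ?S" and "b' = Min ?T"
  have mem: "a \<in> ?S" "b \<in> ?T" "a' \<in> ?S" "b' \<in> ?T"
    using ne by (simp_all add: a_def b_def a'_def b'_def)
  have le: "m \<in> ?S \<Longrightarrow> a' \<le> m \<and> m \<le> a" "m \<in> ?T \<Longrightarrow> b' \<le> m \<and> m \<le> b" for m
    by (simp_all add: a_def b_def a'_def b'_def)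
  have max: "a + b = 0 \<and> P a * pf q a * dilate (q powi (2 * a)) (R b * pf q b) = 1"
    by (rule extremal) (use mem le in force)+
  have min: "a' + b' = 0" using extremal[OF mem(3,4)] le by force
  have "degree (P a * pf q a * dilate (q powi (2 * a)) (R b * pf q b)) = 0" using max by simp
  moreover have nz: "P a \<noteq> 0" "R b \<noteq> 0" using supp_poly mem by auto
  ultimately have "degree (P a) = 0 \<and> degree (pf q a) = 0 \<and> degree (pf q b) = 0"
    by (simp add: degree_mult_eq degree_pcompose pf_nonzero pcompose_eq_0_iff)
  \<comment> \<open>\<open>pf q n\<close> is constant only for n \<ge> 0, and a + b = 0 then leaves
    a = b = 0. The lowest diagonals a' and b' are at most 0 and add up to 0, so they are 0
    too.\<close>
  then have "degree (P a) = 0" "a \<ge> 0" "b \<ge> 0" by (simp_all add: degree_pf)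
  moreover from this have "a = 0" using max by linarith
  ultimately have a0: "a = 0" "degree (P 0) = 0" by simp_all
  have "a' = 0" using le(1)[OF mem(1)] le(2)[OF mem(2)] min max a0 le(2)[OF mem(4)] le(1)[OF mem(3)] by linarith
  obtain c where "P 0 = [:c:]" using a0(2) by (rule degree_eq_zeroE)
  then have "u = sc c"
    unfolding sc_def eq_dg_iff
    using le(1) a0 \<open>a' = 0\<close> P ent_outside[of _ u] by (auto simp: pf_nonneg) (metis order_antisym)
  then show ?thesis by (rule that)
qed

lemma disc_homogeneous:
  assumes "u \<in> disc_ops" "\<And>n i. n \<noteq> a \<Longrightarrow> ent u n i = 0"
  obtains P where "u = dg a (\<lambda>i. poly (P * pf q a) (s i))"
proof -
  obtain P where P: "\<And>n i. ent u n i = poly (P n * pf q n) (s i)"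
    by (rule disc_ops_ent[OF assms(1)]) blast
  have "u = dg a (\<lambda>i. poly (P a * pf q a) (s i))"
    unfolding eq_dg_iff using assms(2) P by simp
  then show ?thesis by (rule that)
qed

end

section \<open>The action of k on the generators\<close>

context disc_action
begin

lemma KEF_scalar: "K (sc c) = sc c" "K' (sc c) = sc c" "E (sc c) = 0" "F (sc c) = 0"
  using KEF_sc[of 1 c] by (simp_all add: KEF_one)

text \<open>y is a multiple of the commutator of z and \<open>w\<close>, and a homomorphism takes
  commutators to commutators.\<close>

lemma hom_y:
  assumes "\<phi> = K \<or> \<phi> = K'"
  obtains v where "v \<in> disc_ops" "\<phi> y = y * v"
proof -
  have "\<phi> y = sc (1 / (inverse (q^2) - 1)) * (\<phi> op_z * \<phi> w - \<phi> w * \<phi> op_z)"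
    using assms by (subst y_commutator) (auto simp: KEF_scalar KEF_diff KEF_mult disc_ops_mult disc_ops_diff)
  moreover have "\<phi> op_z \<in> disc_ops" "\<phi> w \<in> disc_ops" using assms by auto
  ultimately have "\<phi> y \<in> y_ideal" using commutator_in_y_ideal y_ideal_sc by simp
  then show ?thesis using that by (auto simp: y_ideal_def)
qed

lemma y_cancel: "y * u = y * v \<Longrightarrow> u = v"
proof (rule band_eqI)
  fix n i assume "y * u = y * v"
  then have "ent (y * u) n i = ent (y * v) n i" by simp
  then show "ent u n i = ent v n i" by (simp add: op_y_def ent_dg_mult)
qed

lemma K_y: obtains c where "c \<noteq> 0" "K y = sc c * y"
proof -
  obtain v where v: "v \<in> disc_ops" "K y = y * v" by (rule hom_y[of K]) auto
  obtain v' where v': "v' \<in> disc_ops" "K' y = y * v'" by (rule hom_y[of K']) auto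
  \<comment> \<open>K applied to K' y = y v' gives y = y v K(v'); cancelling y exhibits v as a unit,
    hence as a scalar.\<close>
  have "y * (v * K v') = y * 1"
    using KEF_relations(2)[of y] v v' by (simp add: KEF_mult mult.assoc)
  then have "v * K v' = 1" by (rule y_cancel)
  then obtain c where c: "v = sc c" using unit_is_scalar[OF v(1), of "K v'"] v'(1) by auto
  have "y \<noteq> 0"
  proof
    assume "y = 0"
    then have "ent y 0 0 = 0" by (simp add: ent_simps)
    then show False by (simp add: op_y_def ent_dg)
  qed
  moreover have "K y = sc c * y" using v c sc_central by simp
  moreover have "c \<noteq> 0"
  proof
    assume "c = 0"
    then have "K y = 0" using \<open>K y = sc c * y\<close> by simp
    then have "y = K' 0" using KEF_relations(1)[of y] by simp
    also have "K' 0 = 0" using KEF_sc(2)[of 0 0] by simp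
    finally show False using \<open>y \<noteq> 0\<close> by simp
  qed
  ultimately show ?thesis using that by blast
qed

lemma K_gens: obtains l where "l \<noteq> 0" "K op_z = sc l * op_z" "K w = sc (inverse l) * w"
proof -
  obtain c where c: "c \<noteq> 0" "K y = sc c * y" by (rule K_y)
  have yent: "ent (y * u) n i = s i * ent u n i" "ent (u * y) n i = ent u n i * s (i - n)" for u n i
    by (simp_all add: op_y_def ent_dg_mult ent_mult_dg)
  \<comment> \<open>K z commutes with y by the same factor as z does, since c cancels. On diagonal n
    this forces the entries times q^(2n-2) - 1 to vanish.\<close>
  have Kz: "ent (K op_z) n i = 0" if "n \<noteq> 1" for n i
  proof -
    have "sc c * (y * K op_z) = K (y * op_z)" by (simp add: KEF_mult c mult.assoc)
    also have "\<dots> = sc (inverse (q^2)) * (K op_z * K y)"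
      unfolding y_z by (simp add: KEF_mult KEF_scalar disc_ops_mult mult.assoc)
    also have "\<dots> = sc c * (sc (inverse (q^2)) * (K op_z * y))"
      unfolding c(2) sc_left_commute[of "K op_z"] by (simp add: mult.commute)
    finally have "ent (sc c * (y * K op_z)) n i = ent (sc c * (sc (inverse (q^2)) * (K op_z * y))) n i"
      by simp
    then have "s i * ent (K op_z) n i = inverse (q^2) * ent (K op_z) n i * s (i - n)"
      unfolding ent_sc_mult yent using c by simp
    then have "s i * ent (K op_z) n i * (q powi (2 * n - 2) - 1) = 0"
      by (auto simp: s_diff power_int_diff field_simps)
    then show ?thesis using that by (simp add: powi_eq_1_iff)
  qed
  have Kw: "ent (K w) n i = 0" if "n \<noteq> -1" for n i
  proof -
    have "sc c * (y * K w) = K (y * w)" by (simp add: KEF_mult c mult.assoc)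
    also have "\<dots> = sc (q^2) * (K w * K y)"
      unfolding y_w by (simp add: KEF_mult KEF_scalar disc_ops_mult mult.assoc)
    also have "\<dots> = sc c * (sc (q^2) * (K w * y))"
      unfolding c(2) sc_left_commute[of "K w"] by (simp add: mult.commute)
    finally have "ent (sc c * (y * K w)) n i = ent (sc c * (sc (q^2) * (K w * y))) n i"
      by simp
    then have "s i * ent (K w) n i = q^2 * ent (K w) n i * s (i - n)"
      unfolding ent_sc_mult yent using c by simp
    then have "s i * ent (K w) n i * (q powi (2 * n + 2) - 1) = 0"
      by (auto simp: s_diff power_int_add field_simps)
    then show ?thesis using that by (simp add: powi_eq_1_iff)
  qed
  obtain A where "K op_z = dg 1 (\<lambda>i. poly (A * pf q 1) (s i))"
    by (rule disc_homogeneous[of "K op_z" 1]) (use Kz in auto)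
  then have A: "K op_z = dg 1 (\<lambda>i. poly A (s i))" by (simp add: pf_nonneg)
  obtain B where B: "K w = dg (-1) (\<lambda>i. poly (B * pf q (-1)) (s i))"
    by (rule disc_homogeneous[of "K w" "-1"]) (use Kw in auto)
  have pf1: "poly (pf q (-1)) (s i) = 1 - s (i + 1)" for i
    by (simp add: pf_def s_add)
  \<comment> \<open>K is applied to zw = 1 - y. The left side has degree deg A + deg B + 1 and the
    right side at most 1, so A and B are constants.\<close>
  have "dg 0 (\<lambda>i. poly (A * dilate (q powi (2 * 1)) B * [:1, -1:]) (s i)) = K op_z * K w"
    unfolding A B dg_mult
    by (rule dg_eqI) (simp_all only: poly_mult poly_dilate_s pf1, simp_all add: algebra_simps)
  also have "\<dots> = K (1 - y)" by (simp flip: op_z_mult_op_w add: KEF_mult)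
  also have "\<dots> = 1 - sc c * y"
    by (simp add: KEF_diff KEF_one c)
  also have "\<dots> = dg 0 (\<lambda>i. poly [:1, -c:] (s i))"
    by (simp add: op_y_def sc_mult_dg dg_diff mult.commute flip: dg_one)
  finally have eq: "A * dilate (q powi (2 * 1)) B * [:1, -1:] = [:1, -c:]"
    unfolding dg_eq_iff by (intro poly_eqI_s) simp
  then have nz: "A \<noteq> 0" "B \<noteq> 0" by auto
  have "degree (A * dilate (q powi (2 * 1)) B * [:1, -1:]) = degree A + degree B + 1"
    using nz by (subst degree_mult_eq; (subst degree_mult_eq)?)
      (auto simp: degree_pcompose pcompose_eq_0_iff)
  moreover have "degree [:1, -c:] \<le> 1" by simp
  ultimately have "degree A = 0" "degree B = 0" using eq by simp_all
  then obtain a b where ab: "A = [:a:]" "B = [:b:]" by (metis degree_eq_zeroE)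
  then have "a * b = 1" using eq by (simp add: mult.commute)
  then have "a \<noteq> 0" "b = inverse a" using inverse_unique[of a b] by auto
  moreover have "K op_z = sc a * op_z" unfolding A by (simp add: ab op_z_def sc_mult_dg)
  moreover have "K w = sc b * w"
    unfolding B unfolding op_w_def sc_mult_dg by (rule dg_eqI) (simp_all add: ab pf1)
  ultimately show ?thesis using that by blast
qed

end


section \<open>Classification\<close>

text \<open>This lemma and the next four are the field computations behind \<open>ez_x\<close>,
  \<open>ew_x\<close>, \<open>fz_x'\<close> and \<open>fw_x'\<close>. S stands for s i, p and p' for
  q^2 and q^-2, r for q^(2m), e or f for the unknown entry, X and X1 for the values of x or x' at i
  and at the neighbouring index.\<close>

lemma inner_E_z_algebra:
  fixes p :: complex
  assumes "p * p' = 1" "S * e + l * ((1 - r) * S * X) = p' * ((1 - r) * (p * S) * X1 + e * (p * r * S))"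
  shows "(1 - r) * S * (e - (X1 - l * X)) = 0"
proof -
  have "p' * ((1 - r) * (p * S) * X1 + e * (p * r * S)) = p * p' * ((1 - r) * S * X1 + e * r * S)"
    by (simp add: algebra_simps)
  then have "S * e + l * ((1 - r) * S * X) = (1 - r) * S * X1 + e * r * S"
    using assms by simp
  then show ?thesis by (simp add: algebra_simps)
qed

lemma inner_E_w_algebra:
  fixes p :: complex
  assumes "p * p' = 1" "T = r * S * p'"
    "S * e + (1 - r) * S * X * (1 - T) * l' = p * ((1 - S * p') * ((1 - r) * (S * p') * X1) + e * T)"
  shows "(1 - r) * S * (e - ((1 - S * p') * X1 - X * (1 - T) * l')) = 0"
proof -
  have "p * ((1 - S * p') * ((1 - r) * (S * p') * X1) + e * T) =
      p * p' * ((1 - S * p') * (1 - r) * S * X1 + e * r * S)"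
    by (simp add: algebra_simps assms(2))
  then have "S * e + (1 - r) * S * X * (1 - T) * l' = (1 - S * p') * (1 - r) * S * X1 + e * r * S"
    using assms(1,3) by simp
  then show ?thesis by (simp add: algebra_simps)
qed

lemma inner_F_algebra:
  fixes r :: complex
  assumes "r * r' = 1" "r' * A + S * f = r' * B"
  shows "B - A - r * S * f = 0"
proof -
  have "r * (r' * A + S * f) = r * (r' * B)" using assms(2) by simp
  then have "r * r' * A + r * S * f = r * r' * B" by (simp add: algebra_simps)
  then show ?thesis using assms(1) by (simp add: algebra_simps)
qed

lemma inner_F_z_algebra:
  fixes p :: complex
  assumes "p * p' = 1" "r * r' = 1" "T = p * r' * S"
    "(1 - r) * r' * S * X + S * f = p' * (f * T + (1 - r) * r' * (p * S) * X1 * l')"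
  shows "(1 - r) * S * (f - (X - X1 * l')) = 0"
proof -
  have "p' * (f * T + (1 - r) * r' * (p * S) * X1 * l') =
      p * p' * (r' * (f * S + (1 - r) * S * X1 * l'))"
    by (simp add: algebra_simps assms(3))
  then have "r' * ((1 - r) * S * X) + S * f = r' * (f * S + (1 - r) * S * X1 * l')"
    using assms(1,4) by (simp add: mult_ac)
  from inner_F_algebra[OF assms(2) this] show ?thesis by (simp add: algebra_simps)
qed

lemma inner_F_w_algebra:
  fixes p :: complex
  assumes "p * p' = 1" "r * r' = 1" "T = S * r' * p'"
    "(1 - r) * r' * S * X * (1 - T) + S * f = p * (f * T + l * (1 - S * p') * ((1 - r) * r' * (S * p') * X1))"
  shows "(1 - r) * S * (f - (X * (1 - T) - l * (1 - S * p') * X1)) = 0"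
proof -
  have "p * (f * T + l * (1 - S * p') * ((1 - r) * r' * (S * p') * X1)) =
      p * p' * (r' * (f * S + l * (1 - S * p') * (1 - r) * S * X1))"
    by (simp add: algebra_simps assms(3))
  then have "r' * ((1 - r) * S * X * (1 - T)) + S * f = r' * (f * S + l * (1 - S * p') * (1 - r) * S * X1)"
    using assms(1,4) by (simp add: mult_ac)
  from inner_F_algebra[OF assms(2) this] show ?thesis by (simp add: algebra_simps)
qed

locale weighted_action = disc_action +
  fixes l :: complex
  assumes l_nonzero [simp]: "l \<noteq> 0"
    and K_z: "K op_z = sc l * op_z"
    and K_w: "K w = sc (inverse l) * w"
begin

lemma K_conj: assumes "u \<in> disc_ops" shows "K u = cz l * u * cz (inverse l)"
proof -
  let ?c = "\<lambda>u. cz l * u * cz (inverse l)"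
  have "cz (inverse l) * (cz l * v) = v" for v
    using cz_inverse[of "inverse l"] by (simp flip: mult.assoc)
  then have mult: "?c (u * v) = ?c u * ?c v" for u v by (simp add: mult.assoc)
  have gens: "?c op_z = K op_z" "?c w = K w"
    unfolding K_z K_w unfolding op_z_def op_w_def sc_mult_dg
    by (simp_all add: cz_conj_dg power_int_minus)
  show ?thesis using assms
  proof (induction rule: disc_ops_induct)
    case (sc c)
    show ?case
      by (simp add: KEF_scalar sc_central[of c] mult.assoc)
         (simp add: cz_inverse flip: mult.assoc)
  next
    case (z u)
    then show ?case using mult[of op_z u] by (simp only: KEF_mult(1) disc_ops_closed gens)
  next
    case (w u)
    then show ?case using mult[of w u] by (simp only: KEF_mult(1) disc_ops_closed gens)
  next
    case (add u v)
    then show ?case by (simp add: KEF_add distrib_left distrib_right)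
  qed
qed

lemma ent_K: "u \<in> disc_ops \<Longrightarrow> ent (K u) n i = l powi n * ent u n i"
  by (simp add: K_conj ent_cz_conj)

lemma ent_K': assumes "u \<in> disc_ops" shows "ent (K' u) n i = l powi (- n) * ent u n i"
proof -
  have "ent u n i = l powi n * ent (K' u) n i"
    using ent_K[of "K' u" n i] KEF_relations(2)[OF assms] assms by simp
  then show ?thesis by (simp add: power_int_minus)
qed

lemma ent_gens: "ent op_z n i = (if n = 1 then 1 else 0)" "ent y n i = (if n = 0 then s i else 0)"
  "ent w n i = (if n = - 1 then 1 - s (i + 1) else 0)"
  by (simp_all add: op_z_def op_y_def op_w_def ent_dg)

lemma K'_z: "K' op_z = sc (inverse l) * op_z"
  by (rule band_eqI) (simp add: ent_K' ent_sc_mult ent_gens power_int_minus)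

lemma K'_w: "K' w = sc l * w"
  by (rule band_eqI) (simp add: ent_K' ent_sc_mult ent_gens)

lemma K_y_eq: "K y = y" and K'_y_eq: "K' y = y"
  by (rule band_eqI, simp add: ent_K ent_K' ent_gens)+

text \<open>K multiplies diagonal n by l^n, and z, \<open>w\<close>, y are eigenvectors of K with
  eigenvalues l, 1/l, 1. Comparing entries in KE = q^2 EK and KF = q^-2 FK fixes the power of l
  wherever an entry is nonzero.\<close>

lemma weights:
  "ent (E op_z) n i \<noteq> 0 \<Longrightarrow> l powi (n - 1) = q^2"
  "ent (E w) n i \<noteq> 0 \<Longrightarrow> l powi (n + 1) = q^2"
  "ent (E y) n i \<noteq> 0 \<Longrightarrow> l powi n = q^2"
  "ent (F op_z) n i \<noteq> 0 \<Longrightarrow> l powi (1 - n) = q^2"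
  "ent (F w) n i \<noteq> 0 \<Longrightarrow> l powi (- 1 - n) = q^2"
  "ent (F y) n i \<noteq> 0 \<Longrightarrow> l powi (- n) = q^2"
proof -
  have E: "l powi n * ent (E u) n i = q^2 * ent (E (K u)) n i" if "u \<in> disc_ops" for u
    using KEF_relations(3)[OF that] that by (simp add: ent_sc_mult flip: ent_K)
  have F: "l powi n * ent (F u) n i = inverse (q^2) * ent (F (K u)) n i" if "u \<in> disc_ops" for u
    using KEF_relations(4)[OF that] that by (simp add: ent_sc_mult flip: ent_K)
  show "ent (E op_z) n i \<noteq> 0 \<Longrightarrow> l powi (n - 1) = q^2"
    using E[of op_z] by (simp add: K_z KEF_sc ent_sc_mult power_int_diff field_simps)
  show "ent (E w) n i \<noteq> 0 \<Longrightarrow> l powi (n + 1) = q^2"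
    using E[of w] by (simp add: K_w KEF_sc ent_sc_mult power_int_add field_simps)
  show "ent (E y) n i \<noteq> 0 \<Longrightarrow> l powi n = q^2"
    using E[of y] by (simp add: K_y_eq)
  show "ent (F op_z) n i \<noteq> 0 \<Longrightarrow> l powi (1 - n) = q^2"
    using F[of op_z] by (simp add: K_z KEF_sc ent_sc_mult power_int_diff field_simps)
  show "ent (F w) n i \<noteq> 0 \<Longrightarrow> l powi (- 1 - n) = q^2"
    using F[of w] by (simp add: K_w KEF_sc ent_sc_mult power_int_diff power_int_minus field_simps)
  show "ent (F y) n i \<noteq> 0 \<Longrightarrow> l powi (- n) = q^2"
    using F[of y] by (simp add: K_y_eq power_int_minus field_simps)
qed

lemma KEF_zero: "E 0 = 0" "F 0 = 0"
  using KEF_scalar[of 0] by simp_all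

lemma c_nonzero: "1 / (q - inverse q) \<noteq> 0"
proof -
  have "q \<noteq> inverse q" using q2 by (auto simp: field_simps power2_eq_square)
  then show ?thesis by simp
qed

text \<open>By \<open>weights\<close>, E and F vanish on the generators. The relation between e and
  f then gives K z = K' z, which is l^2 = 1.\<close>

lemma trivial_case:
  assumes "\<And>m. l powi m \<noteq> q^2"
  shows "series_0plus q \<pi> \<or> series_0minus q \<pi>"
proof -
  have E0: "E op_z = 0" "E w = 0" "F op_z = 0" "F w = 0"
  proof -
    have "ent (E op_z) n i = 0" "ent (E w) n i = 0" "ent (F op_z) n i = 0" "ent (F w) n i = 0" for n i
      using weights(1,2,4,5)[of n i] assms by blast+
    then show "E op_z = 0" "E w = 0" "F op_z = 0" "F w = 0"
      by (auto intro!: band_eqI simp: ent_simps)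
  qed
  have "sc (1 / (q - inverse q)) * (K op_z - K' op_z) = 0"
    using KEF_relations(5)[of op_z] by (simp add: E0 KEF_zero)
  then have "ent (sc (1 / (q - inverse q)) * (K op_z - K' op_z)) 1 0 = 0" by (simp add: ent_simps)
  then have "l - inverse l = 0"
    using c_nonzero by (simp add: K_z K'_z ent_sc_mult ent_simps ent_gens)
  then have "l = 1 \<or> l = -1" by (simp add: field_simps square_eq_1_iff)
  then show ?thesis
    unfolding series_0plus_def series_0minus_def acts_iff
    using K_z K_w E0 by (auto simp: rep.hom_simps rep_vz rep_vzs KEF_defs sc_uminus)
qed

end

locale nontrivial_action = weighted_action +
  fixes m :: int
  assumes l_m: "l powi m = q^2"
begin

lemma m_nonzero: "m \<noteq> 0"
  using l_m q2 by auto

text \<open>l is not a root of 1 because a power of it is q^2. Hence m is unique, and E and F take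
  each of z, \<open>w\<close>, y to a single diagonal.\<close>

lemma l_powi_eq_1: assumes "l powi k = 1" shows "k = 0"
proof -
  have "q powi (2 * k) = (l powi m) powi k" by (simp add: l_m power_int_mult)
  also have "\<dots> = (l powi k) powi m" by (simp add: mult.commute flip: power_int_mult)
  also have "\<dots> = 1" by (simp add: assms)
  finally show ?thesis by (simp add: powi_eq_1_iff)
qed

lemma l_powi_eq_q2: "l powi k = q^2 \<Longrightarrow> k = m"
  using l_powi_eq_1[of "k - m"] l_m by (simp add: power_int_diff)

definition ey :: "int \<Rightarrow> complex" where "ey = ent (E y) m"
definition fy :: "int \<Rightarrow> complex" where "fy = ent (F y) (- m)"

lemma E_y: "E y = dg m ey" and F_y: "F y = dg (- m) fy"
  unfolding eq_dg_iff ey_def fy_def using weights(3,6) l_powi_eq_q2 by auto force+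

definition ez :: "int \<Rightarrow> complex" where "ez = ent (E op_z) (m + 1)"
definition ew :: "int \<Rightarrow> complex" where "ew = ent (E w) (m - 1)"
definition fz :: "int \<Rightarrow> complex" where "fz = ent (F op_z) (1 - m)"
definition fw :: "int \<Rightarrow> complex" where "fw = ent (F w) (- 1 - m)"

lemma E_z: "E op_z = dg (m + 1) ez" and E_w: "E w = dg (m - 1) ew"
  and F_z: "F op_z = dg (1 - m) fz" and F_w: "F w = dg (- 1 - m) fw"
  unfolding eq_dg_iff ez_def ew_def fz_def fw_def using weights(1,2,4,5) l_powi_eq_q2 by auto force+

definition r :: complex where "r = q powi (2 * m)"

lemma r: "r \<noteq> 0" "r \<noteq> 1" "s (i - m) = r * s i" "s (i + m) = s i / r"
  using m_nonzero s_diff[of i m] s_add[of i m]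
  by (simp_all add: r_def powi_eq_1_iff power_int_minus divide_inverse mult.commute)

text \<open>The solution of E y = yX - Xy with X = \<open>dg m x\<close>, read on diagonal m. The
  denominator is (1 - r) s i, nonzero because m is.\<close>

definition x :: "int \<Rightarrow> complex" where "x i = ey i / (s i - s (i - m))"
definition x' :: "int \<Rightarrow> complex" where "x' i = fy i / (s (i + m) - s i)"

lemma ey_x: "ey i = (1 - r) * s i * x i" and fy_x': "fy i = (1 - r) / r * s i * x' i"
  using r(1,2) by (simp_all add: x_def x'_def r field_simps)

text \<open>E applied to yz = q^-2 zy ties E z to E y: the entry of E z occurs with the nonzero
  factor (1 - r) s i and can be solved for. The next three lemmas do the same with yw = q^2 wy and
  with F.\<close>

lemma ez_x: "ez i = x (i - 1) - l * x i"
proof -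
  have "y * E op_z + E y * K op_z = sc (inverse (q^2)) * (op_z * E y + E op_z * K y)"
    using arg_cong[OF y_z, of E]
    by (simp add: KEF_mult KEF_scalar disc_ops_mult mult.assoc)
  then have "ent (y * E op_z + E y * K op_z) (m + 1) i =
      ent (sc (inverse (q^2)) * (op_z * E y + E op_z * K y)) (m + 1) i" by simp
  then have "s i * ez i + l * ey i = inverse (q^2) * (ey (i - 1) + ez i * s (i - m - 1))"
    unfolding E_z E_y K_z K_y_eq unfolding op_y_def op_z_def
    by (simp add: dg_mult sc_mult_dg ent_simps ent_dg algebra_simps)
  moreover have "s (i - m - 1) = q^2 * r * s i" by (simp add: s_simps r)
  ultimately have "(1 - r) * s i * (ez i - (x (i - 1) - l * x i)) = 0"
    by (intro inner_E_z_algebra[where p = "q^2" and p' = "inverse (q^2)"]) (simp_all only: ey_x s_simps, simp)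
  then show ?thesis using r(2) by simp
qed

lemma ew_x: "ew i = (1 - s (i + 1)) * x (i + 1) - x i * (1 - s (i - m + 1)) / l"
proof -
  have "y * E w + E y * K w = sc (q^2) * (w * E y + E w * K y)"
    using arg_cong[OF y_w, of E]
    by (simp add: KEF_mult KEF_scalar disc_ops_mult mult.assoc)
  then have "ent (y * E w + E y * K w) (m - 1) i =
      ent (sc (q^2) * (w * E y + E w * K y)) (m - 1) i" by simp
  then have "s i * ew i + ey i * (1 - s (i - m + 1)) / l =
      q^2 * ((1 - s (i + 1)) * ey (i + 1) + ew i * s (i - m + 1))"
    unfolding E_w E_y K_w K_y_eq unfolding op_y_def op_w_def
    by (simp add: dg_mult sc_mult_dg ent_simps ent_dg algebra_simps divide_inverse)
  moreover have "s (i - m + 1) = r * s i * inverse (q^2)" by (simp add: s_simps r divide_inverse)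
  ultimately have "(1 - r) * s i * (ew i -
      ((1 - s i * inverse (q^2)) * x (i + 1) - x i * (1 - s (i - m + 1)) * inverse l)) = 0"
    by (intro inner_E_w_algebra[where p = "q^2" and p' = "inverse (q^2)"])
       (simp_all only: ey_x s_simps divide_inverse, simp)
  then show ?thesis using r(2) by (simp add: s_simps divide_inverse)
qed

lemma fz_x': "fz i = x' i - x' (i - 1) / l"
proof -
  have "F y * op_z + K' y * F op_z = sc (inverse (q^2)) * (F op_z * y + K' op_z * F y)"
    using arg_cong[OF y_z, of F]
    by (simp add: KEF_mult KEF_scalar disc_ops_mult mult.assoc)
  then have "ent (F y * op_z + K' y * F op_z) (1 - m) i =
      ent (sc (inverse (q^2)) * (F op_z * y + K' op_z * F y)) (1 - m) i" by simp
  then have "fy i + s i * fz i = inverse (q^2) * (fz i * s (i + m - 1) + fy (i - 1) / l)"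
    unfolding F_z F_y K'_z K'_y_eq unfolding op_y_def op_z_def
    by (simp add: dg_mult sc_mult_dg ent_simps ent_dg algebra_simps divide_inverse)
  moreover have "s (i + m - 1) = q^2 * inverse r * s i" by (simp add: s_simps r divide_inverse)
  ultimately have "(1 - r) * s i * (fz i - (x' i - x' (i - 1) * inverse l)) = 0"
    using r(1) by (intro inner_F_z_algebra[where p = "q^2" and p' = "inverse (q^2)" and r = r and r' = "inverse r"])
       (simp_all only: fy_x' s_simps divide_inverse, simp_all)
  then show ?thesis using r(2) by (simp add: divide_inverse)
qed

lemma fw_x': "fw i = x' i * (1 - s (i + m + 1)) - l * (1 - s (i + 1)) * x' (i + 1)"
proof -
  have "F y * w + K' y * F w = sc (q^2) * (F w * y + K' w * F y)"
    using arg_cong[OF y_w, of F]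
    by (simp add: KEF_mult KEF_scalar disc_ops_mult mult.assoc)
  then have "ent (F y * w + K' y * F w) (- 1 - m) i =
      ent (sc (q^2) * (F w * y + K' w * F y)) (- 1 - m) i" by simp
  then have "fy i * (1 - s (i + m + 1)) + s i * fw i =
      q^2 * (fw i * s (i + m + 1) + l * (1 - s (i + 1)) * fy (i + 1))"
    unfolding F_w F_y K'_w K'_y_eq unfolding op_y_def op_w_def
    by (simp add: dg_mult sc_mult_dg ent_simps ent_dg algebra_simps)
  moreover have "s (i + m + 1) = s i * inverse r * inverse (q^2)"
    by (simp add: s_simps r divide_inverse)
  ultimately have "(1 - r) * s i * (fw i -
      (x' i * (1 - s (i + m + 1)) - l * (1 - s i * inverse (q^2)) * x' (i + 1))) = 0"
    using r(1) by (intro inner_F_w_algebra[where p = "q^2" and p' = "inverse (q^2)" and r = r and r' = "inverse r"])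
       (simp_all only: fy_x' s_simps divide_inverse, simp_all)
  then show ?thesis using r(2) by (simp add: s_simps divide_inverse)
qed

lemma acts_formulas:
  assumes "inner_formulas l m x x' py pz pzs ry rz rzs"
  shows "acts q \<pi> U_k vz (scal l * vz)" "acts q \<pi> U_k vzs (scal (inverse l) * vzs)"
    "acts q \<pi> U_e vy py" "acts q \<pi> U_e vz pz" "acts q \<pi> U_e vzs pzs"
    "acts q \<pi> U_f vy ry" "acts q \<pi> U_f vz rz" "acts q \<pi> U_f vzs rzs"
proof -
  have "(s i - s (i - m)) * x i = ey i" "(s (i + m) - s i) * x' i = fy i" for i
    using r(1,2) by (simp_all add: ey_x fy_x' r(3,4) field_simps)
  then show "acts q \<pi> U_k vz (scal l * vz)" "acts q \<pi> U_k vzs (scal (inverse l) * vzs)"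
    "acts q \<pi> U_e vy py" "acts q \<pi> U_e vz pz" "acts q \<pi> U_e vzs pzs"
    "acts q \<pi> U_f vy ry" "acts q \<pi> U_f vz rz" "acts q \<pi> U_f vzs rzs"
    using assms E_y E_z E_w F_y F_z F_w K_z K_w
    unfolding inner_formulas_def acts_iff KEF_defs
    by (simp_all add: rep.hom_simps rep_vy rep_vz rep_vzs dg_eq_iff ez_x ew_x fz_x' fw_x')
qed

text \<open>Both sides obey the same product rule involving K, and they agree on the generators by
  \<open>ez_x\<close> and \<open>ew_x\<close>.\<close>

lemma E_inner: "u \<in> disc_ops \<Longrightarrow> E u = u * dg m x - dg m x * K u"
proof (induction rule: disc_ops_induct)
  case (sc c)
  then show ?case by (simp add: KEF_scalar sc_central)
next
  case (z u)
  have Eg: "E op_z = op_z * dg m x - dg m x * K op_z"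
    unfolding E_z K_z unfolding op_z_def
    by (simp add: sc_mult_dg dg_mult dg_diff add.commute dg_eq_iff ez_x mult.commute)
  show ?case using z(1)
    by (simp add: KEF_mult z(2) Eg left_diff_distrib right_diff_distrib mult.assoc)
next
  case (w u)
  have Eg: "E w = w * dg m x - dg m x * K w"
    unfolding E_w K_w unfolding op_w_def
    by (simp add: sc_mult_dg dg_mult dg_diff add.commute dg_eq_iff ew_x divide_inverse mult_ac)
  show ?case using w(1)
    by (simp add: KEF_mult w(2) Eg left_diff_distrib right_diff_distrib mult.assoc)
next
  case (add u v)
  show ?case using add(1,2) by (simp add: KEF_add add(3,4) distrib_left distrib_right)
qed

lemma F_inner: "u \<in> disc_ops \<Longrightarrow> F u = dg (- m) x' * u - K' u * dg (- m) x'"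
proof (induction rule: disc_ops_induct)
  case (sc c)
  then show ?case by (simp add: KEF_scalar sc_central)
next
  case (z u)
  have Eg: "F op_z = dg (- m) x' * op_z - K' op_z * dg (- m) x'"
    unfolding F_z K'_z unfolding op_z_def
    by (simp add: sc_mult_dg dg_mult dg_diff dg_eq_iff fz_x' divide_inverse mult.commute)
  show ?case using z(1)
    by (simp add: KEF_mult z(2) Eg left_diff_distrib right_diff_distrib mult.assoc)
next
  case (w u)
  have Eg: "F w = dg (- m) x' * w - K' w * dg (- m) x'"
    unfolding F_w K'_w unfolding op_w_def
    by (simp add: sc_mult_dg dg_mult dg_diff) (rule band_eqI, auto simp: fw_x' ent_dg ent_simps)
  show ?case using w(1)
    by (simp add: KEF_mult w(2) Eg left_diff_distrib right_diff_distrib mult.assoc)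
next
  case (add u v)
  show ?case using add(1,2) by (simp add: KEF_add add(3,4) distrib_left distrib_right)
qed

text \<open>XX' is \<open>dg 0 h\<close>, and X'X has the entries h (i + m); the combination X'X -
  q^-2 XX' is thus expressed by h alone.\<close>

definition h :: "int \<Rightarrow> complex" where "h i = x i * x' (i - m)"

abbreviation "c0 \<equiv> 1 / (q - inverse q)"

text \<open>The relation between e and f, evaluated at z and read on diagonal 1. With T the diagonal
  of X'X - q^-2 XX' it says l T(i) - T(i - 1)/l = c0 (l - 1/l).\<close>

lemma h_commutation:
  "l * (h (i + m) - h i / q^2) - (h (i + m - 1) - h (i - 1) / q^2) / l = c0 * (l - 1 / l)"
proof -
  let ?X = "dg m x" and ?X' = "dg (- m) x'"
  have Kdg: "K (F op_z) = sc (l / q^2) * F op_z" "K' (E op_z) = sc (1 / (l * q^2)) * E op_z"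
  proof -
    show "K (F op_z) = sc (l / q^2) * F op_z"
      using KEF_relations(4)[of op_z] by (simp add: K_z KEF_sc divide_inverse mult.commute)
    have "l powi (m + 1) = l * q^2"
      using l_m by (simp add: power_int_add)
    then have "l powi (- (m + 1)) = 1 / (l * q^2)"
      by (simp only: power_int_minus inverse_eq_divide)
    then show "K' (E op_z) = sc (1 / (l * q^2)) * E op_z"
      by (intro band_eqI) (simp only: ent_K'[OF KEF_mem(3)[OF disc_ops_closed(1)]] ent_sc_mult, simp add: E_z ent_dg)
  qed
  have "E (F op_z) - F (E op_z) = sc c0 * (sc l * op_z - sc (inverse l) * op_z)"
    using KEF_relations(5)[of op_z] by (simp add: K_z K'_z)
  moreover have "E (F op_z) = F op_z * ?X - ?X * (sc (l / q^2) * F op_z)"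
    by (simp add: E_inner Kdg)
  moreover have "F (E op_z) = ?X' * E op_z - sc (1 / (l * q^2)) * E op_z * ?X'"
    by (simp add: F_inner Kdg)
  ultimately have "F op_z * ?X - ?X * (sc (l / q^2) * F op_z) -
      (?X' * E op_z - sc (1 / (l * q^2)) * E op_z * ?X') =
      sc c0 * (sc l * op_z - sc (inverse l) * op_z)" by simp
  then have "ent (F op_z * ?X - ?X * (sc (l / q^2) * F op_z) -
      (?X' * E op_z - sc (1 / (l * q^2)) * E op_z * ?X')) 1 i =
      ent (sc c0 * (sc l * op_z - sc (inverse l) * op_z)) 1 i" by simp
  then have *: "fz i * x (i - (1 - m)) - x i * (l / q^2 * fz (i - m)) -
      (x' i * ez (i + m) - 1 / (l * q^2) * ez i * x' (i - m - 1)) = c0 * (l - inverse l)"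
    unfolding F_z E_z unfolding op_z_def mult.assoc
    by (simp add: sc_mult_dg dg_mult ent_simps ent_dg mult.assoc algebra_simps)
       (simp add: diff_divide_distrib algebra_simps)
  have "l * (h (i + m) - h i / q^2) - (h (i + m - 1) - h (i - 1) / q^2) / l =
      fz i * x (i - (1 - m)) - x i * (l / q^2 * fz (i - m)) -
      (x' i * ez (i + m) - 1 / (l * q^2) * ez i * x' (i - m - 1))"
    unfolding h_def fz_x' ez_x by (simp add: field_simps)
  then show ?thesis unfolding * by (simp add: inverse_eq_divide)
qed

text \<open>By \<open>h_commutation\<close>, passing from i - 1 to i multiplies g = T - c0 by l^-2.
  After m steps the factor is l^(-2m) = q^-4, a constant in which l no longer appears.\<close>

lemma h_recurrence:
  "h (i + 2 * m) - h (i + m) / q^2 - c0 = (h (i + m) - h i / q^2 - c0) / q^4"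
proof -
  define g where "g i = h (i + m) - h i / q^2 - c0" for i
  have step: "g i = l powi (-2) * g (i - 1)" for i
  proof -
    have "i + m - 1 = i - 1 + m" by simp
    then have "l * (g i + c0) - (g (i - 1) + c0) / l = c0 * (l - 1 / l)"
      using h_commutation[of i] unfolding g_def \<open>i + m - 1 = i - 1 + m\<close> by simp
    moreover have "a = l powi (-2) * b" if "l * (a + c) - (b + c) / l = c * (l - 1 / l)" for a b c
      using that by (simp add: power_int_minus field_simps power2_eq_square)
    ultimately show ?thesis by blast
  qed
  have g0: "g i = l powi (- 2 * i) * g 0" for i
  proof (induction i rule: int_induct[of _ 0])
    case (step1 i)
    have "g (i + 1) = l powi (-2) * g i" using step[of "i + 1"] by simp
    then show ?case using step1 by (simp add: power_int_diff power_int_minus field_simps)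
  next
    case (step2 i)
    have "g (i - 1) = l powi 2 * g i" using step[of i] by (simp add: power_int_minus)
    then show ?case using step2 by (simp add: power_int_diff power_int_add power_int_minus field_simps)
  qed simp
  have "l powi (- 2 * (i + m)) = l powi (- 2 * i) * l powi (m * (-2))"
    by (simp add: algebra_simps flip: power_int_add)
  also have "l powi (m * (-2)) = 1 / q^4"
    unfolding power_int_mult l_m by (simp add: power_int_minus divide_inverse flip: power_mult)
  finally have "g (i + m) = g i / q^4" unfolding g0[of "i + m"] g0[of i] by simp
  then show ?thesis by (simp add: g_def algebra_simps)
qed

end


context quantum_disc
begin

lemma dg_in_disc:
  assumes "dg k g \<in> disc_ops"
  obtains P where "\<And>i. g i = poly (P * pf q k) (s i)"
proof -
  have "ent (dg k g) n i = 0" if "n \<noteq> k" for n i using that by (simp add: ent_dg)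
  then obtain P where "dg k g = dg k (\<lambda>i. poly (P * pf q k) (s i))"
    using disc_homogeneous[OF assms] by metis
  then have "g i = poly (P * pf q k) (s i)" for i by (metis dg_eq_iff)
  then show ?thesis by (rule that)
qed

lemma poly_pf_0: "poly (pf q n) 0 = 1"
  by (simp add: pf_def poly_prod)

lemma pf_minus_1: "pf q (-1) = [:1, - 1 / q^2:]"
  by (simp add: pf_def power_int_minus inverse_eq_divide)

text \<open>0 is not among the s i, so evaluation at y = 0 is available only through the identity of
  polynomials.\<close>

lemma at_0_of_s:
  assumes "\<And>i. poly P (s i) = poly R (s i)" shows "poly P 0 = poly R 0"
  using poly_eqI_s[OF assms] by simp

end

section \<open>Coefficients of h and the possible degrees\<close>

context nontrivial_action
begin

text \<open>The power s i^e clears the denominators of h. In the recurrence the coefficient of y^j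
  is multiplied by (u - q^-2)(u - q^-4) with u = q^(-2m(j - e)). For j = e, where u = 1, the
  constant c0 fixes the coefficient; for other j one of the two factors has to vanish.\<close>

lemma h_poly_coeffs:
  assumes H: "\<And>i. poly H (s i) = s i ^ e * h i"
  shows "coeff H e * (1 - 1 / q^2) = c0"
    and "j \<noteq> e \<Longrightarrow> coeff H j \<noteq> 0 \<Longrightarrow> m * (int j - int e) = 1 \<or> m * (int j - int e) = 2"
proof -
  define t where "t = inverse r"
  have t: "t \<noteq> 0" "s (i + m) = t * s i" "s (i + 2 * m) = t * (t * s i)" for i
    using r(1) r(4)[of i] r(4)[of "i + m"] unfolding mult_2 add.assoc[symmetric]
    by (simp_all add: t_def divide_inverse mult_ac)
  have h: "h i = poly H (s i) / s i ^ e" for i using H[of i] by simp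
  let ?L = "smult (inverse (t ^ e * t ^ e)) (dilate (t * t) H) - smult (inverse (q^2 * t ^ e)) (dilate t H)
      - monom c0 e"
  let ?R = "smult (inverse (q^4)) (smult (inverse (t ^ e)) (dilate t H) - smult (inverse (q^2)) H - monom c0 e)"
  have "?L = ?R"
  proof (rule poly_eqI_s)
    fix i
    have "s i ^ e * (h (i + 2 * m) - h (i + m) / q^2 - c0) =
        s i ^ e * ((h (i + m) - h i / q^2 - c0) / q^4)"
      using h_recurrence[of i] by simp
    then have "s i ^ e * h (i + 2 * m) - s i ^ e * h (i + m) * inverse (q^2) - c0 * s i ^ e =
        inverse (q^4) * (s i ^ e * h (i + m) - s i ^ e * h i * inverse (q^2) - c0 * s i ^ e)"
      by (simp add: right_diff_distrib mult_ac divide_inverse)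
    moreover have "s i ^ e * h (i + 2 * m) = poly H (t * (t * s i)) * inverse (t ^ e * t ^ e)"
      "s i ^ e * h (i + m) = poly H (t * s i) * inverse (t ^ e)" "s i ^ e * h i = poly H (s i)"
      unfolding h t(2,3) using t(1) by (simp_all add: power_mult_distrib field_simps)
    ultimately show "poly ?L (s i) = poly ?R (s i)"
      by (simp only: poly_monom poly_pcompose poly_diff poly_smult) (simp add: mult_ac)
  qed
  then have coeffs: "coeff ?L j = coeff ?R j" for j by simp
  define u where "u j = t ^ j * inverse (t ^ e)" for j
  have key: "coeff H j * ((u j - inverse (q^2)) * (u j - inverse (q^4))) =
      (if j = e then c0 * (1 - inverse (q^4)) else 0)" for j
  proof -
    have L: "coeff ?L j = coeff H j * (u j * u j) - inverse (q^2) * coeff H j * u j - (if j = e then c0 else 0)"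
      by (simp add: coeff_pcompose_linear u_def power_mult_distrib mult_ac)
    have R: "coeff ?R j = inverse (q^4) * (coeff H j * u j - inverse (q^2) * coeff H j - (if j = e then c0 else 0))"
      by (simp add: coeff_pcompose_linear u_def mult_ac)
    have "a * ((v - A) * (v - B)) = c * (1 - B)"
      if "a * (v * v) - A * a * v - c = B * (a * v - A * a - c)" for a v A B c :: complex
      using that by (simp add: algebra_simps)
    from this[OF coeffs[of j, unfolded L R]] show ?thesis by simp
  qed
  have q4: "q^4 \<noteq> 1" using q_not_root[of 4] by simp
  have "u e = 1" using t(1) by (simp add: u_def)
  then have "coeff H e * (1 - inverse (q^2)) * (1 - inverse (q^4)) = c0 * (1 - inverse (q^4))"
    using key[of e] by (simp only: mult.assoc if_True refl)
  moreover have "1 - inverse (q^4) \<noteq> 0" using q4 by simp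
  ultimately have "coeff H e * (1 - inverse (q^2)) = c0" by (rule mult_right_cancel[THEN iffD1, rotated])
  then show "coeff H e * (1 - 1 / q^2) = c0" by (simp only: inverse_eq_divide)
  assume j: "j \<noteq> e" "coeff H j \<noteq> 0"
  have uj: "u j = q powi (- 2 * (m * (int j - int e)))"
  proof -
    have "t = q powi (- 2 * m)" by (simp add: t_def r_def power_int_minus)
    then have "t ^ k = q powi (- 2 * m * int k)" for k
      using power_int_mult[of q "- 2 * m" "int k"] by simp
    then have "u j = q powi (- 2 * m * int j - (- 2 * m * int e))"
      by (simp only: u_def power_int_diff q_nonzero simp_thms divide_inverse)
    also have "- 2 * m * int j - (- 2 * m * int e) = - 2 * (m * (int j - int e))"
      by (simp add: algebra_simps)
    finally show ?thesis .
  qed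
  have "u j = q powi (-2) \<or> u j = q powi (-4)"
    using key[of j] j by (auto simp: power_int_minus)
  then show "m * (int j - int e) = 1 \<or> m * (int j - int e) = 2"
    unfolding uj powi_eq_iff by auto
qed

lemma disc_KEF_gens: "E y \<in> disc_ops" "E op_z \<in> disc_ops" "F y \<in> disc_ops" "F w \<in> disc_ops"
  by simp_all

lemma deg1: "degree (P :: complex poly) \<le> 1 \<Longrightarrow> P = [:coeff P 0, coeff P 1:]"
  by (rule poly_eqI) (auto simp: coeff_pCons coeff_eq_0 split: nat.splits)

text \<open>Invariance of the disc at z and \<open>w\<close> makes e(y) and f(y) divisible by y, so
  x and x' are polynomials in y and h needs no denominator. The degree of H is then deg A' + deg C'
  + m, to be compared with the exponents that \<open>h_poly_coeffs\<close> admits. The distribution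
  of the one remaining degree between A' and C' separates the two series.\<close>

lemma positive_weight:
  assumes "m > 0"
  shows "(\<exists>b0 b1. b0 \<noteq> 0 \<and> series_1a q b0 b1 \<pi>) \<or> (\<exists>a0 a1. a0 \<noteq> 0 \<and> series_1b q a0 a1 \<pi>)"
proof -
  obtain A where "\<And>i. ey i = poly (A * pf q m) (s i)"
    using dg_in_disc disc_KEF_gens(1) unfolding E_y by metis
  then have A: "\<And>i. ey i = poly A (s i)" using assms by (simp add: pf_nonneg)
  obtain B where "\<And>i. ez i = poly (B * pf q (m + 1)) (s i)"
    using dg_in_disc disc_KEF_gens(2) unfolding E_z by metis
  then have B: "\<And>i. ez i = poly B (s i)" using assms by (simp add: pf_nonneg)
  obtain C where C: "\<And>i. fy i = poly (C * pf q (- m)) (s i)"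
    using dg_in_disc disc_KEF_gens(3) unfolding F_y by metis
  obtain D where D: "\<And>i. fw i = poly (D * pf q (- 1 - m)) (s i)"
    using dg_in_disc disc_KEF_gens(4) unfolding F_w by metis
  have lq: "l * q^2 \<noteq> 1"
  proof
    assume "l * q^2 = 1"
    then have "l = q powi (-2)" by (simp add: power_int_minus field_simps)
    then have "q powi (-2 * m) = q powi 2" using l_m power_int_mult[of q "-2" m] by simp
    then show False unfolding powi_eq_iff using assms by simp
  qed
  \<comment> \<open>This is \<open>ez_x\<close> times (1 - r) s i. At y = 0 the left side vanishes
    because of its factor y, which leaves (q^-2 - l) A(0) = 0.\<close>
  have "poly (smult (1 - r) ([:0, 1:] * B)) (s i) =
      poly (smult (inverse (q^2)) (dilate (q^2) A) - smult l A) (s i)" for i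
  proof -
    have "(1 - r) * (s i * ez i) = inverse (q^2) * ey (i - 1) - l * ey i"
      by (simp add: ez_x ey_x s_simps field_simps)
    then show ?thesis
      unfolding A B by (simp add: poly_pcompose s_simps mult_ac)
  qed
  from at_0_of_s[OF this] have "inverse (q^2) * poly A 0 - l * poly A 0 = 0"
    by (simp add: poly_pcompose)
  moreover have "q^2 * (inverse (q^2) * a - l * a) = (1 - l * q^2) * a" for a
    by (simp add: field_simps)
  ultimately have "(1 - l * q^2) * poly A 0 = 0" by (metis mult_zero_right)
  then have "poly A 0 = 0" using lq by simp
  then obtain A' where A': "A = [:0, 1:] * A'" using poly_eq_0_iff_dvd[of A 0] by (auto simp: dvd_def)
  define P G where "P = C * pf q (- m)" and "G = D * pf q (- 1 - m)"
  \<comment> \<open>Likewise \<open>fw_x'\<close> times (1 - r)/r s i; as \<open>pf\<close> is 1 at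
    0, evaluation there gives (1 - l q^2) C(0) = 0.\<close>
  have "poly (smult ((1 - r) / r) ([:0, 1:] * G)) (s i) =
      poly (P * [:1, - inverse (r * q^2):]
        - smult (l * q^2) ([:1, - inverse (q^2):] * dilate (inverse (q^2)) P)) (s i)" for i
  proof -
    have "(1 - r) / r * (s i * fw i) =
        fy i * (1 - s i * inverse (r * q^2)) - l * q^2 * ((1 - s i * inverse (q^2)) * fy (i + 1))"
      using r(1) by (simp add: fw_x' fy_x' s_simps r(4)) (simp add: field_simps)
    moreover have "fy i = poly P (s i)" "fw i = poly G (s i)" by (simp_all only: C D P_def G_def)
    moreover have "fy (i + 1) = poly (dilate (inverse (q^2)) P) (s i)"
      by (simp only: C P_def[symmetric] poly_pcompose s_simps) (simp add: field_simps)
    ultimately show ?thesis by (simp add: right_diff_distrib left_diff_distrib mult_ac)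
  qed
  from at_0_of_s[OF this] have "poly C 0 * (1 - l * q^2) = 0"
    by (simp add: P_def poly_pcompose poly_pf_0 algebra_simps)
  then have "poly C 0 = 0" using lq by simp
  then obtain C' where C': "C = [:0, 1:] * C'" using poly_eq_0_iff_dvd[of C 0] by (auto simp: dvd_def)
  have x: "x i = poly A' (s i) / (1 - r)" for i
  proof -
    have "s i * poly A' (s i) = s i * ((1 - r) * x i)"
      using ey_x[of i] by (simp add: A A' mult_ac)
    then have "poly A' (s i) = (1 - r) * x i" using mult_left_cancel[OF s_nonzero] by blast
    then show ?thesis using r(2) by simp
  qed
  have x': "x' i = r / (1 - r) * poly (C' * pf q (- m)) (s i)" for i
  proof -
    have "s i * poly (C' * pf q (- m)) (s i) = s i * ((1 - r) / r * x' i)"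
      using fy_x'[of i] by (simp add: C C' mult_ac)
    then have "poly (C' * pf q (- m)) (s i) = (1 - r) / r * x' i"
      using mult_left_cancel[OF s_nonzero] by blast
    then show ?thesis using r(1,2) by simp
  qed
  define H where "H = smult (r / (1 - r)^2) (A' * dilate r (C' * pf q (- m)))"
  have "poly H (s i) = s i ^ 0 * h i" for i
    by (simp add: h_def x x' H_def poly_pcompose r(3) power2_eq_square mult_ac)
  note H = h_poly_coeffs[OF this]
  have "coeff H 0 \<noteq> 0" using H(1) c_nonzero by (metis mult_zero_left)
  then have nz: "A' \<noteq> 0" "C' \<noteq> 0" "H \<noteq> 0" by (auto simp: H_def)
  have deg: "degree H = degree A' + degree C' + nat m"
    using nz r(1,2) unfolding H_def
    by (simp add: degree_mult_eq degree_pcompose pcompose_eq_0_iff pf_nonzero degree_pf)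
  then have "degree H \<noteq> 0" using assms by simp
  moreover have "coeff H (degree H) \<noteq> 0" using nz by simp
  ultimately have md: "m * int (degree H) = 1 \<or> m * int (degree H) = 2"
    using H(2)[of "degree H"] by simp
  \<comment> \<open>deg H is at least m, so m \<ge> 2 would make m deg H at least 4.\<close>
  have "m = 1"
  proof (rule ccontr)
    assume "m \<noteq> 1"
    then have "m \<ge> 2" "int (degree H) \<ge> 2" using assms deg by linarith+
    then have "m * int (degree H) \<ge> 2 * 2" by (intro mult_mono) auto
    then show False using md by auto
  qed
  then have l: "l = q^2" using l_m by simp
  have r_eq: "r = q^2" unfolding r_def by (simp add: \<open>m = 1\<close>)
  have "degree A' + degree C' \<le> 1" using md deg \<open>m = 1\<close> by auto
  then have cases: "degree A' = 0 \<and> degree C' \<le> 1 \<or> degree C' = 0 \<and> degree A' \<le> 1" by linarith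
  define a0 a1 c1 c2 where "a0 = coeff A' 0" and "a1 = coeff A' 1" and "c1 = coeff C' 0" and "c2 = coeff C' 1"
  have "degree A' \<le> 1" "degree C' \<le> 1" using cases by auto
  then have forms: "A' = [:a0, a1:]" "C' = [:c1, c2:]"
    unfolding a0_def a1_def c1_def c2_def by (blast intro: deg1)+
  \<comment> \<open>The constant term of H is prescribed by the recurrence; this is the origin of a0
    c1 = q, which lets one series parameter appear inverted in the formulas.\<close>
  have "coeff H 0 = r / (1 - r)^2 * (a0 * c1)"
    unfolding H_def forms poly_0_coeff_0[symmetric] by (simp add: poly_pcompose poly_pf_0)
  then have "q^2 / (1 - q^2)^2 * (a0 * c1) * (1 - 1 / q^2) = - q / (1 - q^2)"
    using H(1) unfolding r_eq c_eq by simp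
  moreover have "1 - q^2 \<noteq> 0" using q2 by simp
  moreover have "q^2 / (1 - q^2)^2 * (a0 * c1) * (1 - 1 / q^2) = - (a0 * c1) / (1 - q^2)"
    using \<open>1 - q^2 \<noteq> 0\<close> by (simp add: divide_simps) (simp add: algebra_simps power2_eq_square)
  ultimately have ac: "a0 * c1 = q" by simp
  then have nz: "a0 \<noteq> 0" "c1 \<noteq> 0" by auto
  then have a0_eq: "a0 = q / c1" and c1_eq: "c1 = q / a0"
    unfolding ac[symmetric] by simp_all
  have x_eq: "x i = (a0 + a1 * s i) / (1 - q^2)"
    and x'_eq: "x' i = q^2 / (1 - q^2) * (c1 + c2 * s i) * (1 - s i / q^2)" for i
    unfolding x x' forms r_eq unfolding \<open>m = 1\<close> pf_minus_1
    by (simp_all add: mult_ac del: mult_pCons_left mult_pCons_right)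
  from cases show ?thesis
  proof
    assume "degree A' = 0 \<and> degree C' \<le> 1"
    then have "a1 = 0" by (simp add: a1_def coeff_eq_0)
    have X: "x = (\<lambda>_. q / (c1 * (1 - q^2)))"
      unfolding fun_eq_iff x_eq \<open>a1 = 0\<close> a0_eq by simp
    have X': "x' = (\<lambda>i. (1 - s i / q^2) * (c1 + c2 * s i) * q^2 / (1 - q^2))"
      by (simp add: fun_eq_iff x'_eq mult_ac)
    have "series_1a q c1 c2 \<pi>"
      unfolding series_1a_def
      using acts_formulas[unfolded X X', unfolded l \<open>m = 1\<close>, OF formulas_1a[OF nz(2), of c2]]
      by blast
    then show ?thesis using nz by blast
  next
    assume "degree C' = 0 \<and> degree A' \<le> 1"
    then have "c2 = 0" by (simp add: c2_def coeff_eq_0)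
    have "(a0 / q^2 + q^2 * (a1 / q^4) * t) * q^2 = a0 + a1 * t" for t
      by (simp add: field_simps power2_eq_square power4_eq_xxxx)
    then have X: "x = (\<lambda>i. (a0 / q^2 + q^2 * (a1 / q^4) * s i) * q^2 / (1 - q^2))"
      by (simp only: fun_eq_iff x_eq simp_thms)
    have X': "x' = (\<lambda>i. (1 - s i / q^2) * q / (a0 / q^2 * (1 - q^2)))"
      unfolding fun_eq_iff x'_eq \<open>c2 = 0\<close> c1_eq by (simp add: mult_ac)
    have a0: "a0 / q^2 \<noteq> 0" using nz by simp
    \<comment> \<open>\<open>formulas_1b\<close> writes (1 - q^2) x as q^2 times its first parameter
      plus q^4 s i times its second one; hence the divisions by q^2 and q^4.\<close>
    have "series_1b q (a0 / q^2) (a1 / q^4) \<pi>"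
      unfolding series_1b_def
      using acts_formulas[unfolded X X', unfolded l \<open>m = 1\<close>, OF formulas_1b[OF a0, of "a1 / q^4"]]
      by blast
    then show ?thesis using a0 by blast
  qed
qed

text \<open>x and x' may now have a simple pole at y = 0, so h is multiplied by y^2. The coefficient
  of y^2 in H is nonzero, and an exponent j > 2 would make m (j - 2) negative; hence deg A + deg C +
  |m| = deg H = 2.\<close>

lemma negative_weight:
  assumes "m < 0"
  shows "(\<exists>b0 b1. b1 \<noteq> 0 \<and> series_m1a q b0 b1 \<pi>) \<or> (\<exists>a0 a1. a1 \<noteq> 0 \<and> series_m1b q a0 a1 \<pi>)"
proof -
  obtain A where A: "\<And>i. ey i = poly (A * pf q m) (s i)"
    using dg_in_disc disc_KEF_gens(1) unfolding E_y by metis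
  obtain C where "\<And>i. fy i = poly (C * pf q (- m)) (s i)"
    using dg_in_disc disc_KEF_gens(3) unfolding F_y by metis
  then have C: "\<And>i. fy i = poly C (s i)" using assms by (simp add: pf_nonneg)
  have x: "x i = poly (A * pf q m) (s i) / ((1 - r) * s i)" for i
  proof -
    have "(1 - r) * s i \<noteq> 0" using r(2) by simp
    then show ?thesis unfolding A[symmetric] ey_x by simp
  qed
  have x': "x' i = r * poly C (s i) / ((1 - r) * s i)" for i
  proof -
    have "r * fy i = (1 - r) * s i * x' i" using r(1) by (simp add: fy_x')
    moreover have "(1 - r) * s i \<noteq> 0" using r(2) by simp
    ultimately show ?thesis unfolding C by simp
  qed
  define H where "H = smult (1 / (1 - r)^2) (A * pf q m * dilate r C)"
  have "poly H (s i) = s i ^ 2 * h i" for i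
    using r(1,2) by (simp add: h_def x x' H_def poly_pcompose r(3) power2_eq_square mult_ac)
  note H = h_poly_coeffs[OF this]
  have H2: "coeff H 2 \<noteq> 0" using H(1) c_nonzero by (metis mult_zero_left)
  then have nz: "A \<noteq> 0" "C \<noteq> 0" "H \<noteq> 0" by (auto simp: H_def)
  have deg: "degree H = degree A + degree C + nat (- m)"
    using nz r(1,2) unfolding H_def
    by (simp add: degree_mult_eq degree_pcompose pcompose_eq_0_iff pf_nonzero degree_pf)
  have "degree H \<ge> 2" using H2 by (rule le_degree)
  have "degree H = 2"
  proof (rule ccontr)
    assume "degree H \<noteq> 2"
    moreover have "coeff H (degree H) \<noteq> 0" using nz by simp
    ultimately have "m * (int (degree H) - 2) = 1 \<or> m * (int (degree H) - 2) = 2"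
      using H(2)[of "degree H"] by simp
    moreover have "m * (int (degree H) - 2) < 0"
      using assms \<open>degree H \<ge> 2\<close> \<open>degree H \<noteq> 2\<close> by (intro mult_neg_pos) auto
    ultimately show False by auto
  qed
  \<comment> \<open>Otherwise A and C are constant and the constant term of H is nonzero. Exponent 0
    then occurs in H, so -2m is 1 or 2, which again means m = -1.\<close>
  have "m = -1"
  proof (rule ccontr)
    assume "m \<noteq> -1"
    then have "degree A = 0" "degree C = 0" using deg \<open>degree H = 2\<close> assms by linarith+
    then have "poly A 0 \<noteq> 0" "poly C 0 \<noteq> 0" using nz by (auto elim!: degree_eq_zeroE)
    then have "coeff H 0 \<noteq> 0"
      using r(2) unfolding H_def poly_0_coeff_0[symmetric] by (simp add: poly_pcompose poly_pf_0)
    then have "m * (int 0 - int 2) = 1 \<or> m * (int 0 - int 2) = 2" by (intro H(2)) auto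
    then show False using \<open>m \<noteq> -1\<close> by presburger
  qed
  have "inverse l = q^2" using l_m \<open>m = -1\<close> by (simp add: power_int_minus)
  then have l: "l = inverse (q^2)" by (metis inverse_inverse_eq)
  have r_eq: "r = 1 / q^2"
    unfolding r_def by (simp add: \<open>m = -1\<close> power_int_minus inverse_eq_divide)
  have "degree A + degree C = 1" using deg \<open>degree H = 2\<close> \<open>m = -1\<close> by simp
  then have cases: "degree A = 0 \<and> degree C = 1 \<or> degree C = 0 \<and> degree A = 1" by linarith
  define a0 a1 c1 c2 where "a0 = coeff A 0" and "a1 = coeff A 1" and "c1 = coeff C 0" and "c2 = coeff C 1"
  have "degree A \<le> 1" "degree C \<le> 1" using cases by auto
  then have forms: "A = [:a0, a1:]" "C = [:c1, c2:]"
    unfolding a0_def a1_def c1_def c2_def by (blast intro: deg1)+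
  have q1: "q * q \<noteq> 1" "1 \<noteq> q * q" using q2 by (auto simp: power2_eq_square)
  have x_eq: "x i = q^2 * (1 - s i / q^2) * (a0 + a1 * s i) / (s i * (q^2 - 1))"
    and x'_eq: "x' i = (c1 + c2 * s i) / (s i * (q^2 - 1))" for i
    unfolding x x' forms r_eq unfolding \<open>m = -1\<close> pf_minus_1
    using q1 by (simp_all add: power2_eq_square divide_simps) (simp_all add: algebra_simps)
  have coeff2: "coeff H 2 = 1 / (1 - 1 / q^2)^2 * (- (1 / q^2) * (a0 * c2 / q^2 + a1 * c1) + a1 * c2 / q^2)"
    unfolding H_def forms r_eq unfolding \<open>m = -1\<close> pf_minus_1
    by (simp add: numeral_2_eq_2 pcompose_pCons algebra_simps)
  \<comment> \<open>The coefficient of y^2 in A(y) (1 - y/q^2) C(y/q^2). The value that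
    \<open>h_poly_coeffs\<close> prescribes for the coefficient of H at y^2 makes it 1/q.\<close>
  define B where "B = - (1 / q^2) * (a0 * c2 / q^2 + a1 * c1) + a1 * c2 / q^2"
  have B: "B = 1 / q"
  proof -
    define u where "u = 1 - 1 / q^2"
    have u: "u \<noteq> 0" "1 - q^2 = - (q^2 * u)" using q2 by (simp_all add: u_def right_diff_distrib)
    have "1 / u^2 * B * u = - q / (1 - q^2)"
      using H(1) unfolding coeff2 c_eq B_def u_def .
    moreover have "1 / u^2 * B * u = B / u" "- q / (- (q^2 * u)) = (1 / q) / u"
      using u(1) by (simp_all add: power2_eq_square)
    ultimately have "B / u = (1 / q) / u" unfolding u(2) by (simp only:)
    then show ?thesis using u(1) by (metis divide_cancel_right)
  qed
  from cases show ?thesis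
  proof
    assume "degree A = 0 \<and> degree C = 1"
    then have a1: "a1 = 0" by (simp add: a1_def coeff_eq_0)
    have "coeff C (degree C) \<noteq> 0" using nz by simp
    then have c2: "c2 \<noteq> 0" using \<open>degree A = 0 \<and> degree C = 1\<close> by (simp add: c2_def)
    have "a0 * c2 = - (q ^ 3)"
    proof -
      have "a0 * c2 = - (q^2 * q^2) * B" by (simp add: B_def a1)
      then show ?thesis by (simp add: B power2_eq_square power3_eq_cube)
    qed
    then have a0: "a0 = - (q ^ 3) / c2" by (simp only: nonzero_eq_divide_eq[OF c2])
    have X: "x = (\<lambda>i. q ^ 3 * (1 - s i / q^2) / (c2 / q^2 * s i * (1 - q^2)))"
    proof -
      have "q^2 * v * (- (q ^ 3) / c2 + 0 * t) / (t * (- d)) = q ^ 3 * v / (c2 / q^2 * t * d)" for v t d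
        by (simp add: mult_ac)
      from this[where d = "1 - q^2"] show ?thesis unfolding fun_eq_iff x_eq a0 a1 by simp
    qed
    have X': "x' = (\<lambda>i. (c1 + q^2 * (c2 / q^2) * s i) / (s i * (q^2 - 1)))"
      by (simp add: fun_eq_iff x'_eq)
    have b1: "c2 / q^2 \<noteq> 0" using c2 by simp
    \<comment> \<open>The numerator of x' in \<open>formulas_m1a\<close> is b0 + q^2 b1 s i, to be
      matched with c1 + c2 s i.\<close>
    have "series_m1a q c1 (c2 / q^2) \<pi>"
      unfolding series_m1a_def
      using acts_formulas[unfolded X X', unfolded l \<open>m = -1\<close> inverse_inverse_eq, OF formulas_m1a[OF b1, of c1]]
      by blast
    then show ?thesis using b1 by blast
  next
    assume "degree C = 0 \<and> degree A = 1"
    then have c2: "c2 = 0" by (simp add: c2_def coeff_eq_0)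
    have "coeff A (degree A) \<noteq> 0" using nz by simp
    then have a1: "a1 \<noteq> 0" using \<open>degree C = 0 \<and> degree A = 1\<close> by (simp add: a1_def)
    have "a1 * c1 = - q"
    proof -
      have "a1 * c1 = - (q^2) * B" by (simp add: B_def c2)
      then show ?thesis by (simp add: B power2_eq_square)
    qed
    then have c1: "c1 = - q / a1" by (simp only: nonzero_eq_divide_eq[OF a1] mult.commute[of c1 a1])
    have X: "x = (\<lambda>i. q^2 * (1 - s i / q^2) * (a0 + a1 * s i) / (s i * (q^2 - 1)))"
      by (simp add: fun_eq_iff x_eq)
    have X': "x' = (\<lambda>i. - q / (a1 * s i * (q^2 - 1)))"
      using a1 by (simp add: fun_eq_iff x'_eq c1 c2)
    have "series_m1b q a0 a1 \<pi>"
      unfolding series_m1b_def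
      using acts_formulas[unfolded X X', unfolded l \<open>m = -1\<close> inverse_inverse_eq, OF formulas_m1b[OF a1, of a0]]
      by blast
    then show ?thesis using a1 by blast
  qed
qed

end

context quantum_disc
begin

lemma classification:
  assumes "disc_symmetry q \<pi>"
  shows "series_0plus q \<pi> \<or> series_0minus q \<pi> \<or>
    (\<exists>b0 b1. b0 \<noteq> 0 \<and> series_1a q b0 b1 \<pi>) \<or> (\<exists>a0 a1. a0 \<noteq> 0 \<and> series_1b q a0 a1 \<pi>) \<or>
    (\<exists>b0 b1. b1 \<noteq> 0 \<and> series_m1a q b0 b1 \<pi>) \<or> (\<exists>a0 a1. a1 \<noteq> 0 \<and> series_m1b q a0 a1 \<pi>)"
proof -
  interpret disc_action q \<pi> by unfold_locales (rule assms)
  obtain l where l: "l \<noteq> 0" "K op_z = sc l * op_z" "K w = sc (inverse l) * w"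
    by (rule K_gens)
  interpret weighted_action q \<pi> l by unfold_locales (rule l)+
  show ?thesis
  proof (cases "\<exists>m. l powi m = q^2")
    case False
    then show ?thesis using trivial_case by blast
  next
    case True
    then obtain m where m: "l powi m = q^2" by blast
    interpret nontrivial_action q \<pi> l m by unfold_locales (rule m)
    consider "m > 0" | "m < 0" using m_nonzero by linarith
    then show ?thesis
    proof cases
      case 1
      from positive_weight[OF this] show ?thesis by blast
    next
      case 2
      from negative_weight[OF this] show ?thesis by blast
    qed
  qed
qed

end

theorem mainTheorem1:
  fixes q :: complex
  assumes "q \<noteq> 0"
    and "\<forall>n::nat. n > 0 \<longrightarrow> q ^ n \<noteq> 1"
  shows
    "(\<exists>!\<pi>. disc_symmetry q \<pi> \<and> series_0plus q \<pi>) \<and>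
     (\<exists>!\<pi>. disc_symmetry q \<pi> \<and> series_0minus q \<pi>) \<and>
     (\<forall>b0 b1. b0 \<noteq> 0 \<longrightarrow> (\<exists>!\<pi>. disc_symmetry q \<pi> \<and> series_1a q b0 b1 \<pi>)) \<and>
     (\<forall>a0 a1. a0 \<noteq> 0 \<longrightarrow> (\<exists>!\<pi>. disc_symmetry q \<pi> \<and> series_1b q a0 a1 \<pi>)) \<and>
     (\<forall>b0 b1. b1 \<noteq> 0 \<longrightarrow> (\<exists>!\<pi>. disc_symmetry q \<pi> \<and> series_m1a q b0 b1 \<pi>)) \<and>
     (\<forall>a0 a1. a1 \<noteq> 0 \<longrightarrow> (\<exists>!\<pi>. disc_symmetry q \<pi> \<and> series_m1b q a0 a1 \<pi>)) \<and>
     (\<forall>\<pi>. disc_symmetry q \<pi> \<longrightarrow>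
        series_0plus q \<pi> \<or>
        series_0minus q \<pi> \<or>
        (\<exists>b0 b1. b0 \<noteq> 0 \<and> series_1a q b0 b1 \<pi>) \<or>
        (\<exists>a0 a1. a0 \<noteq> 0 \<and> series_1b q a0 a1 \<pi>) \<or>
        (\<exists>b0 b1. b1 \<noteq> 0 \<and> series_m1a q b0 b1 \<pi>) \<or>
        (\<exists>a0 a1. a1 \<noteq> 0 \<and> series_m1b q a0 a1 \<pi>))"
proof -
  interpret quantum_disc q using assms by unfold_locales auto
  show ?thesis
    by (intro conjI allI impI)
       (rule ex1_series_0plus ex1_series_0minus ex1_series_1a ex1_series_1b ex1_series_m1a
         ex1_series_m1b classification; assumption?)+
qed

end
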